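(* Let $\nu>0$, $a=-2$ and $\omega_0\in\dot H^1$. Assume $B_{p}<+\infty$ for some integer $p>1$. If $\nu^3\ge 8C_*B_0$, where $C_*$ is the constant described in the context, then the stochastic process $(\omega_t)_{t\ge0}$, where $\omega$ is the solution with values in $X^1_\infty$ of $$\omega_t+a u\omega_x-u_x\omega-\nu\omega_{xx}=\xi_t,\qquad u_x=\mathcal{H}(\omega),\qquad\omega(0)=\omega_0,$$ is exponentially mixing in the sense of the dual Lipschitz distance based on $L^2$. That is, with $\mu$ the unique invariant measure on $\dot H^1$ of the associated transition semigroup $(P_t)_{t\ge0}$, there exist a rate $\lambda>0$ independent of $\omega_0$ and a finite constant $C(\omega_0)$ such that for every Lipschitz function $\varphi:H\to\mathbb{R}$ and every $t\ge0$ $$\Big|P_t\varphi(\omega_0)-\int_{\dot H^1}\varphi\,d\mu\Big|\le C(\omega_0)\,\|\varphi\|_{\mathrm{Lip}}\,e^{-\lambda t}.$$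
   Context: Notation: $\mathbb{N}=\{1,2,\dots\}$, $\mathbb{S}^1=\mathbb{R}/2\pi\mathbb{Z}$, $\mathbb{Z}^*=\mathbb{Z}\setminus\{0\}$. $H$ is the real Hilbert space of $u\in L^2(\mathbb{S}^1)$ with $\int_0^{2\pi}u\,dx=0$, with inner product $\langle u,v\rangle_H=\int_0^{2\pi}uv\,dx$ and orthonormal basis $e_k(x)=\pi^{-1/2}\cos(kx)$ for $k\ge1$, $e_k(x)=\pi^{-1/2}\sin(-kx)$ for $k\le-1$; $u_k=\langle u,e_k\rangle_H$. For $m\in\mathbb{N}$, $\dot H^m=\{u\in H:\|u\|_{\dot H^m}^2:=\sum_{k\in\mathbb{Z}^*}|k|^{2m}u_k^2<\infty\}$. $X_T^m=C([0,T];\dot H^m)$ with the sup norm, $X_\infty^m=C([0,\infty);\dot H^m)$. For $\varphi:H\to\mathbb{R}$ Lipschitz, $\|\varphi\|_{\mathrm{Lip}}$ is its Lipschitz constant with respect to $\|\cdot\|_H$. Hilbert transform: with complex Fourier coefficients $\hat u(k)=\frac1{2\pi}\int_0^{2\pi}u(x)e^{-ikx}dx$, $\widehat{\mathcal{H}(u)}(k)=-i\,\mathrm{sgn}(k)\hat u(k)$, $\mathrm{sgn}(0)=0$. In the equation, $u$ is the mean-zero function with $u_x=\mathcal{H}(\omega)$, i.e. $u=-(-\partial_x^2)^{-1/2}\omega$. Noise: $(\Omega,\mathcal{F},\mathbb{P},(\mathcal{F}_t)_{t\ge0})$ is a filtered probability space, $\{\beta_k\}_{k\in\mathbb{Z}^*}$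 are independent real Brownian motions adapted to $(\mathcal{F}_t)$ whose increments after time $s$ are independent of $\mathcal{F}_s$ for every $s\ge 0$; $\{b_k\}_{k\in\mathbb{Z}^*}$ is a fixed real sequence, $\xi(t,x)=\sum_{k\in\mathbb{Z}^*}b_k\beta_k(t)e_k(x)$, $B_m=\sum_{k\in\mathbb{Z}^*}|k|^{2m}b_k^2$ and $B_0=\sum_{k\in\mathbb{Z}^*}b_k^2$. Solution: $\omega\in X_T^1$ is a solution on $[0,T]$ with initial value $\omega_0\in\dot H^1$ if, $\mathbb{P}$-a.s., for all $t\in[0,T]$, in $\dot H^1$, $$\omega(t)=e^{\nu t\partial_x^2}\omega_0+\int_0^te^{\nu(t-s)\partial_x^2}\{-a(u\omega)_x(s)+(1+a)(u_x\omega)(s)\}ds+\int_0^te^{\nu(t-s)\partial_x^2}d\xi(s),$$ where $e^{\nu t\partial_x^2}$ is the heat semigroup. For $a=-2$ and $B_p<\infty$ for some integer $p>1$, there is for each $y\in\dot H^1$ a unique adapted global solution $\omega(\cdot;y)\in X_\infty^1$ with $\omega(0)=y$. Transition semigroup: $P_tf(y)=\mathbb{E}[f(\omega(t;y))]$ for $y\in\dot H^1$ and $f:\dot H^1\to\mathbb{R}$ bounded Borel, or $f$ the restriction of a Lipschitz function on $H$. An invariant measure is a Borel probability measure $\mu$ on $\dot H^1$ with $\int P_tf\,d\mu=\int f\,d\mu$ for all $t\ge0$ and all bounded Borel $f$. Under the hypotheses of the claim it exists and is unique. Constant $C_*$: $C_*>0$ is a fixed absolute constant (such a constant exists) with the following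 property: for $a=-2$, every $\nu>0$, every noise with $B_p<\infty$ for some integer $p>1$, and any two solutions $\omega^{(1)},\omega^{(2)}\in X^1_\infty$ of the equation (driven by the same noise) with deterministic initial data $\omega_0^{(1)},\omega_0^{(2)}\in\dot H^1$, one has almost surely for all $t\ge0$ $$\|\omega^{(1)}(t)-\omega^{(2)}(t)\|_H^2\le\|\omega^{(1)}_0-\omega^{(2)}_0\|_H^2\exp\Big\{-\frac{\nu t}{4}+\frac{C_*}{\nu}\Big(\int_0^t\|\omega^{(1)}(s)\|_{\dot H^1}^2ds+\int_0^t\|\omega^{(2)}(s)\|_{\dot H^1}^2ds\Big)\Big\}.$$ *)

theory Defs
  imports "HOL-Probability.Probability"
begin

text \<open>The circle \<open>\<real> / 2 \<pi> \<int>\<close> with arc length, represented by the fundamental domain \<open>[0, 2 \<pi>)\<close>.\<close>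

definition circ :: "real measure" where
  "circ = restrict_space lborel {0..<2 * pi}"

lemma space_circ [simp]: "space circ = {0..<2 * pi}"
  by (simp add: circ_def space_restrict_space)

lemma emeasure_circ [simp]: "emeasure circ (space circ) = ennreal (2 * pi)"
  by (simp add: circ_def emeasure_restrict_space space_restrict_space)

lemma finite_measure_circ: "finite_measure circ"
  by (rule finite_measureI) (simp only: emeasure_circ, simp)

interpretation circ: finite_measure circ
  by (rule finite_measure_circ)

lemma measurable_circ: "f \<in> borel_measurable borel \<Longrightarrow> f \<in> borel_measurable circ"
  by (simp add: circ_def measurable_restrict_space1)

definition L2_mean0 :: "(real \<Rightarrow> real) set" where
  "L2_mean0 = {f \<in> borel_measurable circ. integrable circ (\<lambda>x. (f x)\<^sup>2) \<and> (\<integral>x. f x \<partial>circ) = 0}"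

lemma L2_mean0_D:
  assumes "f \<in> L2_mean0"
  shows "f \<in> borel_measurable circ" "integrable circ (\<lambda>x. (f x)\<^sup>2)" "(\<integral>x. f x \<partial>circ) = 0"
  using assms by (auto simp: L2_mean0_def)

lemma integrable_L2_mult:
  assumes "f \<in> borel_measurable circ" "integrable circ (\<lambda>x. (f x)\<^sup>2)"
    and "g \<in> borel_measurable circ" "integrable circ (\<lambda>x. (g x)\<^sup>2)"
  shows "integrable circ (\<lambda>x. f x * g x :: real)"
proof (rule Bochner_Integration.integrable_bound)
  show "integrable circ (\<lambda>x. (f x)\<^sup>2 + (g x)\<^sup>2)"
    using assms by simp
  have "\<bar>a * b\<bar> \<le> \<bar>a\<^sup>2 + b\<^sup>2\<bar>" for a b :: real
  proof -
    have "2 * (\<bar>a\<bar> * \<bar>b\<bar>) \<le> \<bar>a\<bar>\<^sup>2 + \<bar>b\<bar>\<^sup>2"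
      using sum_squares_bound[of "\<bar>a\<bar>" "\<bar>b\<bar>"] by (simp add: mult.assoc)
    moreover have "0 \<le> \<bar>a\<bar> * \<bar>b\<bar>" by simp
    ultimately show ?thesis
      unfolding abs_mult power2_abs by linarith
  qed
  then show "AE x in circ. norm (f x * g x) \<le> norm ((f x)\<^sup>2 + (g x)\<^sup>2)"
    by (auto intro!: AE_I2)
qed (use assms in measurable)

lemma integrable_L2:
  assumes "f \<in> borel_measurable circ" "integrable circ (\<lambda>x. (f x)\<^sup>2)"
  shows "integrable circ (f :: real \<Rightarrow> real)"
  using integrable_L2_mult[OF assms, of "\<lambda>_. 1"] by simp

lemma L2_mean0_add:
  assumes "f \<in> L2_mean0" "g \<in> L2_mean0"
  shows "(\<lambda>x. f x + g x) \<in> L2_mean0"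
proof -
  note f = L2_mean0_D[OF assms(1)] and g = L2_mean0_D[OF assms(2)]
  have [measurable]: "f \<in> borel_measurable circ" "g \<in> borel_measurable circ"
    using f g by auto
  have "integrable circ (\<lambda>x. (f x)\<^sup>2 + (g x)\<^sup>2 + 2 * (f x * g x))"
    using f g integrable_L2_mult[OF f(1,2) g(1,2)] by simp
  then show ?thesis
    unfolding L2_mean0_def
    using f g integrable_L2[OF f(1,2)] integrable_L2[OF g(1,2)]
    by (simp add: power2_sum mult.assoc)
qed

lemma L2_mean0_scale: "f \<in> L2_mean0 \<Longrightarrow> (\<lambda>x. c * f x) \<in> L2_mean0"
  by (auto simp: L2_mean0_def power_mult_distrib)

text \<open>\<open>hsp\<close> is the space \<open>H\<close> of mean-zero square-integrable functions modulo equality almost everywhere.\<close>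

quotient_type hsp = "real \<Rightarrow> real" /
    partial: "\<lambda>f g. f \<in> L2_mean0 \<and> g \<in> L2_mean0 \<and> (AE x in circ. f x = g x)"
  morphisms rep_hsp abs_hsp
proof (rule part_equivpI)
  show "\<exists>f. f \<in> L2_mean0 \<and> f \<in> L2_mean0 \<and> (AE x in circ. f x = f x)"
    by (rule exI[of _ "\<lambda>_. 0"]) (simp add: L2_mean0_def)
  show "symp (\<lambda>f g. f \<in> L2_mean0 \<and> g \<in> L2_mean0 \<and> (AE x in circ. f x = g x))"
    by (auto intro!: sympI elim: AE_mp)
  show "transp (\<lambda>f g. f \<in> L2_mean0 \<and> g \<in> L2_mean0 \<and> (AE x in circ. f x = g x))"
    by (rule transpI) (auto elim: AE_mp)
qed

lemma rep_hsp_L2: "rep_hsp u \<in> L2_mean0"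
  using Quotient3_rep_reflp[OF Quotient3_hsp] by auto

lemma rep_abs_hsp: "f \<in> L2_mean0 \<Longrightarrow> AE x in circ. rep_hsp (abs_hsp f) x = f x"
  using Quotient3_rep_abs[OF Quotient3_hsp, of f] by auto

lemma hsp_eqI: "AE x in circ. rep_hsp u x = rep_hsp v x \<Longrightarrow> u = v"
  using Quotient3_rel_rep[OF Quotient3_hsp, of u v] rep_hsp_L2 by blast

lemmas rep_hsp_D = L2_mean0_D[OF rep_hsp_L2]

lemma measurable_rep_hsp [measurable]: "rep_hsp u \<in> borel_measurable circ"
  by (rule rep_hsp_D)

lemma integrable_rep_hsp_mult: "integrable circ (\<lambda>x. rep_hsp u x * rep_hsp v x)"
  by (rule integrable_L2_mult) (rule rep_hsp_D)+

instantiation hsp :: real_inner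
begin

definition zero_hsp :: hsp where "0 = abs_hsp (\<lambda>_. 0)"
definition plus_hsp :: "hsp \<Rightarrow> hsp \<Rightarrow> hsp" where
  "u + v = abs_hsp (\<lambda>x. rep_hsp u x + rep_hsp v x)"
definition scaleR_hsp :: "real \<Rightarrow> hsp \<Rightarrow> hsp" where
  "c *\<^sub>R u = abs_hsp (\<lambda>x. c * rep_hsp u x)"
definition uminus_hsp :: "hsp \<Rightarrow> hsp" where "- u = (-1) *\<^sub>R (u :: hsp)"
definition minus_hsp :: "hsp \<Rightarrow> hsp \<Rightarrow> hsp" where "u - v = u + - (v :: hsp)"
definition inner_hsp :: "hsp \<Rightarrow> hsp \<Rightarrow> real" where
  "inner u v = (\<integral>x. rep_hsp u x * rep_hsp v x \<partial>circ)"
definition norm_hsp :: "hsp \<Rightarrow> real" where "norm u = sqrt (inner u (u :: hsp))"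
definition sgn_hsp :: "hsp \<Rightarrow> hsp" where "sgn u = inverse (norm u) *\<^sub>R (u :: hsp)"
definition dist_hsp :: "hsp \<Rightarrow> hsp \<Rightarrow> real" where "dist u v = norm (u - v :: hsp)"
definition uniformity_hsp :: "(hsp \<times> hsp) filter" where
  "(uniformity :: (hsp \<times> hsp) filter) = (INF e\<in>{0 <..}. principal {(u, v). dist u v < e})"
definition open_hsp :: "hsp set \<Rightarrow> bool" where
  "open U = (\<forall>u\<in>U. \<forall>\<^sub>F (u', v) in uniformity. u' = u \<longrightarrow> v \<in> (U :: hsp set))"

lemma rep_zero_hsp: "AE x in circ. rep_hsp 0 x = 0"
  unfolding zero_hsp_def by (rule rep_abs_hsp) (simp add: L2_mean0_def)

lemma rep_plus_hsp: "AE x in circ. rep_hsp (u + v) x = rep_hsp u x + rep_hsp v x"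
  unfolding plus_hsp_def by (rule rep_abs_hsp) (intro L2_mean0_add rep_hsp_L2)

lemma rep_scaleR_hsp: "AE x in circ. rep_hsp (c *\<^sub>R u) x = c * rep_hsp u x"
  unfolding scaleR_hsp_def by (rule rep_abs_hsp) (intro L2_mean0_scale rep_hsp_L2)

instance
proof
  fix u v w :: hsp and c d :: real
  show "u + v + w = u + (v + w)"
    using rep_plus_hsp[of "u + v" w] rep_plus_hsp[of u v] rep_plus_hsp[of u "v + w"] rep_plus_hsp[of v w]
    by (intro hsp_eqI) (auto elim!: AE_mp)
  show "u + v = v + u"
    using rep_plus_hsp[of u v] rep_plus_hsp[of v u]
    by (intro hsp_eqI) (auto elim!: AE_mp)
  show "0 + u = u"
    using rep_plus_hsp[of 0 u] rep_zero_hsp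
    by (intro hsp_eqI) (auto elim!: AE_mp)
  show "- u + u = 0"
    using rep_plus_hsp[of "- u" u] rep_zero_hsp rep_scaleR_hsp[of "-1" u]
    by (intro hsp_eqI) (auto elim!: AE_mp simp: uminus_hsp_def)
  show "u - v = u + - v"
    by (simp add: minus_hsp_def)
  show "c *\<^sub>R (u + v) = c *\<^sub>R u + c *\<^sub>R v"
    using rep_plus_hsp[of u v] rep_scaleR_hsp[of c "u + v"] rep_scaleR_hsp[of c u] rep_scaleR_hsp[of c v]
      rep_plus_hsp[of "c *\<^sub>R u" "c *\<^sub>R v"]
    by (intro hsp_eqI) (auto elim!: AE_mp simp: distrib_left)
  show "(c + d) *\<^sub>R u = c *\<^sub>R u + d *\<^sub>R u"
    using rep_scaleR_hsp[of "c + d" u] rep_scaleR_hsp[of c u] rep_scaleR_hsp[of d u]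
      rep_plus_hsp[of "c *\<^sub>R u" "d *\<^sub>R u"]
    by (intro hsp_eqI) (auto elim!: AE_mp simp: distrib_right)
  show "c *\<^sub>R d *\<^sub>R u = (c * d) *\<^sub>R u"
    using rep_scaleR_hsp[of c "d *\<^sub>R u"] rep_scaleR_hsp[of d u] rep_scaleR_hsp[of "c * d" u]
    by (intro hsp_eqI) (auto elim!: AE_mp)
  show "1 *\<^sub>R u = u"
    using rep_scaleR_hsp[of 1 u] by (intro hsp_eqI) (auto elim!: AE_mp)
  show "sgn u = inverse (norm u) *\<^sub>R u" by (simp add: sgn_hsp_def)
  show "dist u v = norm (u - v)" by (simp add: dist_hsp_def)
  show "(uniformity :: (hsp \<times> hsp) filter) = (INF e\<in>{0 <..}. principal {(u, v). dist u v < e})"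
    by (simp add: uniformity_hsp_def)
  show "open U = (\<forall>u\<in>U. \<forall>\<^sub>F (u', v) in uniformity. u' = u \<longrightarrow> v \<in> U)" for U :: "hsp set"
    by (simp add: open_hsp_def)
  show "norm u = sqrt (inner u u)" by (simp add: norm_hsp_def)
  show "inner u v = inner v u" by (simp add: inner_hsp_def mult.commute)
  show "0 \<le> inner u u" by (simp add: inner_hsp_def)
  show "inner (u + v) w = inner u w + inner v w"
  proof -
    have "inner (u + v) w = (\<integral>x. rep_hsp u x * rep_hsp w x + rep_hsp v x * rep_hsp w x \<partial>circ)"
      unfolding inner_hsp_def
      by (rule integral_cong_AE) (use rep_plus_hsp[of u v] in \<open>auto elim!: AE_mp simp: distrib_right\<close>)
    then show ?thesis
      by (simp add: inner_hsp_def integrable_rep_hsp_mult)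
  qed
  show "inner (c *\<^sub>R u) v = c * inner u v"
  proof -
    have "inner (c *\<^sub>R u) v = (\<integral>x. c * (rep_hsp u x * rep_hsp v x) \<partial>circ)"
      unfolding inner_hsp_def
      by (rule integral_cong_AE) (use rep_scaleR_hsp[of c u] in \<open>auto elim!: AE_mp\<close>)
    then show ?thesis
      by (simp add: inner_hsp_def)
  qed
  show "(inner u u = 0) = (u = 0)"
  proof
    assume "inner u u = 0"
    then have "AE x in circ. rep_hsp u x * rep_hsp u x = 0"
      unfolding inner_hsp_def
      by (subst (asm) integral_nonneg_eq_0_iff_AE) (auto simp: integrable_rep_hsp_mult)
    then show "u = 0"
      using rep_zero_hsp by (intro hsp_eqI) (auto elim!: AE_mp)
  next
    assume u: "u = 0"
    have "inner u u = (\<integral>x. 0 \<partial>circ)"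
      unfolding inner_hsp_def u
      by (rule integral_cong_AE) (use rep_zero_hsp in \<open>auto elim!: AE_mp\<close>)
    then show "inner u u = 0" by simp
  qed
qed

end

lemma integral_circ_FTC:
  fixes f F :: "real \<Rightarrow> real"
  assumes "\<And>x. (F has_real_derivative f x) (at x)" "continuous_on UNIV f"
  shows "(\<integral>x. f x \<partial>circ) = F (2 * pi) - F 0"
proof -
  have "(\<integral>x. f x \<partial>circ) = (\<integral>x. indicator {0..<2 * pi} x *\<^sub>R f x \<partial>lborel)"
    unfolding circ_def by (rule integral_restrict_space) simp
  also have "\<dots> = (\<integral>x. f x * indicator {0..2 * pi} x \<partial>lborel)"
  proof (rule integral_cong_AE)
    have [measurable]: "f \<in> borel_measurable borel"
      using assms(2) by (rule borel_measurable_continuous_onI)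
    show "(\<lambda>x. indicator {0..<2 * pi} x *\<^sub>R f x) \<in> borel_measurable lborel"
      "(\<lambda>x. f x * indicator {0..2 * pi} x) \<in> borel_measurable lborel"
      by measurable
    show "AE x in lborel. indicator {0..<2 * pi} x *\<^sub>R f x = f x * indicator {0..2 * pi} x"
      using AE_lborel_singleton[of "2 * pi"] by eventually_elim (auto simp: indicator_def)
  qed
  also have "\<dots> = F (2 * pi) - F 0"
    by (rule integral_FTC_Icc_real)
      (use assms in \<open>auto intro: continuous_on_eq_continuous_at[THEN iffD1, rule_format, of UNIV]\<close>)
  finally show ?thesis .
qed

lemma integrable_circ_bounded:
  fixes f :: "real \<Rightarrow> 'b::{banach, second_countable_topology}"
  assumes "f \<in> borel_measurable circ" "\<And>x. norm (f x) \<le> C"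
  shows "integrable circ f"
  by (rule circ.integrable_const_bound[of _ C]) (use assms in auto)

lemma integral_cos_circ: "(\<integral>x. cos (of_int m * x) \<partial>circ) = (if m = 0 then 2 * pi else 0)"
proof (cases "m = 0")
  case False
  have "(\<integral>x. cos (of_int m * x) \<partial>circ) = sin (of_int m * (2 * pi)) / of_int m - sin (of_int m * 0) / of_int m"
    by (rule integral_circ_FTC) (use False in \<open>auto intro!: derivative_eq_intros continuous_intros\<close>)
  with False show ?thesis
    using sin_int_2pin[of m] by (simp only: mult.commute[of "2 * pi"]) simp
next
  case True
  have "(\<integral>x. cos (of_int m * x) \<partial>circ) = measure circ (space circ)"
    using True by simp
  also have "\<dots> = 2 * pi" using emeasure_circ by (simp only: measure_def enn2real_ennreal) simp
  finally show ?thesis using True by simp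
qed

lemma integral_sin_circ: "(\<integral>x. sin (of_int m * x) \<partial>circ) = 0"
proof (cases "m = 0")
  case False
  have "(\<integral>x. sin (of_int m * x) \<partial>circ) = (- cos (of_int m * (2 * pi)) / of_int m) - (- cos (of_int m * 0) / of_int m)"
    by (rule integral_circ_FTC) (use False in \<open>auto intro!: derivative_eq_intros continuous_intros\<close>)
  with False show ?thesis
    using cos_int_2pin[of m] by (simp only: mult.commute[of "2 * pi"]) simp
qed simp

text \<open>The orthonormal basis \<open>e\<^sub>k\<close> is indexed by the nonzero integers; the index 0 gives the zero function.\<close>

definition trig :: "int \<Rightarrow> real \<Rightarrow> real" where
  "trig k x = (if k \<ge> 1 then cos (of_int k * x) else sin (- of_int k * x)) / sqrt pi"

lemma measurable_trig [measurable]: "trig k \<in> borel_measurable borel"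
  unfolding trig_def by measurable

lemma measurable_trig_circ: "trig k \<in> borel_measurable circ"
  by (rule measurable_circ) measurable

lemma abs_trig_le: "\<bar>trig k x\<bar> \<le> 1"
proof -
  have "1 \<le> sqrt pi" using pi_ge_two by simp
  moreover have "\<bar>if k \<ge> 1 then cos (of_int k * x) else sin (- of_int k * x)\<bar> \<le> 1" by simp
  ultimately have "\<bar>if k \<ge> 1 then cos (of_int k * x) else sin (- of_int k * x)\<bar> \<le> 1 * sqrt pi"
    by linarith
  then have "\<bar>if k \<ge> 1 then cos (of_int k * x) else sin (- of_int k * x)\<bar> / sqrt pi \<le> 1"
    by (subst pos_divide_le_eq) auto
  then show ?thesis unfolding trig_def abs_divide by simp
qed

lemma trig_L2_mean0: "trig k \<in> L2_mean0"
proof -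
  have "(\<integral>x. trig k x \<partial>circ) = 0"
    using integral_cos_circ[of k] integral_sin_circ[of "- k"]
    by (cases "k \<ge> 1") (simp_all add: trig_def)
  moreover have "integrable circ (\<lambda>x. (trig k x)\<^sup>2)"
    by (rule integrable_circ_bounded[of _ 1])
      (use measurable_trig_circ[measurable] in \<open>auto simp: abs_square_le_1 abs_trig_le\<close>)
  ultimately show ?thesis
    by (simp add: L2_mean0_def measurable_trig_circ)
qed

lemma trig_orthonormal:
  assumes "j \<noteq> 0" "k \<noteq> 0"
  shows "(\<integral>x. trig j x * trig k x \<partial>circ) = (if j = k then 1 else 0)"
proof -
  have int: "integrable circ (\<lambda>x. cos (of_int m * x))" "integrable circ (\<lambda>x. sin (of_int m * x))" for m
    by (rule integrable_circ_bounded[of _ 1]; simp add: measurable_circ)+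
  have t: "(a / sqrt pi) * (b / sqrt pi) = a * b / pi" for a b
    by simp
  have d: "of_int (j - k) * x = of_int j * x - of_int k * x" "of_int (j + k) * x = of_int j * x + of_int k * x" for x :: real
    by (simp_all add: algebra_simps)
  consider "j \<ge> 1" "k \<ge> 1" | "j \<ge> 1" "k \<le> -1" | "j \<le> -1" "k \<ge> 1" | "j \<le> -1" "k \<le> -1"
    using assms by linarith
  then show ?thesis
  proof cases
    case 1
    have "trig j x * trig k x = (cos (of_int (j - k) * x) + cos (of_int (j + k) * x)) / (2 * pi)" for x
      unfolding trig_def t d using 1 by (simp add: cos_times_cos)
    then show ?thesis
      using 1 int integral_cos_circ[of "j - k"] integral_cos_circ[of "j + k"]
      by (simp del: of_int_add of_int_diff)
  next
    case 2
    have "trig j x * trig k x = (sin (of_int (j - k) * x) - sin (of_int (j + k) * x)) / (2 * pi)" for x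
      unfolding trig_def t d using 2 by (simp add: cos_times_sin minus_divide_left)
    then show ?thesis
      using 2 int integral_sin_circ[of "j - k"] integral_sin_circ[of "j + k"]
      by (auto simp del: of_int_add of_int_diff)
  next
    case 3
    have "trig j x * trig k x = - (sin (of_int (j + k) * x) + sin (of_int (j - k) * x)) / (2 * pi)" for x
      unfolding trig_def t d using 3 by (simp add: sin_times_cos minus_divide_left)
    then show ?thesis
      using 3 int integral_sin_circ[of "j - k"] integral_sin_circ[of "j + k"]
      by (auto simp del: of_int_add of_int_diff)
  next
    case 4
    have "trig j x * trig k x = (cos (of_int (j - k) * x) - cos (of_int (j + k) * x)) / (2 * pi)" for x
      unfolding trig_def t d using 4 by (simp add: sin_times_sin)
    then show ?thesis
      using 4 int integral_cos_circ[of "j - k"] integral_cos_circ[of "j + k"]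
      by (auto simp del: of_int_add of_int_diff)
  qed
qed

definition eb :: "int \<Rightarrow> hsp" where "eb k = abs_hsp (trig k)"

definition fc :: "hsp \<Rightarrow> int \<Rightarrow> real" where "fc u k = inner u (eb k)"

lemma fc_eq_integral: "fc u k = (\<integral>x. rep_hsp u x * trig k x \<partial>circ)"
  unfolding fc_def inner_hsp_def eb_def
  by (rule integral_cong_AE)
    (use rep_abs_hsp[OF trig_L2_mean0[of k]] measurable_trig_circ[measurable] in \<open>auto elim!: AE_mp\<close>)

lemma fc_abs_hsp: "f \<in> L2_mean0 \<Longrightarrow> fc (abs_hsp f) k = (\<integral>x. f x * trig k x \<partial>circ)"
  unfolding fc_eq_integral
  by (rule integral_cong_AE)
    (use rep_abs_hsp[of f] measurable_trig_circ[measurable] L2_mean0_D(1)[of f] in \<open>auto elim!: AE_mp\<close>)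

lemma fc_eb: "j \<noteq> 0 \<Longrightarrow> k \<noteq> 0 \<Longrightarrow> fc (eb j) k = (if j = k then 1 else 0)"
  by (simp add: eb_def fc_abs_hsp trig_L2_mean0 trig_orthonormal)

lemma fc_add: "fc (u + v) k = fc u k + fc v k"
  and fc_scaleR: "fc (c *\<^sub>R u) k = c * fc u k"
  and fc_zero: "fc 0 k = 0"
  and fc_diff: "fc (u - v) k = fc u k - fc v k"
  and fc_minus: "fc (- u) k = - fc u k"
  by (simp_all add: fc_def inner_add_left inner_diff_left)

text \<open>Completeness of the trigonometric system: an element of \<open>hsp\<close> is determined by its coefficients.\<close>

definition orth_cis :: "(real \<Rightarrow> complex) \<Rightarrow> bool" where
  "orth_cis g \<longleftrightarrow> integrable circ g \<and> (\<forall>n::int. (\<integral>x. g x * cis (of_int n * x) \<partial>circ) = 0)"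

lemma measurable_cis_circ [measurable]: "(\<lambda>x. cis (c * x)) \<in> borel_measurable circ"
  by (intro measurable_circ borel_measurable_continuous_onI continuous_intros)

lemma integrable_times_cis:
  "integrable circ g \<Longrightarrow> integrable circ (\<lambda>x. g x * cis (c * x))"
  by (rule Bochner_Integration.integrable_bound[of _ g]) (auto simp: norm_mult)

lemma orth_cis_poly:
  assumes "real_polynomial_function (p :: complex \<Rightarrow> real)" "orth_cis g"
  shows "orth_cis (\<lambda>x. of_real (p (cis x)) * g x)"
  using assms
proof (induction p arbitrary: g rule: real_polynomial_function.induct)
  case (linear p)
  have p: "p z = Re z * p 1 + Im z * p \<i>" for z
  proof -
    have "p z = p (Re z *\<^sub>R 1 + Im z *\<^sub>R \<i>)"
      by (rule arg_cong[of _ _ p]) (simp add: complex_eq_iff)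
    then show ?thesis
      by (simp only: linear_simps[OF linear.hyps] real_scaleR_def)
  qed
  define A :: complex where "A = (of_real (p 1) - \<i> * of_real (p \<i>)) / 2"
  define B :: complex where "B = (of_real (p 1) + \<i> * of_real (p \<i>)) / 2"
  have eq: "of_real (p (cis x)) = A * cis (1 * x) + B * cis ((-1) * x)" for x
    unfolding p[of "cis x"] A_def B_def by (simp add: complex_eq_iff field_simps)
  have int: "integrable circ (\<lambda>x. g x * cis (of_int n * x))" for n
    using linear.prems integrable_times_cis by (auto simp: orth_cis_def)
  have zero: "(\<integral>x. g x * cis (of_int n * x) \<partial>circ) = 0" for n
    using linear.prems by (auto simp: orth_cis_def)
  have e2: "(of_real (p (cis x)) * g x) * cis (of_int n * x) =
      A * (g x * cis (of_int (n + 1) * x)) + B * (g x * cis (of_int (n - 1) * x))" for n x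
  proof -
    have *: "cis (of_int (n + 1) * x) = cis (of_int n * x) * cis (1 * x)"
      "cis (of_int (n - 1) * x) = cis (of_int n * x) * cis ((-1) * x)"
      by (simp_all add: cis_mult algebra_simps)
    have "(A * c + B * d) * b * a = A * (b * (a * c)) + B * (b * (a * d))" for a b c d
      by (simp add: algebra_simps)
    then show ?thesis unfolding eq * by blast
  qed
  have "integrable circ (\<lambda>x. (of_real (p (cis x)) * g x) * cis (of_int 0 * x))"
    unfolding e2 by (intro Bochner_Integration.integrable_add integrable_mult_right int)
  moreover have "(\<integral>x. (of_real (p (cis x)) * g x) * cis (of_int n * x) \<partial>circ) = 0" for n
    unfolding e2
    by (subst Bochner_Integration.integral_add) (intro integrable_mult_right int, intro integrable_mult_right int, simp add: zero del: of_int_add of_int_diff)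
  ultimately show ?case by (simp add: orth_cis_def)
next
  case (const c)
  then show ?case by (simp add: orth_cis_def mult.assoc)
next
  case (add p q)
  have "orth_cis (\<lambda>x. of_real (p (cis x)) * g x)" "orth_cis (\<lambda>x. of_real (q (cis x)) * g x)"
    using add by auto
  then show ?case
    by (simp add: orth_cis_def distrib_right integrable_times_cis)
next
  case (mult p q)
  have "orth_cis (\<lambda>x. of_real (p (cis x)) * (of_real (q (cis x)) * g x))"
    using mult by auto
  then show ?case by (simp add: mult.assoc)
qed

lemma orth_cis_continuous:
  fixes f :: "real \<Rightarrow> real" and h :: "complex \<Rightarrow> real"
  assumes f: "orth_cis (\<lambda>x. of_real (f x))" and h: "continuous_on UNIV h"
  shows "(\<integral>x. f x * h (cis x) \<partial>circ) = 0"
proof -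
  have intf: "integrable circ f"
    using f by (simp add: orth_cis_def complex_of_real_integrable_eq)
  then have [measurable]: "f \<in> borel_measurable circ" by simp
  have mc: "(\<lambda>x. q (cis x)) \<in> borel_measurable circ" if "continuous_on UNIV q" for q :: "complex \<Rightarrow> real"
    by (intro measurable_circ borel_measurable_continuous_onI continuous_on_compose2[OF that])
      (auto intro!: continuous_intros)
  have bd: "\<bar>\<integral>x. f x * h (cis x) \<partial>circ\<bar> \<le> e * (\<integral>x. \<bar>f x\<bar> \<partial>circ)" if e: "e > 0" for e
  proof -
    obtain p where p: "real_polynomial_function p" "\<And>z. z \<in> sphere 0 1 \<Longrightarrow> \<bar>h z - p z\<bar> < e"
      by (rule Stone_Weierstrass_real_polynomial_function[of "sphere 0 1 :: complex set" h e])
        (use continuous_on_subset[OF h] e in auto)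
    have pc: "continuous_on UNIV p"
      using p(1) continuous_on_polymonial_function by (simp add: real_polynomial_function_eq)
    have [measurable]: "(\<lambda>x. p (cis x)) \<in> borel_measurable circ" "(\<lambda>x. h (cis x)) \<in> borel_measurable circ"
      using mc[OF pc] mc[OF h] by auto
    have "orth_cis (\<lambda>x. of_real (p (cis x)) * of_real (f x))"
      using p(1) f by (rule orth_cis_poly)
    then have "(\<integral>x. of_real (p (cis x) * f x) * cis (of_int 0 * x) \<partial>circ) = (0::complex)"
      and "integrable circ (\<lambda>x. of_real (p (cis x) * f x) :: complex)"
      unfolding orth_cis_def of_real_mult by blast+
    then have p0: "(\<integral>x. f x * p (cis x) \<partial>circ) = 0" and pint: "integrable circ (\<lambda>x. f x * p (cis x))"
      by (simp_all add: complex_of_real_integrable_eq mult.commute flip: of_real_mult)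
    have bnd: "norm (f x * (h (cis x) - p (cis x))) \<le> e * \<bar>f x\<bar>" for x
      using mult_right_mono[of "\<bar>h (cis x) - p (cis x)\<bar>" e "\<bar>f x\<bar>"] p(2)[of "cis x"]
      by (simp add: abs_mult mult.commute)
    have dint: "integrable circ (\<lambda>x. f x * (h (cis x) - p (cis x)))"
      by (rule Bochner_Integration.integrable_bound[of _ "\<lambda>x. e * \<bar>f x\<bar>"])
        (use intf bnd that in \<open>auto intro!: AE_I2 simp: abs_mult\<close>)
    have "(\<integral>x. f x * h (cis x) \<partial>circ) = (\<integral>x. f x * (h (cis x) - p (cis x)) + f x * p (cis x) \<partial>circ)"
      by (simp add: algebra_simps)
    also have "\<dots> = (\<integral>x. f x * (h (cis x) - p (cis x)) \<partial>circ)"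
      using dint pint p0 by (subst Bochner_Integration.integral_add) auto
    finally have "\<bar>\<integral>x. f x * h (cis x) \<partial>circ\<bar> \<le> (\<integral>x. norm (f x * (h (cis x) - p (cis x))) \<partial>circ)"
      using integral_norm_bound[of circ "\<lambda>x. f x * (h (cis x) - p (cis x))"] by simp
    also have "\<dots> \<le> (\<integral>x. e * \<bar>f x\<bar> \<partial>circ)"
      by (intro integral_mono integrable_norm dint integrable_mult_right) (use intf bnd in auto)
    finally show ?thesis by simp
  qed
  define c where "c = (\<integral>x. \<bar>f x\<bar> \<partial>circ)"
  have c0: "0 \<le> c" unfolding c_def by simp
  have "\<bar>\<integral>x. f x * h (cis x) \<partial>circ\<bar> \<le> 0 + e" if "e > 0" for e
  proof -
    have "\<bar>\<integral>x. f x * h (cis x) \<partial>circ\<bar> \<le> e / (c + 1) * c"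
      using c0 that by (intro bd[folded c_def] divide_pos_pos) auto
    also have "\<dots> \<le> e" using that c0 by (simp add: field_simps)
    finally show ?thesis by simp
  qed
  then have "\<bar>\<integral>x. f x * h (cis x) \<partial>circ\<bar> \<le> 0"
    by (rule field_le_epsilon)
  then show ?thesis by simp
qed

lemma orth_cis_compact:
  fixes f :: "real \<Rightarrow> real"
  assumes f: "orth_cis (\<lambda>x. of_real (f x))" and K: "compact K" "K \<subseteq> {0..<2 * pi}"
  shows "(\<integral>x. f x * indicator K x \<partial>circ) = 0"
proof (cases "K = {}")
  case False
  have intf: "integrable circ f"
    using f by (simp add: orth_cis_def complex_of_real_integrable_eq)
  then have fm: "f \<in> borel_measurable circ" by simp
  have Kb: "K \<in> sets borel" using K(1) by (simp add: compact_imp_closed)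
  have im: "(indicator K :: real \<Rightarrow> real) \<in> borel_measurable circ"
    by (intro measurable_circ borel_measurable_indicator Kb)
  define C where "C = cis ` K"
  have C: "compact C" "C \<noteq> {}"
    unfolding C_def using K False by (auto intro!: compact_continuous_image continuous_intros)
  have iff: "cis x \<in> C \<longleftrightarrow> x \<in> K" if "x \<in> {0..<2 * pi}" for x
  proof
    assume "cis x \<in> C"
    then obtain y where y: "y \<in> K" "cis x = cis y" by (auto simp: C_def)
    have arg: "Arg2pi (cis z) = z" if "z \<in> {0..<2 * pi}" for z
      using that by (intro Arg2pi_unique[of 1]) (simp_all add: cis_conv_exp)
    have "x = y"
      using arg[OF that] arg[of y] y K(2) by auto
    then show "x \<in> K" using y by simp
  qed (auto simp: C_def)
  define h where "h n z = max 0 (1 - real n * infdist z C)" for n z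
  have hc: "continuous_on UNIV (h n)" for n
    unfolding h_def by (intro continuous_intros)
  have hb: "\<bar>h n z\<bar> \<le> 1" for n z
    unfolding h_def using infdist_nonneg[of z C] by (auto simp: max_def)
  have lim: "(\<lambda>n. h n (cis x)) \<longlonglongrightarrow> indicator K x" if "x \<in> {0..<2 * pi}" for x
  proof (cases "x \<in> K")
    case True
    then have "cis x \<in> C" by (auto simp: C_def)
    then have "h n (cis x) = 1" for n by (simp add: h_def)
    then show ?thesis using True by simp
  next
    case False
    then have "infdist (cis x) C > 0"
      using C iff[OF that] False by (intro infdist_pos_not_in_closed) (simp_all add: compact_imp_closed)
    then obtain N where N: "1 < real N * infdist (cis x) C"
      using reals_Archimedean3[of "infdist (cis x) C"] by blast
    have "h n (cis x) = 0" if "n \<ge> N" for n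
    proof -
      have "real N * infdist (cis x) C \<le> real n * infdist (cis x) C"
        using that by (intro mult_right_mono) (auto simp: infdist_nonneg)
      then show ?thesis unfolding h_def using N by linarith
    qed
    then have "\<forall>\<^sub>F n in sequentially. h n (cis x) = 0"
      unfolding eventually_sequentially by blast
    then show ?thesis using False by (simp add: tendsto_eventually)
  qed
  have mc: "(\<lambda>x. h n (cis x)) \<in> borel_measurable circ" for n
    by (intro measurable_circ borel_measurable_continuous_onI continuous_on_compose2[OF hc])
      (auto intro!: continuous_intros)
  have "(\<lambda>n. \<integral>x. f x * h n (cis x) \<partial>circ) \<longlonglongrightarrow> (\<integral>x. f x * indicator K x \<partial>circ)"
  proof (rule integral_dominated_convergence[where w = "\<lambda>x. \<bar>f x\<bar>"])
    show "AE x in circ. (\<lambda>n. f x * h n (cis x)) \<longlonglongrightarrow> f x * indicator K x"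
      by (rule AE_I2) (intro tendsto_intros lim, simp)
    show "AE x in circ. norm (f x * h n (cis x)) \<le> \<bar>f x\<bar>" for n
      by (rule AE_I2) (use hb in \<open>simp add: abs_mult mult_left_le\<close>)
    show "(\<lambda>x. f x * indicator K x) \<in> borel_measurable circ"
      "(\<lambda>x. f x * h n (cis x)) \<in> borel_measurable circ" for n
      by (intro borel_measurable_times fm im mc)+
    show "integrable circ (\<lambda>x. \<bar>f x\<bar>)"
      using intf by simp
  qed
  then show ?thesis
    by (simp add: orth_cis_continuous[OF f hc] LIMSEQ_const_iff)
qed simp

lemma orth_cis_nonpos:
  fixes f :: "real \<Rightarrow> real"
  assumes f: "orth_cis (\<lambda>x. of_real (f x))"
  shows "AE x in circ. f x \<le> 0"
proof -
  have intf: "integrable circ f"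
    using f by (simp add: orth_cis_def complex_of_real_integrable_eq)
  then have fm[measurable]: "f \<in> borel_measurable circ" by simp
  define S :: "real set" where "S = {0..<2 * pi}"
  have S [measurable]: "S \<in> sets borel" unfolding S_def by simp
  define N where "N = density lborel (indicator S)"
  define E where "E = {x \<in> space circ. f x > 0}"
  have "E \<in> sets circ" unfolding E_def by measurable
  then have E: "E \<in> sets borel" "E \<subseteq> S"
    by (auto simp: circ_def sets_restrict_space S_def)
  have eq: "emeasure N A = emeasure circ A" if "A \<in> sets borel" "A \<subseteq> S" for A
  proof -
    have "emeasure N A = emeasure lborel A"
      unfolding N_def using that by (simp add: emeasure_density Int_absorb1 flip: indicator_inter_arith)
    then show ?thesis
      using that by (simp add: circ_def emeasure_restrict_space S_def)
  qed
  have sN: "sets N = sets borel" by (simp add: N_def)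
  have fin: "emeasure N (space N) \<noteq> \<infinity>"
    by (simp add: N_def emeasure_density S_def)
  have "emeasure N E = (SUP K\<in>{K. K \<subseteq> E \<and> compact K}. emeasure N K)"
    by (rule inner_regular[OF sN fin E(1)])
  also have "\<dots> = 0"
  proof -
    have "emeasure N K = 0" if K: "K \<subseteq> E" "compact K" for K
    proof -
      have Kb: "K \<in> sets borel" using K(2) by (simp add: compact_imp_closed)
      have KS: "K \<subseteq> {0..<2 * pi}" using K E by (auto simp: S_def)
      have im: "(indicator K :: real \<Rightarrow> real) \<in> borel_measurable circ"
        by (intro measurable_circ borel_measurable_indicator Kb)
      have Kc: "K \<in> sets circ" using Kb KS by (auto simp: circ_def sets_restrict_space)
      have z: "(\<integral>x. f x * indicator K x \<partial>circ) = 0"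
        by (rule orth_cis_compact[OF f K(2) KS])
      have nn: "AE x in circ. 0 \<le> f x * indicator K x"
        using K by (auto intro!: AE_I2 simp: E_def indicator_def dest: subsetD)
      have "integrable circ (\<lambda>x. f x * indicator K x)"
        by (rule Bochner_Integration.integrable_bound[OF intf])
          (intro borel_measurable_times fm im, simp add: indicator_def)
      then have "AE x in circ. f x * indicator K x = 0"
        using integral_nonneg_eq_0_iff_AE[OF _ nn] z by simp
      then have "AE x in circ. x \<notin> K"
        by (rule AE_mp) (use K in \<open>auto intro!: AE_I2 simp: E_def indicator_def dest: subsetD\<close>)
      then have "emeasure circ K = 0"
        using Kc by (simp add: AE_iff_null_sets null_setsD1)
      then show ?thesis using eq[OF Kb] KS by (simp add: S_def)
    qed
    then show ?thesis by (auto intro!: antisym SUP_least)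
  qed
  finally have "emeasure circ E = 0" using eq[OF E] by simp
  then have "E \<in> null_sets circ" using \<open>E \<in> sets circ\<close> by auto
  then have "AE x in circ. x \<notin> E" by (rule AE_not_in)
  moreover have "AE x in circ. x \<in> space circ" by (rule AE_space)
  ultimately show ?thesis
    by eventually_elim (unfold E_def mem_Collect_eq, linarith)
qed


lemma hsp_eq_zeroI:
  assumes "\<And>k. k \<noteq> 0 \<Longrightarrow> fc u k = 0"
  shows "u = 0"
proof -
  let ?f = "rep_hsp u"
  have intf: "integrable circ ?f" by (rule integrable_L2[OF rep_hsp_D(1,2)])
  have meas: "(\<lambda>x. cos (c * x)) \<in> borel_measurable circ" "(\<lambda>x. sin (c * x)) \<in> borel_measurable circ" for c :: real
    by (intro measurable_circ borel_measurable_continuous_onI continuous_intros)+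
  have intc: "integrable circ (\<lambda>x. ?f x * cos (c * x))" "integrable circ (\<lambda>x. ?f x * sin (c * x))" for c
    by (rule Bochner_Integration.integrable_bound[OF intf],
        intro borel_measurable_times measurable_rep_hsp meas, simp add: abs_mult mult_left_le)+
  have tr: "(\<integral>x. ?f x * trig k x \<partial>circ) = 0" if "k \<noteq> 0" for k
    using assms[OF that] by (simp add: fc_eq_integral)
  have c: "(\<integral>x. ?f x * cos (of_int n * x) \<partial>circ) = 0" for n
  proof -
    consider "n = 0" | "n \<ge> 1" | "n \<le> -1" by linarith
    then show ?thesis
    proof cases
      case 1 then show ?thesis using rep_hsp_D(3) by simp
    next
      case 2 then show ?thesis using tr[of n] by (simp add: trig_def)
    next
      case 3 then show ?thesis using tr[of "- n"] by (simp add: trig_def)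
    qed
  qed
  have s: "(\<integral>x. ?f x * sin (of_int n * x) \<partial>circ) = 0" for n
  proof -
    consider "n = 0" | "n \<ge> 1" | "n \<le> -1" by linarith
    then show ?thesis
    proof cases
      case 2 then show ?thesis using tr[of "- n"] by (simp add: trig_def)
    next
      case 3 then show ?thesis using tr[of n] by (simp add: trig_def)
    qed simp
  qed
  have e: "of_real a * cis b = of_real (a * cos b) + \<i> * of_real (a * sin b)" for a b :: real
    by (simp add: complex_eq_iff)
  have n0: "(\<integral>x. of_real (?f x) * cis (of_int n * x) \<partial>circ) = 0" for n
  proof -
    have "(\<integral>x. of_real (?f x) * cis (of_int n * x) \<partial>circ) =
        (\<integral>x. complex_of_real (?f x * cos (of_int n * x)) \<partial>circ) +
        (\<integral>x. \<i> * complex_of_real (?f x * sin (of_int n * x)) \<partial>circ)"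
      unfolding e
      by (intro Bochner_Integration.integral_add integrable_mult_right integrable_of_real intc)
    also have "\<dots> = 0"
      using c[of n] s[of n] by (simp del: of_real_mult)
    finally show ?thesis .
  qed
  have o: "orth_cis (\<lambda>x. of_real (?f x))"
    unfolding orth_cis_def using intf n0 by simp
  have "orth_cis (\<lambda>x. of_real (- ?f x))"
    using o unfolding orth_cis_def by simp
  then have "AE x in circ. - ?f x \<le> 0" by (rule orth_cis_nonpos)
  with orth_cis_nonpos[OF o] rep_zero_hsp have "AE x in circ. ?f x = rep_hsp 0 x"
    by eventually_elim linarith
  then show ?thesis by (rule hsp_eqI)
qed

lemma hsp_eq_fcI:
  assumes "\<And>k. k \<noteq> 0 \<Longrightarrow> fc u k = fc v k"
  shows "u = v"
  using hsp_eq_zeroI[of "u - v"] assms by (simp add: fc_diff)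

lemma exists_hsp_fc:
  assumes c: "(\<lambda>k. \<bar>c k\<bar>) summable_on (- {0::int})"
  obtains u where "\<And>k. k \<noteq> 0 \<Longrightarrow> fc u k = c k"
proof -
  define d where "d k = (if k = 0 then 0 else c k)" for k
  have "(\<lambda>k. \<bar>d k\<bar>) summable_on UNIV"
    by (rule summable_on_cong_neutral[THEN iffD1, OF _ _ _ c]) (auto simp: d_def)
  then have "(\<lambda>n. \<bar>d (int_decode n)\<bar>) summable_on UNIV"
    by (subst summable_on_reindex_bij_betw[OF bij_int_decode])
  then have sd: "summable (\<lambda>n. \<bar>d (int_decode n)\<bar>)"
    by (rule summable_on_UNIV_nonneg_real_iff[THEN iffD1, rotated]) simp
  define t where "t n x = d (int_decode n) * trig (int_decode n) x" for n x
  have tb: "\<bar>t n x\<bar> \<le> \<bar>d (int_decode n)\<bar>" for n x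
    unfolding t_def abs_mult using abs_trig_le by (simp add: mult_left_le)
  have st: "summable (\<lambda>n. \<bar>t n x\<bar>)" for x
    by (rule summable_comparison_test'[OF sd, of 0]) (use tb in auto)
  define f where "f x = (\<Sum>n. t n x)" for x
  have fb: "\<bar>f x\<bar> \<le> (\<Sum>n. \<bar>d (int_decode n)\<bar>)" for x
    unfolding f_def
    by (rule order_trans[OF summable_rabs[OF st]]) (intro suminf_le tb st sd)
  have [measurable]: "t n \<in> borel_measurable circ" for n
    unfolding t_def using measurable_trig_circ[measurable] by measurable
  have fm [measurable]: "f \<in> borel_measurable circ"
    unfolding f_def by measurable
  have swap: "(\<integral>x. f x * g x \<partial>circ) = (\<Sum>n. \<integral>x. t n x * g x \<partial>circ)"
    if [measurable]: "g \<in> borel_measurable circ" and g: "\<And>x. \<bar>g x\<bar> \<le> 1" for g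
  proof -
    have tg: "\<bar>t n x * g x\<bar> \<le> \<bar>d (int_decode n)\<bar>" for n x
      unfolding abs_mult using mult_mono[OF tb g, of n x x] by simp
    have i: "integrable circ (\<lambda>x. t n x * g x)" for n
      by (rule integrable_circ_bounded[of _ "\<bar>d (int_decode n)\<bar>"]) (use tg in auto)
    have s: "summable (\<lambda>n. \<bar>t n x * g x\<bar>)" for x
      by (rule summable_comparison_test'[OF sd, of 0]) (use tg in auto)
    have "(\<integral>x. (\<Sum>n. t n x * g x) \<partial>circ) = (\<Sum>n. \<integral>x. t n x * g x \<partial>circ)"
    proof (rule integral_suminf[OF i])
      show "AE x in circ. summable (\<lambda>n. norm (t n x * g x))"
        using s by (intro AE_I2) simp
      have "(\<integral>x. norm (t n x * g x) \<partial>circ) \<le> \<bar>d (int_decode n)\<bar> * measure circ (space circ)" for n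
      proof -
        have "(\<integral>x. norm (t n x * g x) \<partial>circ) \<le> (\<integral>x. \<bar>d (int_decode n)\<bar> \<partial>circ)"
          by (intro integral_mono integrable_norm i) (use tg in auto)
        then show ?thesis by (simp add: mult.commute)
      qed
      then show "summable (\<lambda>n. \<integral>x. norm (t n x * g x) \<partial>circ)"
        by (intro summable_comparison_test'[OF summable_mult2[OF sd, of "measure circ (space circ)"], of 0]) simp
    qed
    moreover have "(\<Sum>n. t n x * g x) = f x * g x" for x
      unfolding f_def by (rule suminf_mult2[symmetric]) (rule summable_rabs_cancel[OF st])
    ultimately show ?thesis by simp
  qed
  have "(\<integral>x. f x \<partial>circ) = (\<Sum>n. \<integral>x. t n x \<partial>circ)"
    using swap[of "\<lambda>_. 1"] by simp
  also have "\<dots> = 0"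
    using L2_mean0_D(3)[OF trig_L2_mean0] by (simp add: t_def)
  finally have f0: "(\<integral>x. f x \<partial>circ) = 0" .
  have "integrable circ (\<lambda>x. (f x)\<^sup>2)"
    by (rule integrable_circ_bounded[of _ "(\<Sum>n. \<bar>d (int_decode n)\<bar>)\<^sup>2"])
      (use fb power_mono[OF fb, of _ 2] in auto)
  then have fL: "f \<in> L2_mean0"
    using f0 by (simp add: L2_mean0_def)
  have "fc (abs_hsp f) k = c k" if k: "k \<noteq> 0" for k
  proof -
    have "fc (abs_hsp f) k = (\<Sum>n. \<integral>x. t n x * trig k x \<partial>circ)"
      unfolding fc_abs_hsp[OF fL] by (rule swap) (auto simp: measurable_trig_circ abs_trig_le)
    also have "\<dots> = (\<Sum>n. if n = int_encode k then c k else 0)"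
    proof (rule arg_cong[of _ _ suminf], rule ext)
      fix n
      have "(\<integral>x. t n x * trig k x \<partial>circ) = d (int_decode n) * (\<integral>x. trig (int_decode n) x * trig k x \<partial>circ)"
        by (simp add: t_def mult.assoc)
      also have "\<dots> = (if int_decode n = k then c k else 0)"
        using k by (cases "int_decode n = 0") (auto simp: d_def trig_orthonormal)
      finally show "(\<integral>x. t n x * trig k x \<partial>circ) = (if n = int_encode k then c k else 0)"
        by (metis int_decode_inverse int_encode_inverse)
    qed
    also have "\<dots> = c k" using sums_single[of "int_encode k" "\<lambda>_. c k"] by (auto simp: sums_iff)
    finally show ?thesis .
  qed
  then show thesis by (rule that)
qed

definition Hdot :: "nat \<Rightarrow> hsp set" where
  "Hdot m = {u. (\<lambda>k. \<bar>real_of_int k\<bar> ^ (2 * m) * (fc u k)\<^sup>2) summable_on (- {0})}"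

lemma Hdot_zero: "0 \<in> Hdot m"
  by (simp add: Hdot_def fc_zero)

lemma Hdot_scaleR: "u \<in> Hdot m \<Longrightarrow> c *\<^sub>R u \<in> Hdot m"
  unfolding Hdot_def mem_Collect_eq fc_scaleR power_mult_distrib
  by (subst mult.left_commute) (rule summable_on_cmult_right)

lemma Hdot_add:
  assumes "u \<in> Hdot m" "v \<in> Hdot m"
  shows "u + v \<in> Hdot m"
proof -
  let ?f = "\<lambda>u k. \<bar>real_of_int k\<bar> ^ (2 * m) * (fc u k)\<^sup>2"
  have "(\<lambda>k. 2 * (?f u k + ?f v k)) summable_on (- {0})"
    using assms by (intro summable_on_cmult_right summable_on_add) (simp_all add: Hdot_def)
  then have "?f (u + v) summable_on (- {0})"
  proof (rule summable_on_comparison_test)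
    fix k
    have "(fc (u + v) k)\<^sup>2 \<le> 2 * ((fc u k)\<^sup>2 + (fc v k)\<^sup>2)"
      unfolding fc_add power2_sum using sum_squares_bound[of "fc u k" "fc v k"] by simp
    then have "\<bar>real_of_int k\<bar> ^ (2 * m) * (fc (u + v) k)\<^sup>2
        \<le> \<bar>real_of_int k\<bar> ^ (2 * m) * (2 * ((fc u k)\<^sup>2 + (fc v k)\<^sup>2))"
      by (rule mult_left_mono) simp
    then show "?f (u + v) k \<le> 2 * (?f u k + ?f v k)"
      by (simp add: algebra_simps)
  qed simp
  then show ?thesis by (simp add: Hdot_def)
qed

lemma eb_Hdot:
  assumes "j \<noteq> 0" shows "eb j \<in> Hdot m"
proof -
  have "(\<lambda>k. \<bar>real_of_int k\<bar> ^ (2 * m) * (fc (eb j) k)\<^sup>2) summable_on (- {0}) \<longleftrightarrow>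
      (\<lambda>k. \<bar>real_of_int k\<bar> ^ (2 * m) * (fc (eb j) k)\<^sup>2) summable_on {j}"
    by (rule summable_on_cong_neutral) (use assms in \<open>auto simp: fc_eb\<close>)
  then show ?thesis by (simp add: Hdot_def)
qed

text \<open>\<open>hdot1\<close> is \<open>Hdot 1\<close> as a type of its own, so that it carries the topology of its own norm
  and not the one induced from \<open>hsp\<close>; \<open>emb\<close> is the inclusion.\<close>

typedef hdot1 = "Hdot 1" morphisms emb abs_hdot1
  using Hdot_zero by blast

lemma summable_hdot1: "(\<lambda>k. \<bar>real_of_int k\<bar>\<^sup>2 * (fc (emb u) k)\<^sup>2) summable_on (- {0})"
  using emb[of u] by (simp add: Hdot_def)

lemma summable_hdot1_inner:
  "(\<lambda>k. \<bar>real_of_int k\<bar>\<^sup>2 * (fc (emb u) k * fc (emb v) k)) summable_on (- {0})"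
proof -
  have "(\<lambda>k. \<bar>\<bar>real_of_int k\<bar>\<^sup>2 * (fc (emb u) k * fc (emb v) k)\<bar>) summable_on (- {0})"
  proof (rule summable_on_comparison_test[OF summable_on_add[OF summable_hdot1[of u] summable_hdot1[of v]]])
    fix k
    have "\<bar>a * b\<bar> \<le> a\<^sup>2 + b\<^sup>2" for a b :: real
    proof -
      have "2 * \<bar>a * b\<bar> \<le> a\<^sup>2 + b\<^sup>2"
        using sum_squares_bound[of "\<bar>a\<bar>" "\<bar>b\<bar>"] by (simp add: abs_mult mult.assoc)
      moreover have "0 \<le> \<bar>a * b\<bar>" by simp
      ultimately show ?thesis by linarith
    qed
    then have "\<bar>real_of_int k\<bar>\<^sup>2 * \<bar>fc (emb u) k * fc (emb v) k\<bar>
        \<le> \<bar>real_of_int k\<bar>\<^sup>2 * ((fc (emb u) k)\<^sup>2 + (fc (emb v) k)\<^sup>2)"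
      by (intro mult_left_mono) auto
    then show "\<bar>\<bar>real_of_int k\<bar>\<^sup>2 * (fc (emb u) k * fc (emb v) k)\<bar>
        \<le> \<bar>real_of_int k\<bar>\<^sup>2 * (fc (emb u) k)\<^sup>2 + \<bar>real_of_int k\<bar>\<^sup>2 * (fc (emb v) k)\<^sup>2"
      by (simp add: abs_mult distrib_left)
  qed simp
  then show ?thesis
    using summable_on_iff_abs_summable_on_real by fastforce
qed

instantiation hdot1 :: real_inner
begin

definition zero_hdot1 :: hdot1 where "0 = abs_hdot1 0"
definition plus_hdot1 :: "hdot1 \<Rightarrow> hdot1 \<Rightarrow> hdot1" where "u + v = abs_hdot1 (emb u + emb v)"
definition scaleR_hdot1 :: "real \<Rightarrow> hdot1 \<Rightarrow> hdot1" where "c *\<^sub>R u = abs_hdot1 (c *\<^sub>R emb u)"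
definition uminus_hdot1 :: "hdot1 \<Rightarrow> hdot1" where "- u = (-1) *\<^sub>R (u :: hdot1)"
definition minus_hdot1 :: "hdot1 \<Rightarrow> hdot1 \<Rightarrow> hdot1" where "u - v = u + - (v :: hdot1)"
definition inner_hdot1 :: "hdot1 \<Rightarrow> hdot1 \<Rightarrow> real" where
  "inner u v = (\<Sum>\<^sub>\<infinity>k\<in>- {0}. \<bar>real_of_int k\<bar>\<^sup>2 * (fc (emb u) k * fc (emb v) k))"
definition norm_hdot1 :: "hdot1 \<Rightarrow> real" where "norm u = sqrt (inner u (u :: hdot1))"
definition sgn_hdot1 :: "hdot1 \<Rightarrow> hdot1" where "sgn u = inverse (norm u) *\<^sub>R (u :: hdot1)"
definition dist_hdot1 :: "hdot1 \<Rightarrow> hdot1 \<Rightarrow> real" where "dist u v = norm (u - v :: hdot1)"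
definition uniformity_hdot1 :: "(hdot1 \<times> hdot1) filter" where
  "(uniformity :: (hdot1 \<times> hdot1) filter) = (INF e\<in>{0 <..}. principal {(u, v). dist u v < e})"
definition open_hdot1 :: "hdot1 set \<Rightarrow> bool" where
  "open U = (\<forall>u\<in>U. \<forall>\<^sub>F (u', v) in uniformity. u' = u \<longrightarrow> v \<in> (U :: hdot1 set))"

lemma emb_zero: "emb 0 = 0"
  by (simp add: zero_hdot1_def abs_hdot1_inverse Hdot_zero)

lemma emb_add: "emb (u + v) = emb u + emb v"
  unfolding plus_hdot1_def by (intro abs_hdot1_inverse Hdot_add emb)

lemma emb_scaleR: "emb (c *\<^sub>R u) = c *\<^sub>R emb u"
  unfolding scaleR_hdot1_def by (intro abs_hdot1_inverse Hdot_scaleR emb)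

instance
proof
  fix u v w :: hdot1 and c d :: real
  note [simp] = emb_inject[symmetric] emb_zero emb_add emb_scaleR
  show "u + v + w = u + (v + w)" "u + v = v + u" "0 + u = u" "- u + u = 0" "u - v = u + - v"
    by (simp_all add: uminus_hdot1_def minus_hdot1_def algebra_simps)
  show "c *\<^sub>R (u + v) = c *\<^sub>R u + c *\<^sub>R v" "(c + d) *\<^sub>R u = c *\<^sub>R u + d *\<^sub>R u"
    "c *\<^sub>R d *\<^sub>R u = (c * d) *\<^sub>R u" "1 *\<^sub>R u = u"
    by (simp_all add: algebra_simps)
  show "sgn u = inverse (norm u) *\<^sub>R u" by (simp only: sgn_hdot1_def)
  show "dist u v = norm (u - v)" by (simp only: dist_hdot1_def)
  show "(uniformity :: (hdot1 \<times> hdot1) filter) = (INF e\<in>{0 <..}. principal {(u, v). dist u v < e})"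
    by (simp only: uniformity_hdot1_def)
  show "open U = (\<forall>u\<in>U. \<forall>\<^sub>F (u', v) in uniformity. u' = u \<longrightarrow> v \<in> U)" for U :: "hdot1 set"
    by (simp only: open_hdot1_def)
  show "norm u = sqrt (inner u u)" by (simp only: norm_hdot1_def)
  show "inner u v = inner v u" by (simp add: inner_hdot1_def mult.commute)
  show "0 \<le> inner u u" unfolding inner_hdot1_def by (rule infsum_nonneg) simp
  show "inner (u + v) w = inner u w + inner v w"
    unfolding inner_hdot1_def emb_add fc_add distrib_left distrib_right
    by (rule infsum_add) (rule summable_hdot1_inner)+
  show "inner (c *\<^sub>R u) v = c * inner u v"
    unfolding inner_hdot1_def emb_scaleR fc_scaleR
    by (subst infsum_cmult_right[OF summable_hdot1_inner, symmetric]) (simp add: mult_ac)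
  show "(inner u u = 0) = (u = 0)"
  proof
    assume 0: "inner u u = 0"
    have "fc (emb u) k = 0" if "k \<noteq> 0" for k
    proof -
      have "\<bar>real_of_int k\<bar>\<^sup>2 * (fc (emb u) k * fc (emb u) k) \<le> 0"
        using finite_sum_le_infsum[OF summable_hdot1_inner[of u u], of "{k}"] that 0
        by (simp add: inner_hdot1_def)
      then have "\<bar>real_of_int k\<bar>\<^sup>2 * (fc (emb u) k * fc (emb u) k) = 0"
        by (intro antisym) auto
      then show ?thesis using that by simp
    qed
    then have "emb u = 0" by (rule hsp_eq_zeroI)
    then show "u = 0" by simp
  qed (simp add: inner_hdot1_def fc_zero)
qed

end

lemma emb_minus: "emb (- u) = - emb u"
  unfolding uminus_hdot1_def emb_scaleR by simp

lemma emb_diff: "emb (u - v) = emb u - emb v"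
  unfolding minus_hdot1_def emb_add emb_minus by simp

lemma emb_sum: "emb (\<Sum>i\<in>I. f i) = (\<Sum>i\<in>I. emb (f i))"
  by (induction I rule: infinite_finite_induct) (simp_all add: emb_zero emb_add)

lemma norm_hdot1_sq: "(norm u)\<^sup>2 = (\<Sum>\<^sub>\<infinity>k\<in>- {0}. \<bar>real_of_int k\<bar>\<^sup>2 * (fc (emb u) k)\<^sup>2)"
  proof -
  have "fc (emb u) k * fc (emb u) k = (fc (emb u) k)\<^sup>2" for k
    by (rule power2_eq_square[symmetric])
  then show ?thesis
    by (simp only: power2_norm_eq_inner inner_hdot1_def)
qed

lemma sum_le_norm_hdot1_sq:
  "finite F \<Longrightarrow> F \<subseteq> - {0} \<Longrightarrow> (\<Sum>k\<in>F. \<bar>real_of_int k\<bar>\<^sup>2 * (fc (emb u) k)\<^sup>2) \<le> (norm u)\<^sup>2"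
  unfolding norm_hdot1_sq by (rule finite_sum_le_infsum[OF summable_hdot1]) auto

lemma norm_hdot1_sq_le:
  assumes "\<And>F. finite F \<Longrightarrow> F \<subseteq> - {0} \<Longrightarrow> (\<Sum>k\<in>F. \<bar>real_of_int k\<bar>\<^sup>2 * (fc (emb u) k)\<^sup>2) \<le> b"
  shows "(norm u)\<^sup>2 \<le> b"
  unfolding norm_hdot1_sq by (rule infsum_le_finite_sums[OF summable_hdot1 assms])

lemma abs_fc_le_norm_hdot1:
  assumes "k \<noteq> 0" shows "\<bar>fc (emb u) k\<bar> \<le> norm u"
proof -
  have "1 \<le> \<bar>real_of_int k\<bar>" using assms by linarith
  then have "1 \<le> \<bar>real_of_int k\<bar>\<^sup>2" by (rule one_le_power)
  then have "1 * (fc (emb u) k)\<^sup>2 \<le> \<bar>real_of_int k\<bar>\<^sup>2 * (fc (emb u) k)\<^sup>2"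
    by (rule mult_right_mono) simp
  also have "\<dots> \<le> (norm u)\<^sup>2"
    using sum_le_norm_hdot1_sq[of "{k}" u] assms by simp
  finally show ?thesis using abs_le_square_iff[of "fc (emb u) k" "norm u"] by simp
qed

lemma summable_inverse_squares_int: "(\<lambda>k. 1 / (real_of_int k)\<^sup>2) summable_on (- {0})"
proof -
  have "(\<lambda>n. 1 / (real n)\<^sup>2) summable_on UNIV"
    using inverse_power_summable[of 2, where 'a = real]
    by (subst summable_on_UNIV_nonneg_real_iff) (simp_all add: inverse_eq_divide)
  then have "(\<lambda>k. 1 / (real_of_int k)\<^sup>2) summable_on range int"
    "(\<lambda>k. 1 / (real_of_int k)\<^sup>2) summable_on range (\<lambda>n. - int n)"
    by (simp_all add: summable_on_reindex inj_def o_def)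
  then have "(\<lambda>k. 1 / (real_of_int k)\<^sup>2) summable_on (range int \<union> range (\<lambda>n. - int n))"
    by (rule summable_on_union)
  then show ?thesis
    by (rule summable_on_subset_banach) (auto intro: int_cases2)
qed

lemma exists_hdot1_fc:
  assumes c: "(\<lambda>k. \<bar>real_of_int k\<bar>\<^sup>2 * (c k)\<^sup>2) summable_on (- {0})"
  obtains u where "\<And>k. k \<noteq> 0 \<Longrightarrow> fc (emb u) k = c k"
proof -
  have ab: "a * b \<le> a\<^sup>2 + b\<^sup>2" if "0 \<le> a" "0 \<le> b" for a b :: real
    using sum_squares_bound[of a b] mult_nonneg_nonneg[OF that] by linarith
  have "(\<lambda>k. \<bar>c k\<bar>) summable_on (- {0})"
  proof (rule summable_on_comparison_test[OF summable_on_add[OF summable_inverse_squares_int c]])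
    fix k :: int assume "k \<in> - {0}"
    then have "\<bar>c k\<bar> = (1 / \<bar>real_of_int k\<bar>) * (\<bar>real_of_int k\<bar> * \<bar>c k\<bar>)" by simp
    also have "\<dots> \<le> (1 / \<bar>real_of_int k\<bar>)\<^sup>2 + (\<bar>real_of_int k\<bar> * \<bar>c k\<bar>)\<^sup>2"
      by (rule ab) simp_all
    finally show "\<bar>c k\<bar> \<le> 1 / (real_of_int k)\<^sup>2 + \<bar>real_of_int k\<bar>\<^sup>2 * (c k)\<^sup>2"
      by (simp add: power_divide power_mult_distrib)
  qed simp
  then obtain u where u: "\<And>k. k \<noteq> 0 \<Longrightarrow> fc u k = c k"
    using exists_hsp_fc by blast
  have "(\<lambda>k. \<bar>real_of_int k\<bar>\<^sup>2 * (fc u k)\<^sup>2) summable_on (- {0})"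
    by (rule summable_on_cong[THEN iffD1, OF _ c]) (simp add: u)
  then have "u \<in> Hdot 1" by (simp add: Hdot_def)
  then show thesis using that[of "abs_hdot1 u"] u by (simp add: abs_hdot1_inverse)
qed

instance hdot1 :: complete_space
proof
  fix X :: "nat \<Rightarrow> hdot1"
  assume X: "Cauchy X"
  let ?c = "\<lambda>n k. fc (emb (X n)) k"
  have "Cauchy (\<lambda>n. ?c n k)" if "k \<noteq> 0" for k
  proof (rule metric_CauchyI)
    fix e :: real assume "0 < e"
    then obtain N where N: "\<And>m n. m \<ge> N \<Longrightarrow> n \<ge> N \<Longrightarrow> dist (X m) (X n) < e"
      using metric_CauchyD[OF X] by blast
    have "dist (?c m k) (?c n k) < e" if "m \<ge> N" "n \<ge> N" for m n
      using abs_fc_le_norm_hdot1[OF \<open>k \<noteq> 0\<close>, of "X m - X n"] N[OF that]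
      by (simp add: dist_norm emb_diff fc_diff)
    then show "\<exists>N. \<forall>m\<ge>N. \<forall>n\<ge>N. dist (?c m k) (?c n k) < e" by blast
  qed
  then have "\<forall>k. \<exists>l. k \<noteq> 0 \<longrightarrow> (\<lambda>n. ?c n k) \<longlonglongrightarrow> l"
    using Cauchy_convergent unfolding convergent_def by blast
  then obtain c where c: "\<And>k. k \<noteq> 0 \<Longrightarrow> (\<lambda>n. ?c n k) \<longlonglongrightarrow> c k"
    by metis
  have tail: "\<exists>N. \<forall>m\<ge>N. \<forall>F. finite F \<longrightarrow> F \<subseteq> - {0} \<longrightarrow>
      (\<Sum>k\<in>F. \<bar>real_of_int k\<bar>\<^sup>2 * (?c m k - c k)\<^sup>2) \<le> e\<^sup>2" if "0 < e" for e
  proof -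
    obtain N where N: "\<And>m n. m \<ge> N \<Longrightarrow> n \<ge> N \<Longrightarrow> dist (X m) (X n) < e"
      using metric_CauchyD[OF X \<open>0 < e\<close>] by blast
    have "(\<Sum>k\<in>F. \<bar>real_of_int k\<bar>\<^sup>2 * (?c m k - c k)\<^sup>2) \<le> e\<^sup>2"
      if m: "m \<ge> N" and F: "finite F" "F \<subseteq> - {0}" for m F
    proof (rule LIMSEQ_le_const2)
      show "(\<lambda>n. \<Sum>k\<in>F. \<bar>real_of_int k\<bar>\<^sup>2 * (?c m k - ?c n k)\<^sup>2)
          \<longlonglongrightarrow> (\<Sum>k\<in>F. \<bar>real_of_int k\<bar>\<^sup>2 * (?c m k - c k)\<^sup>2)"
        using F by (intro tendsto_intros c) auto
      have "(\<Sum>k\<in>F. \<bar>real_of_int k\<bar>\<^sup>2 * (?c m k - ?c n k)\<^sup>2) \<le> e\<^sup>2" if "n \<ge> N" for n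
      proof -
        have "(\<Sum>k\<in>F. \<bar>real_of_int k\<bar>\<^sup>2 * (?c m k - ?c n k)\<^sup>2) \<le> (norm (X m - X n))\<^sup>2"
          using sum_le_norm_hdot1_sq[OF F, of "X m - X n"] by (simp add: emb_diff fc_diff)
        also have "\<dots> \<le> e\<^sup>2"
          using N[OF m that] by (intro power_mono) (simp_all add: dist_norm)
        finally show ?thesis .
      qed
      then show "\<exists>N. \<forall>n\<ge>N. (\<Sum>k\<in>F. \<bar>real_of_int k\<bar>\<^sup>2 * (?c m k - ?c n k)\<^sup>2) \<le> e\<^sup>2"
        by blast
    qed
    then show ?thesis by blast
  qed
  obtain N where N: "\<And>F. finite F \<Longrightarrow> F \<subseteq> - {0} \<Longrightarrow>
      (\<Sum>k\<in>F. \<bar>real_of_int k\<bar>\<^sup>2 * (?c N k - c k)\<^sup>2) \<le> 1"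
    using tail[of 1] by auto
  have "(\<lambda>k. \<bar>real_of_int k\<bar>\<^sup>2 * (?c N k - c k)\<^sup>2) summable_on (- {0})"
  proof (rule nonneg_bdd_above_summable_on)
    show "bdd_above (sum (\<lambda>k. \<bar>real_of_int k\<bar>\<^sup>2 * (?c N k - c k)\<^sup>2) ` {F. F \<subseteq> - {0} \<and> finite F})"
      by (rule bdd_aboveI[of _ 1]) (use N in blast)
  qed simp
  then obtain w where w: "\<And>k. k \<noteq> 0 \<Longrightarrow> fc (emb w) k = ?c N k - c k"
    using exists_hdot1_fc[of "\<lambda>k. ?c N k - c k"] by blast
  define u where "u = X N - w"
  have u: "fc (emb u) k = c k" if "k \<noteq> 0" for k
    using w[OF that] by (simp add: u_def emb_diff fc_diff)
  have "X \<longlonglongrightarrow> u"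
  proof (rule metric_LIMSEQ_I)
    fix e :: real assume "0 < e"
    then obtain M where M: "\<And>m F. m \<ge> M \<Longrightarrow> finite F \<Longrightarrow> F \<subseteq> - {0} \<Longrightarrow>
      (\<Sum>k\<in>F. \<bar>real_of_int k\<bar>\<^sup>2 * (?c m k - c k)\<^sup>2) \<le> (e / 2)\<^sup>2"
      using tail[of "e / 2"] by auto
    have "dist (X m) u < e" if "m \<ge> M" for m
    proof -
      have "(norm (X m - u))\<^sup>2 \<le> (e / 2)\<^sup>2"
      proof (rule norm_hdot1_sq_le)
        fix F :: "int set" assume F: "finite F" "F \<subseteq> - {0}"
        have "(\<Sum>k\<in>F. \<bar>real_of_int k\<bar>\<^sup>2 * (fc (emb (X m - u)) k)\<^sup>2) = (\<Sum>k\<in>F. \<bar>real_of_int k\<bar>\<^sup>2 * (?c m k - c k)\<^sup>2)"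
        proof (rule sum.cong[OF refl])
          fix k assume "k \<in> F"
          then have "k \<noteq> 0" using F by auto
          then show "\<bar>real_of_int k\<bar>\<^sup>2 * (fc (emb (X m - u)) k)\<^sup>2 = \<bar>real_of_int k\<bar>\<^sup>2 * (?c m k - c k)\<^sup>2"
            by (simp add: emb_diff fc_diff u)
        qed
        then show "(\<Sum>k\<in>F. \<bar>real_of_int k\<bar>\<^sup>2 * (fc (emb (X m - u)) k)\<^sup>2) \<le> (e / 2)\<^sup>2"
          using M[OF that F] by simp
      qed
      then have "norm (X m - u) \<le> e / 2"
        by (rule power2_le_imp_le) (use \<open>0 < e\<close> in linarith)
      then show ?thesis using \<open>0 < e\<close> by (simp add: dist_norm)
    qed
    then show "\<exists>M. \<forall>m\<ge>M. dist (X m) u < e" by blast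
  qed
  then show "convergent X" by (auto simp: convergent_def)
qed

instance hdot1 :: banach ..

definition eb1 :: "int \<Rightarrow> hdot1" where "eb1 k = abs_hdot1 (eb k)"

lemma emb_eb1: "k \<noteq> 0 \<Longrightarrow> emb (eb1 k) = eb k"
  by (simp add: eb1_def abs_hdot1_inverse eb_Hdot)

lemma inner_eb1:
  assumes "k \<noteq> 0" shows "inner u (eb1 k) = \<bar>real_of_int k\<bar>\<^sup>2 * fc (emb u) k"
proof -
  have "inner u (eb1 k) = (\<Sum>\<^sub>\<infinity>j\<in>{k}. \<bar>real_of_int j\<bar>\<^sup>2 * (fc (emb u) j * fc (emb (eb1 k)) j))"
    unfolding inner_hdot1_def
    by (rule infsum_cong_neutral) (use assms in \<open>auto simp: emb_eb1 fc_eb\<close>)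
  then show ?thesis using assms by (simp add: emb_eb1 fc_eb)
qed

lemma has_sum_eb1: "((\<lambda>k. fc (emb u) k *\<^sub>R eb1 k) has_sum u) (- {0})"
proof -
  let ?S = "\<lambda>F. \<Sum>k\<in>F. fc (emb u) k *\<^sub>R eb1 k"
  let ?w = "\<lambda>k. \<bar>real_of_int k\<bar>\<^sup>2 * (fc (emb u) k)\<^sup>2"
  have eq: "(dist (?S F) u)\<^sup>2 = (norm u)\<^sup>2 - sum ?w F" if F: "finite F" "F \<subseteq> - {0}" for F
  proof -
    have us: "inner u (?S F) = sum ?w F"
      unfolding inner_sum_right
    proof (rule sum.cong[OF refl])
      fix k assume "k \<in> F"
      then have "k \<noteq> 0" using F by auto
      then show "inner u (fc (emb u) k *\<^sub>R eb1 k) = ?w k"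
        by (simp add: inner_eb1 power2_eq_square)
    qed
    have fcS: "fc (emb (?S F)) j = fc (emb u) j" if "j \<in> F" for j
    proof -
      have "fc (emb (?S F)) j = (\<Sum>k\<in>F. fc (emb u) k * fc (eb k) j)"
        unfolding emb_sum fc_def inner_sum_left
      proof (rule sum.cong[OF refl])
        fix k assume "k \<in> F"
        then have "k \<noteq> 0" using F by auto
        then show "inner (emb (inner (emb u) (eb k) *\<^sub>R eb1 k)) (eb j) = inner (emb u) (eb k) * inner (eb k) (eb j)"
          by (simp add: emb_scaleR emb_eb1)
      qed
      also have "\<dots> = (\<Sum>k\<in>F. if k = j then fc (emb u) k else 0)"
      proof (rule sum.cong[OF refl])
        fix k assume "k \<in> F"
        then have "k \<noteq> 0" "j \<noteq> 0" using F that by auto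
        then show "fc (emb u) k * fc (eb k) j = (if k = j then fc (emb u) k else 0)"
          by (simp add: fc_eb)
      qed
      finally show ?thesis using F that by simp
    qed
    have "inner (?S F) (?S F) = (\<Sum>k\<in>F. fc (emb u) k * (\<bar>real_of_int k\<bar>\<^sup>2 * fc (emb (?S F)) k))"
      unfolding inner_sum_right[of "?S F"]
    proof (rule sum.cong[OF refl])
      fix k assume "k \<in> F"
      then have "k \<noteq> 0" using F by auto
      then show "inner (?S F) (fc (emb u) k *\<^sub>R eb1 k) = fc (emb u) k * (\<bar>real_of_int k\<bar>\<^sup>2 * fc (emb (?S F)) k)"
        by (simp only: inner_scaleR_right inner_eb1[OF \<open>k \<noteq> 0\<close>])
    qed
    also have "\<dots> = sum ?w F"
      by (rule sum.cong) (auto simp: fcS power2_eq_square)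
    finally have ss: "inner (?S F) (?S F) = sum ?w F" .
    show ?thesis
      unfolding dist_norm power2_norm_eq_inner
      by (simp only: inner_diff_left inner_diff_right inner_commute[of "?S F" u] us ss)
  qed
  have "(?w has_sum (norm u)\<^sup>2) (- {0})"
    unfolding norm_hdot1_sq by (rule has_sum_infsum[OF summable_hdot1])
  then have "((\<lambda>F. (norm u)\<^sup>2 - sum ?w F) \<longlongrightarrow> (norm u)\<^sup>2 - (norm u)\<^sup>2) (finite_subsets_at_top (- {0}))"
    unfolding has_sum_def by (intro tendsto_intros)
  then have "((\<lambda>F. (norm u)\<^sup>2 - sum ?w F) \<longlongrightarrow> 0) (finite_subsets_at_top (- {0}))"
    by simp
  then have "((\<lambda>F. (dist (?S F) u)\<^sup>2) \<longlongrightarrow> 0) (finite_subsets_at_top (- {0}))"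
    by (rule Lim_transform_eventually)
      (rule eventually_finite_subsets_at_top_weakI, rule eq[symmetric])
  then have "((\<lambda>F. sqrt ((dist (?S F) u)\<^sup>2)) \<longlongrightarrow> sqrt 0) (finite_subsets_at_top (- {0}))"
    by (rule tendsto_real_sqrt)
  then show ?thesis
    unfolding has_sum_def by (simp add: tendsto_dist_iff[of _ u])
qed

instance hdot1 :: second_countable_topology
proof
  define g :: "(int \<times> rat) list \<Rightarrow> hdot1" where
    "g xs = (\<Sum>(k, q)\<leftarrow>xs. of_rat q *\<^sub>R eb1 k)" for xs
  define D where "D = range g"
  have D: "countable D" unfolding D_def by simp
  have D_add: "x + y \<in> D" if "x \<in> D" "y \<in> D" for x y
  proof -
    obtain xs where "x = g xs" using \<open>x \<in> D\<close> by (auto simp: D_def)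
    moreover obtain ys where "y = g ys" using \<open>y \<in> D\<close> by (auto simp: D_def)
    ultimately have "x + y = g (xs @ ys)" by (simp add: g_def)
    then show ?thesis by (simp add: D_def)
  qed
  have cl_add: "x + y \<in> closure D" if "x \<in> closure D" "y \<in> closure D" for x y
  proof -
    obtain a where "\<And>n. a n \<in> D" "a \<longlonglongrightarrow> x"
      using \<open>x \<in> closure D\<close> unfolding closure_sequential by blast
    moreover obtain b where "\<And>n. b n \<in> D" "b \<longlonglongrightarrow> y"
      using \<open>y \<in> closure D\<close> unfolding closure_sequential by blast
    ultimately show ?thesis
      unfolding closure_sequential
      by (intro exI[of _ "\<lambda>n. a n + b n"] conjI allI D_add tendsto_add)
  qed
  have cl_single: "c *\<^sub>R eb1 k \<in> closure D" for c k
  proof -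
    have "c \<in> closure \<rat>" by (simp add: Rats_closure_real)
    then obtain a where a: "\<And>n. a n \<in> \<rat>" "a \<longlonglongrightarrow> c"
      unfolding closure_sequential by blast
    have "a n *\<^sub>R eb1 k \<in> D" for n
    proof -
      obtain q where "a n = of_rat q" using a(1)[of n] by (auto elim: Rats_cases)
      then have "a n *\<^sub>R eb1 k = g [(k, q)]" by (simp add: g_def)
      then show ?thesis by (simp add: D_def)
    qed
    then show ?thesis
      unfolding closure_sequential
      by (intro exI[of _ "\<lambda>n. a n *\<^sub>R eb1 k"] conjI allI tendsto_scaleR tendsto_const a(2))
  qed
  have "0 \<in> D" unfolding D_def by (rule image_eqI[of _ _ "[]"]) (simp_all add: g_def)
  then have cl_0: "0 \<in> closure D" using closure_subset by blast
  have cl_sum: "(\<Sum>k\<in>F. c k *\<^sub>R eb1 k) \<in> closure D" for c F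
    by (induction F rule: infinite_finite_induct) (auto intro: cl_0 cl_add cl_single)
  have dense: "u \<in> closure D" for u
  proof (rule Lim_in_closed_set[OF closed_closure _ _ has_sum_eb1[unfolded has_sum_def]])
    show "\<forall>\<^sub>F F in finite_subsets_at_top (- {0}). (\<Sum>k\<in>F. fc (emb u) k *\<^sub>R eb1 k) \<in> closure D"
      by (intro always_eventually allI cl_sum)
  qed simp
  define B where "B = (\<lambda>(d, n). ball d (1 / real (Suc n))) ` (D \<times> (UNIV :: nat set))"
  have "topological_basis B"
  proof (rule topological_basisI)
    fix U u assume U: "open U" and u: "u \<in> (U :: hdot1 set)"
    obtain e where e: "e > 0" "ball u e \<subseteq> U" using U u open_contains_ball by blast
    obtain n where "inverse (real (Suc n)) < e / 2"
      using reals_Archimedean[of "e / 2"] e(1) by auto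
    then have n: "1 / real (Suc n) < e / 2"
      by (simp only: inverse_eq_divide)
    have "0 < 1 / real (Suc n)" by simp
    then obtain d where d: "d \<in> D" "dist d u < 1 / real (Suc n)"
      using dense[of u] unfolding closure_approachable by blast
    have sub: "ball d (1 / real (Suc n)) \<subseteq> ball u e"
    proof
      fix x assume "x \<in> ball d (1 / real (Suc n))"
      then have "dist d x < 1 / real (Suc n)" by (simp only: mem_ball)
      moreover have "dist u x \<le> dist d u + dist d x"
        using dist_triangle[of u x d] by (simp only: dist_commute)
      ultimately show "x \<in> ball u e"
        unfolding mem_ball using d(2) n by linarith
    qed
    show "\<exists>B'\<in>B. u \<in> B' \<and> B' \<subseteq> U"
    proof (intro bexI conjI)
      show "u \<in> ball d (1 / real (Suc n))" using d(2) by (simp only: mem_ball)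
      show "ball d (1 / real (Suc n)) \<subseteq> U" using sub e(2) by (rule subset_trans)
      show "ball d (1 / real (Suc n)) \<in> B"
        unfolding B_def by (rule image_eqI[of _ _ "(d, n)"]) (use d(1) in simp_all)
    qed
  next
    fix V assume "V \<in> B"
    then show "open V" unfolding B_def by auto
  qed
  then have op: "open = generate_topology B"
    by (rule topological_basis_imp_subbasis)
  have "countable (D \<times> (UNIV :: nat set))"
    using D by (rule countable_SIGMA) (rule countableI_type)
  then have "countable B"
    unfolding B_def by (rule countable_image)
  with op show "\<exists>B::hdot1 set set. countable B \<and> open = generate_topology B"
    by metis
qed

definition fourier :: "(real \<Rightarrow> real) \<Rightarrow> int \<Rightarrow> complex" where
  "fourier f k = (\<integral>x. of_real (f x) * cis (- of_int k * x) \<partial>circ) / of_real (2 * pi)"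

definition hilbert :: "hsp \<Rightarrow> hsp" where
  "hilbert u = (THE v. \<forall>k. fourier (rep_hsp v) k = - \<i> * of_int (sgn k) * fourier (rep_hsp u) k)"

text \<open>Distributional derivative on the circle, tested against the exponentials
  \<open>x \<mapsto> exp (- i k x)\<close>. The derivative of any square-integrable function has mean zero.\<close>

definition is_weak_deriv :: "(real \<Rightarrow> real) \<Rightarrow> hsp \<Rightarrow> bool" where
  "is_weak_deriv f v \<longleftrightarrow> (\<forall>k. fourier (rep_hsp v) k = \<i> * of_int k * fourier f k)"

definition weak_deriv :: "(real \<Rightarrow> real) \<Rightarrow> hsp" where
  "weak_deriv f = (THE v. is_weak_deriv f v)"

definition velocity :: "hsp \<Rightarrow> hsp" where
  "velocity w = (THE u. is_weak_deriv (rep_hsp u) (hilbert w))"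

text \<open>\<open>- a (u w)\<^sub>x + (1 + a) u\<^sub>x w\<close> with \<open>u\<^sub>x = hilbert w\<close>. It is only used for \<open>w \<in> Hdot 1\<close>,
  where \<open>u w\<close> is weakly differentiable and \<open>u\<^sub>x w\<close> is in \<open>L2_mean0\<close>
  (its mean vanishes because the Hilbert transform is antisymmetric).\<close>

definition nonlin :: "real \<Rightarrow> hsp \<Rightarrow> hsp" where
  "nonlin a w =
     (- a) *\<^sub>R weak_deriv (\<lambda>x. rep_hsp (velocity w) x * rep_hsp w x)
     + (1 + a) *\<^sub>R abs_hsp (\<lambda>x. rep_hsp (hilbert w) x * rep_hsp w x)"

text \<open>\<open>heat \<tau>\<close> is \<open>exp (\<tau> \<partial>\<^sub>x\<^sup>2)\<close>. The value is in \<open>Hdot 1\<close> for every \<open>v\<close> if \<open>\<tau> > 0\<close>, and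
  for \<open>v \<in> Hdot 1\<close> if \<open>\<tau> = 0\<close>; these are the only cases that are used.\<close>

definition heat :: "real \<Rightarrow> hsp \<Rightarrow> hdot1" where
  "heat \<tau> v = (THE w. \<forall>k. k \<noteq> 0 \<longrightarrow> fc (emb w) k = exp (- \<tau> * (real_of_int k)\<^sup>2) * fc v k)"

lemma fc_heat:
  assumes "0 \<le> \<tau>" "k \<noteq> 0"
  shows "fc (emb (heat \<tau> (emb y))) k = exp (- \<tau> * (real_of_int k)\<^sup>2) * fc (emb y) k"
proof -
  let ?c = "\<lambda>k. exp (- \<tau> * (real_of_int k)\<^sup>2) * fc (emb y) k"
  have "(\<lambda>k. \<bar>real_of_int k\<bar>\<^sup>2 * (?c k)\<^sup>2) summable_on (- {0})"
  proof (rule summable_on_comparison_test[OF summable_hdot1[of y]])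
    fix k :: int
    have "(exp (- \<tau> * (real_of_int k)\<^sup>2))\<^sup>2 \<le> 1"
      using assms(1) by (intro power_le_one) auto
    then have "(exp (- \<tau> * (real_of_int k)\<^sup>2))\<^sup>2 * (fc (emb y) k)\<^sup>2 \<le> 1 * (fc (emb y) k)\<^sup>2"
      by (rule mult_right_mono) simp
    then show "\<bar>real_of_int k\<bar>\<^sup>2 * (?c k)\<^sup>2 \<le> \<bar>real_of_int k\<bar>\<^sup>2 * (fc (emb y) k)\<^sup>2"
      unfolding power_mult_distrib by (intro mult_left_mono) auto
  qed simp
  then obtain w where w: "\<And>k. k \<noteq> 0 \<Longrightarrow> fc (emb w) k = ?c k"
    using exists_hdot1_fc[of ?c] by blast
  have "\<forall>k. k \<noteq> 0 \<longrightarrow> fc (emb (heat \<tau> (emb y))) k = ?c k"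
    unfolding heat_def
  proof (rule theI[of _ w])
    show "\<forall>k. k \<noteq> 0 \<longrightarrow> fc (emb w) k = ?c k" using w by blast
    show "v = w" if "\<forall>k. k \<noteq> 0 \<longrightarrow> fc (emb v) k = ?c k" for v
      using that w hsp_eq_fcI[of "emb v" "emb w"] by (simp add: emb_inject)
  qed
  then show ?thesis using assms(2) by blast
qed

definition brownian_motion :: "'w measure \<Rightarrow> (real \<Rightarrow> 'w \<Rightarrow> real) \<Rightarrow> bool" where
  "brownian_motion M B \<longleftrightarrow>
     (\<forall>t\<ge>0. B t \<in> borel_measurable M) \<and>
     (AE x in M. B 0 x = 0) \<and>
     (\<forall>s t. 0 \<le> s \<and> s < t \<longrightarrow>
        distributed M lborel (\<lambda>x. B t x - B s x) (\<lambda>z. ennreal (normal_density 0 (sqrt (t - s)) z))) \<and>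
     (\<forall>\<tau> n. 0 \<le> \<tau> 0 \<and> mono \<tau> \<longrightarrow>
        prob_space.indep_vars M (\<lambda>_. borel) (\<lambda>i x. B (\<tau> (Suc i)) x - B (\<tau> i) x) {..<n::nat}) \<and>
     (AE x in M. continuous_on {0..} (\<lambda>t. B t x))"

definition filtered_prob_space :: "'w measure \<Rightarrow> (real \<Rightarrow> 'w measure) \<Rightarrow> bool" where
  "filtered_prob_space M F \<longleftrightarrow>
     prob_space M \<and> (\<forall>t\<ge>0. subalgebra M (F t)) \<and>
     (\<forall>s t. 0 \<le> s \<and> s \<le> t \<longrightarrow> sets (F s) \<subseteq> sets (F t))"

definition driving_noise ::
    "'w measure \<Rightarrow> (real \<Rightarrow> 'w measure) \<Rightarrow> (int \<Rightarrow> real \<Rightarrow> 'w \<Rightarrow> real) \<Rightarrow> bool" where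
  "driving_noise M F \<beta> \<longleftrightarrow>
     filtered_prob_space M F \<and>
     (\<forall>k. k \<noteq> 0 \<longrightarrow> brownian_motion M (\<beta> k)) \<and>
     prob_space.indep_vars M (\<lambda>_. PiM {0..} (\<lambda>_. borel)) (\<lambda>k x. \<lambda>t\<in>{0..}. \<beta> k t x) (- {0}) \<and>
     (\<forall>k t. k \<noteq> 0 \<and> 0 \<le> t \<longrightarrow> \<beta> k t \<in> borel_measurable (F t)) \<and>
     (\<forall>s\<ge>0. prob_space.indep_set M (sets (F s))
        (sigma_sets (space M)
          {(\<lambda>x. \<beta> k t x - \<beta> k s x) -` A \<inter> space M | k t A. k \<noteq> 0 \<and> s \<le> t \<and> A \<in> sets borel}))"

definition noise_finite :: "(int \<Rightarrow> real) \<Rightarrow> nat \<Rightarrow> bool" where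
  "noise_finite b m \<longleftrightarrow> (\<lambda>k. \<bar>real_of_int k\<bar> ^ (2 * m) * (b k)\<^sup>2) summable_on (- {0})"

definition noise_sum :: "(int \<Rightarrow> real) \<Rightarrow> nat \<Rightarrow> real" where
  "noise_sum b m = (\<Sum>\<^sub>\<infinity>k\<in>- {0}. \<bar>real_of_int k\<bar> ^ (2 * m) * (b k)\<^sup>2)"

text \<open>Stochastic integral over \<open>[0, t]\<close> of a deterministic vector-valued integrand against a real
  Brownian motion: the \<open>L\<^sup>2\<close>-limit of the integrals of step functions that approximate the
  integrand in \<open>L\<^sup>2(0, t)\<close>.\<close>

definition step_fun :: "nat \<Rightarrow> (nat \<Rightarrow> real) \<Rightarrow> (nat \<Rightarrow> 'b::real_normed_vector) \<Rightarrow> real \<Rightarrow> 'b" where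
  "step_fun n \<tau> c s = (\<Sum>i<n. indicator {\<tau> i<..\<tau> (Suc i)} s *\<^sub>R c i)"

definition step_integral ::
    "(real \<Rightarrow> 'w \<Rightarrow> real) \<Rightarrow> nat \<Rightarrow> (nat \<Rightarrow> real) \<Rightarrow> (nat \<Rightarrow> 'b::real_normed_vector) \<Rightarrow> 'w \<Rightarrow> 'b" where
  "step_integral B n \<tau> c x = (\<Sum>i<n. (B (\<tau> (Suc i)) x - B (\<tau> i) x) *\<^sub>R c i)"

definition has_wiener_integral ::
    "'w measure \<Rightarrow> (real \<Rightarrow> 'w \<Rightarrow> real) \<Rightarrow> real \<Rightarrow> (real \<Rightarrow> 'b::real_normed_vector) \<Rightarrow> ('w \<Rightarrow> 'b) \<Rightarrow> bool" where
  "has_wiener_integral M B t f X \<longleftrightarrow>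
     X \<in> borel_measurable M \<and>
     (\<exists>n \<tau> c. (\<forall>j. mono (\<tau> j) \<and> range (\<tau> j) \<subseteq> {0..t}) \<and>
        (\<lambda>j::nat. \<integral>\<^sup>+s\<in>{0..t}. ennreal ((norm (f s - step_fun (n j) (\<tau> j) (c j) s))\<^sup>2) \<partial>lborel)
          \<longlonglongrightarrow> 0 \<and>
        (\<lambda>j. \<integral>\<^sup>+x. ennreal ((norm (X x - step_integral B (n j) (\<tau> j) (c j) x))\<^sup>2) \<partial>M)
          \<longlonglongrightarrow> 0)"

text \<open>\<open>Z t\<close> is the integral over \<open>[0, t]\<close> of \<open>heat (\<nu> (t - s))\<close> against \<open>d\<xi>(s)\<close>, where
  \<open>\<xi>(t) = \<Sum>\<^sub>k b\<^sub>k \<beta>\<^sub>k(t) e\<^sub>k\<close>, in its version with continuous paths.\<close>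

definition stoch_convolution ::
    "'w measure \<Rightarrow> (int \<Rightarrow> real \<Rightarrow> 'w \<Rightarrow> real) \<Rightarrow> (int \<Rightarrow> real) \<Rightarrow> real \<Rightarrow> (real \<Rightarrow> 'w \<Rightarrow> hdot1) \<Rightarrow> bool" where
  "stoch_convolution M \<beta> b \<nu> Z \<longleftrightarrow>
     (\<forall>t\<ge>0. Z t \<in> borel_measurable M \<and>
        (\<exists>I. (\<forall>k. k \<noteq> 0 \<longrightarrow> has_wiener_integral M (\<beta> k) t (\<lambda>s. heat (\<nu> * (t - s)) (eb k)) (I k)) \<and>
             (AE x in M. ((\<lambda>k. b k *\<^sub>R I k x) has_sum Z t x) (- {0})))) \<and>
     (AE x in M. continuous_on {0..} (\<lambda>t. Z t x))"

text \<open>Mild solution on \<open>[0, \<infinity>)\<close>. The drift integral is a Bochner integral in \<open>hdot1\<close>; the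
  endpoint \<open>s = t\<close> is a null set and is left out because \<open>heat 0\<close> does not map into \<open>Hdot 1\<close>.\<close>

definition mild_solution ::
    "'w measure \<Rightarrow> (int \<Rightarrow> real \<Rightarrow> 'w \<Rightarrow> real) \<Rightarrow> (int \<Rightarrow> real) \<Rightarrow> real \<Rightarrow> real \<Rightarrow> hdot1 \<Rightarrow>
      (real \<Rightarrow> 'w \<Rightarrow> hdot1) \<Rightarrow> bool" where
  "mild_solution M \<beta> b \<nu> a y w \<longleftrightarrow>
     (\<forall>t\<ge>0. w t \<in> borel_measurable M) \<and>
     (AE x in M. continuous_on {0..} (\<lambda>t. w t x)) \<and>
     (\<exists>Z. stoch_convolution M \<beta> b \<nu> Z \<and>
        (AE x in M. \<forall>t\<ge>0.
           set_integrable lborel {0..<t} (\<lambda>s. heat (\<nu> * (t - s)) (nonlin a (emb (w s x)))) \<and>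
           w t x = heat (\<nu> * t) (emb y)
             + (LINT s:{0..<t}|lborel. heat (\<nu> * (t - s)) (nonlin a (emb (w s x))))
             + Z t x))"

definition adapted_to :: "(real \<Rightarrow> 'w measure) \<Rightarrow> (real \<Rightarrow> 'w \<Rightarrow> hdot1) \<Rightarrow> bool" where
  "adapted_to F w \<longleftrightarrow> (\<forall>t\<ge>0. w t \<in> borel_measurable (F t))"

text \<open>The property that defines the constant \<open>C\<^sub>*\<close>, over all filtered probability spaces with
  sample points of type \<open>'w\<close>.\<close>

definition stability_constant :: "'w itself \<Rightarrow> real \<Rightarrow> bool" where
  "stability_constant _ C \<longleftrightarrow> 0 < C \<and>
     (\<forall>(M :: 'w measure) F \<beta> b \<nu> p w1 w2 y1 y2.
        driving_noise M F \<beta> \<and> 0 < \<nu> \<and> 1 < p \<and> noise_finite b p \<and>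
        mild_solution M \<beta> b \<nu> (- 2) y1 w1 \<and> mild_solution M \<beta> b \<nu> (- 2) y2 w2 \<longrightarrow>
        (AE x in M. \<forall>t\<ge>0.
           (norm (emb (w1 t x) - emb (w2 t x)))\<^sup>2 \<le>
             (norm (emb y1 - emb y2))\<^sup>2 *
             exp (- (\<nu> * t / 4) + C / \<nu> *
               ((LINT s:{0..t}|lborel. (norm (w1 s x))\<^sup>2) + (LINT s:{0..t}|lborel. (norm (w2 s x))\<^sup>2)))))"

definition transition ::
    "'w measure \<Rightarrow> (hdot1 \<Rightarrow> real \<Rightarrow> 'w \<Rightarrow> hdot1) \<Rightarrow> real \<Rightarrow> (hdot1 \<Rightarrow> real) \<Rightarrow> hdot1 \<Rightarrow> real" where
  "transition M W t f y = (\<integral>x. f (W y t x) \<partial>M)"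

definition invariant_measure ::
    "'w measure \<Rightarrow> (hdot1 \<Rightarrow> real \<Rightarrow> 'w \<Rightarrow> hdot1) \<Rightarrow> hdot1 measure \<Rightarrow> bool" where
  "invariant_measure M W \<mu> \<longleftrightarrow>
     prob_space \<mu> \<and> sets \<mu> = sets borel \<and>
     (\<forall>t\<ge>0. \<forall>f\<in>borel_measurable borel. bounded (range f) \<longrightarrow>
        (\<integral>y. transition M W t f y \<partial>\<mu>) = (\<integral>y. f y \<partial>\<mu>))"

definition lip_norm :: "(hsp \<Rightarrow> real) \<Rightarrow> real" where
  "lip_norm \<phi> = Inf {L. L-lipschitz_on UNIV \<phi>}"

end

(*
  Ito's formula is avoided. A mild solution is projected on finitely many Fourier modes, where
  integrating the Wiener integrals by parts turns the equation into an integral equation driven by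
  Brownian motions. On a uniform time grid, the exponential of the sum of the increments of
  kappa |w|^2, compensated by the explicit Gaussian integrals, has expectation at most 1 because the
  noise increments are independent of the past. Refining the grid and then adding all modes, with
  Fatou's lemma each time, gives the exponential energy inequality; the cubic term drops out because
  the integral of (u w^2)_x vanishes.

  With kappa constant this bounds exponential moments of the dissipation and, combined with the
  defining property of C_*, makes E |w1(t) - w2(t)| decay exponentially. With kappa growing like
  exp(nu t) it bounds exponential moments of |w(t)|^2 uniformly in time, hence those of the
  invariant measure, and integrating the contraction estimate against the invariant measure
  concludes.
*)
theory Submission
  imports Defs
begin

section \<open>Completeness of the space of mean-zero functions\<close>

text \<open>Origin of the threshold: taking the square root in the defining property of the
  stability constant C leaves the decay exp(-\<nu> t / 8) against exp(C / (2 \<nu>) * (J1 + J2)),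
  where J1 and J2 are the dissipation integrals. AM-GM splits the product, so what is needed is the
  expectation of exp(C / \<nu> * J) for one solution. A constant weight c controls it if C / \<nu>
  \<le> 2 c (\<nu> - c B), at the price of growth exp(c B t), where B is the sum of the squared
  noise coefficients. With c = \<theta> C / \<nu>^2 and 8 C B \<le> \<nu>^3 the growth rate is at
  most \<theta> \<nu> / 8, below \<nu> / 8 when \<theta> < 1. Two measurability obstacles shape the
  statements. Measurability in the sample point is not established for time integrals of the
  dissipation, so their exponentials are dominated almost surely by multiples of a measurable
  \<open>G\<close> with integral at most 1. Measurability of \<open>transition M W t f\<close> in
  the initial datum is not part of \<open>invariant_measure\<close>; integrability is extracted from
  the invariance identity.\<close>

lemma measure_circ: "measure circ {0..<2 * pi} = 2 * pi"
  using emeasure_circ unfolding space_circ by (simp add: measure_def)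

text \<open>Cauchy-Schwarz against the constant 1, in the form that |f| has nonnegative variance. It
  transfers L2 convergence to L1, where means and almost everywhere bounds are read off.\<close>

lemma L1_le_L2_circ:
  assumes "f \<in> borel_measurable circ" "integrable circ (\<lambda>x. (f x)\<^sup>2)"
  shows "(\<integral>x. \<bar>f x\<bar> \<partial>circ) \<le> sqrt (2 * pi) * sqrt (\<integral>x. (f x)\<^sup>2 \<partial>circ)"
proof -
  define I where "I = (\<integral>x. \<bar>f x\<bar> \<partial>circ)"
  define Q where "Q = (\<integral>x. (f x)\<^sup>2 \<partial>circ)"
  have intf: "integrable circ (\<lambda>x. \<bar>f x\<bar>)"
    using integrable_L2[OF assms] by simp
  have "0 \<le> (\<integral>x. (\<bar>f x\<bar> - I / (2 * pi))\<^sup>2 \<partial>circ)"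
    by simp
  also have "\<dots> = (\<integral>x. (f x)\<^sup>2 - 2 * (I / (2 * pi)) * \<bar>f x\<bar> + (I / (2 * pi))\<^sup>2 \<partial>circ)"
    by (rule Bochner_Integration.integral_cong) (auto simp: power2_diff algebra_simps)
  also have "\<dots> = Q - 2 * (I / (2 * pi)) * I + (I / (2 * pi))\<^sup>2 * (2 * pi)"
    using assms intf by (simp add: I_def Q_def measure_circ)
  finally have "I\<^sup>2 \<le> 2 * pi * Q"
    by (simp add: power2_eq_square field_simps)
  then have "I \<le> sqrt (2 * pi * Q)"
    by (rule real_le_rsqrt)
  then show ?thesis by (simp add: I_def Q_def real_sqrt_mult)
qed

lemma norm_hsp_sq: "(norm u)\<^sup>2 = (\<integral>x. (rep_hsp u x)\<^sup>2 \<partial>circ)"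
  unfolding power2_norm_eq_inner inner_hsp_def by (simp add: power2_eq_square)

lemma rep_diff_hsp: "AE x in circ. rep_hsp (u - v) x = rep_hsp u x - rep_hsp v x"
  using rep_plus_hsp[of u "- v"] rep_scaleR_hsp[of "-1" v]
  unfolding uminus_hsp_def minus_hsp_def by eventually_elim simp

text \<open>Stated for any function that agrees almost everywhere with the representative, because
  \<open>rep_hsp\<close> commutes with the vector space operations only almost everywhere.\<close>

lemma norm_hsp_nn:
  assumes "AE x in circ. rep_hsp w x = f x"
  shows "(\<integral>\<^sup>+x. ennreal ((f x)\<^sup>2) \<partial>circ) = ennreal ((norm w)\<^sup>2)"
proof -
  have "(\<integral>\<^sup>+x. ennreal ((f x)\<^sup>2) \<partial>circ) = (\<integral>\<^sup>+x. ennreal ((rep_hsp w x)\<^sup>2) \<partial>circ)"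
    by (rule nn_integral_cong_AE) (use assms in eventually_elim, simp)
  then show ?thesis
    by (simp add: nn_integral_eq_integral rep_hsp_D norm_hsp_sq)
qed

lemma L1_le_norm_hsp: "(\<integral>x. \<bar>rep_hsp u x\<bar> \<partial>circ) \<le> sqrt (2 * pi) * norm u"
  using L1_le_L2_circ[OF rep_hsp_D(1,2), of u] by (simp flip: norm_hsp_sq)

text \<open>As in the proof of the Riesz-Fischer theorem, a rapidly Cauchy subsequence converges almost everywhere.\<close>

instance hsp :: complete_space
proof
  fix X :: "nat \<Rightarrow> hsp"
  assume X: "Cauchy X"
  have "\<exists>N. \<forall>m\<ge>N. \<forall>n\<ge>N. dist (X m) (X n) < (1/2)^j" for j :: nat
    by (rule metric_CauchyD[OF X]) simp
  then obtain N where N: "\<And>j m n. m \<ge> N j \<Longrightarrow> n \<ge> N j \<Longrightarrow> dist (X m) (X n) < (1/2)^j"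
    by metis
  \<comment> \<open>The maximum makes the chosen indices nondecreasing, so \<open>Y m\<close> and
    \<open>Y n\<close> are within \<open>(1/2)^j\<close> as soon as both positions are at least
    \<open>j\<close>.\<close>
  define r where "r j = Max (N ` {..j})" for j
  have r: "r j \<ge> N j" for j unfolding r_def by (intro Max_ge) auto
  have rm: "r i \<le> r j" if "i \<le> j" for i j
    unfolding r_def using that by (intro Max_mono image_mono) auto
  define Y where "Y j = X (r j)" for j
  have Y: "norm (Y m - Y n) < (1/2)^j" if "m \<ge> j" "n \<ge> j" for j m n
    using N[of j "r m" "r n"] r[of j] rm[OF that(1)] rm[OF that(2)] by (auto simp: Y_def dist_norm)
  define g where "g j x = rep_hsp (Y (Suc j)) x - rep_hsp (Y j) x" for j x
  have g [measurable]: "g j \<in> borel_measurable circ" for j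
    unfolding g_def by measurable
  have gint: "(\<integral>\<^sup>+x. ennreal \<bar>g j x\<bar> \<partial>circ) \<le> ennreal (sqrt (2 * pi) * (1/2)^j)" for j
  proof -
    have "(\<integral>\<^sup>+x. ennreal \<bar>g j x\<bar> \<partial>circ) = (\<integral>\<^sup>+x. ennreal \<bar>rep_hsp (Y (Suc j) - Y j) x\<bar> \<partial>circ)"
      by (rule nn_integral_cong_AE) (use rep_diff_hsp[of "Y (Suc j)" "Y j"] in eventually_elim, simp add: g_def)
    also have "\<dots> = ennreal (\<integral>x. \<bar>rep_hsp (Y (Suc j) - Y j) x\<bar> \<partial>circ)"
      by (rule nn_integral_eq_integral) (use integrable_L2[OF rep_hsp_D(1,2)] in auto)
    also have "\<dots> \<le> ennreal (sqrt (2 * pi) * norm (Y (Suc j) - Y j))"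
      by (intro ennreal_leI L1_le_norm_hsp)
    also have "\<dots> \<le> ennreal (sqrt (2 * pi) * (1/2)^j)"
      using Y[of j "Suc j" j] by (intro ennreal_leI mult_left_mono) auto
    finally show ?thesis .
  qed
  have "(\<integral>\<^sup>+x. (\<Sum>j. ennreal \<bar>g j x\<bar>) \<partial>circ) = (\<Sum>j. \<integral>\<^sup>+x. ennreal \<bar>g j x\<bar> \<partial>circ)"
    by (rule nn_integral_suminf) measurable
  also have "\<dots> \<le> (\<Sum>j. ennreal (sqrt (2 * pi) * (1/2)^j))"
    by (rule suminf_le) (use gint in auto)
  also have "\<dots> < \<infinity>"
    by (subst suminf_ennreal2) (auto intro!: summable_mult summable_geometric)
  finally have "(\<integral>\<^sup>+x. (\<Sum>j. ennreal \<bar>g j x\<bar>) \<partial>circ) \<noteq> \<infinity>" by simp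
  then have "AE x in circ. (\<Sum>j. ennreal \<bar>g j x\<bar>) \<noteq> \<infinity>"
    by (rule nn_integral_PInf_AE[rotated]) measurable
  then have conv: "AE x in circ. convergent (\<lambda>n. rep_hsp (Y n) x)"
  proof (eventually_elim)
    case (elim x)
    have "summable (\<lambda>j. \<bar>g j x\<bar>)"
      by (rule summable_suminf_not_top) (use elim in auto)
    then have "summable (\<lambda>j. g j x)" by (rule summable_rabs_cancel)
    then have "convergent (\<lambda>n. rep_hsp (Y 0) x + (\<Sum>j<n. g j x))"
      by (intro convergent_add convergent_const) (simp add: summable_iff_convergent)
    moreover have "rep_hsp (Y 0) x + (\<Sum>j<n. g j x) = rep_hsp (Y n) x" for n
      by (induction n) (auto simp: g_def)
    ultimately show ?case by simp
  qed
  define f where "f x = lim (\<lambda>n. rep_hsp (Y n) x)" for x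
  have fm [measurable]: "f \<in> borel_measurable circ"
    unfolding f_def by measurable
  have lim: "AE x in circ. (\<lambda>n. rep_hsp (Y n) x) \<longlonglongrightarrow> f x"
    using conv by eventually_elim (simp add: f_def convergent_LIMSEQ_iff)
  \<comment> \<open>Fatou's lemma turns the pointwise limit into an L2 limit along the
    subsequence.\<close>
  have le: "(\<integral>\<^sup>+x. ennreal ((f x - rep_hsp (Y m) x)\<^sup>2) \<partial>circ) \<le> ennreal (((1/2)^m)\<^sup>2)" for m
  proof -
    have "(\<integral>\<^sup>+x. ennreal ((f x - rep_hsp (Y m) x)\<^sup>2) \<partial>circ)
        = (\<integral>\<^sup>+x. liminf (\<lambda>n. ennreal ((rep_hsp (Y n) x - rep_hsp (Y m) x)\<^sup>2)) \<partial>circ)"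
    proof (rule nn_integral_cong_AE, use lim in eventually_elim)
      case (elim x)
      have "(\<lambda>n. ennreal ((rep_hsp (Y n) x - rep_hsp (Y m) x)\<^sup>2)) \<longlonglongrightarrow> ennreal ((f x - rep_hsp (Y m) x)\<^sup>2)"
        by (intro tendsto_intros elim)
      then show ?case
        by (intro lim_imp_Liminf[symmetric]) simp_all
    qed
    also have "\<dots> \<le> liminf (\<lambda>n. \<integral>\<^sup>+x. ennreal ((rep_hsp (Y n) x - rep_hsp (Y m) x)\<^sup>2) \<partial>circ)"
      by (rule nn_integral_liminf) measurable
    also have "\<dots> = liminf (\<lambda>n. ennreal ((norm (Y n - Y m))\<^sup>2))"
      by (simp add: norm_hsp_nn[OF rep_diff_hsp])
    also have "\<dots> \<le> limsup (\<lambda>n. ennreal ((norm (Y n - Y m))\<^sup>2))"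
      by (rule Liminf_le_Limsup) simp
    also have "\<dots> \<le> ennreal (((1/2)^m)\<^sup>2)"
      by (rule Limsup_bounded)
        (use Y[of m _ m] in \<open>auto intro!: eventually_sequentiallyI[of m] ennreal_leI power_mono less_imp_le\<close>)
    finally show ?thesis .
  qed
  define d where "d m x = f x - rep_hsp (Y m) x" for m x
  have dm [measurable]: "d m \<in> borel_measurable circ" for m unfolding d_def by measurable
  have di: "integrable circ (\<lambda>x. (d m x)\<^sup>2)" for m
    by (rule integrableI_nonneg) (use le[of m] in \<open>auto simp: d_def top.not_eq_extremum intro: order.strict_trans1\<close>)
  have d2: "(\<integral>x. (d m x)\<^sup>2 \<partial>circ) \<le> ((1/2)^m)\<^sup>2" for m
    using le[of m] nn_integral_eq_integral[OF di, of m] by (simp add: d_def ennreal_le_iff)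
  have fd: "f x = d m x + rep_hsp (Y m) x" for m x by (simp add: d_def)
  have "integrable circ (\<lambda>x. (d 0 x)\<^sup>2 + (rep_hsp (Y 0) x)\<^sup>2 + 2 * (d 0 x * rep_hsp (Y 0) x))"
    by (intro Bochner_Integration.integrable_add integrable_mult_right integrable_L2_mult di dm rep_hsp_D)
  then have f2: "integrable circ (\<lambda>x. (f x)\<^sup>2)"
    unfolding fd[of _ 0] by (simp add: power2_sum mult.assoc)
  \<comment> \<open>The mean is controlled by the L2 distance to \<open>Y m\<close>, which has mean
    zero, so it vanishes in the limit.\<close>
  have "\<bar>\<integral>x. f x \<partial>circ\<bar> \<le> sqrt (2 * pi) * (1/2)^m" for m
  proof -
    have "(\<integral>x. f x \<partial>circ) = (\<integral>x. d m x \<partial>circ) + (\<integral>x. rep_hsp (Y m) x \<partial>circ)"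
      unfolding fd[of _ m]
      by (intro Bochner_Integration.integral_add integrable_L2[OF dm di] integrable_L2[OF rep_hsp_D(1,2)])
    also have "\<dots> = (\<integral>x. d m x \<partial>circ)" by (simp add: rep_hsp_D)
    also have "\<bar>\<dots>\<bar> \<le> (\<integral>x. \<bar>d m x\<bar> \<partial>circ)"
      by (rule integral_abs_bound)
    also have "\<dots> \<le> sqrt (2 * pi) * sqrt (\<integral>x. (d m x)\<^sup>2 \<partial>circ)"
      by (rule L1_le_L2_circ[OF dm di])
    also have "\<dots> \<le> sqrt (2 * pi) * (1/2)^m"
      using real_sqrt_le_mono[OF d2[of m]] by (intro mult_left_mono) auto
    finally show ?thesis .
  qed
  moreover have "(\<lambda>m. sqrt (2 * pi) * (1/2)^m) \<longlonglongrightarrow> sqrt (2 * pi) * 0"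
    by (intro tendsto_intros LIMSEQ_realpow_zero) auto
  ultimately have "\<bar>\<integral>x. f x \<partial>circ\<bar> \<le> sqrt (2 * pi) * 0"
    by (intro LIMSEQ_le_const[of "\<lambda>m. sqrt (2 * pi) * (1/2)^m"]) blast+
  then have f0: "(\<integral>x. f x \<partial>circ) = 0" by simp
  have fL: "f \<in> L2_mean0" using fm f2 f0 by (simp add: L2_mean0_def)
  define u where "u = abs_hsp f"
  have u: "AE x in circ. rep_hsp u x = f x"
    unfolding u_def by (rule rep_abs_hsp[OF fL])
  have dist: "norm (u - Y m) \<le> (1/2)^m" for m
  proof -
    have "AE x in circ. rep_hsp (u - Y m) x = f x - rep_hsp (Y m) x"
      using u rep_diff_hsp[of u "Y m"] by eventually_elim simp
    from norm_hsp_nn[OF this] le[of m] have "(norm (u - Y m))\<^sup>2 \<le> ((1/2)^m)\<^sup>2"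
      by (simp add: ennreal_le_iff)
    then show ?thesis by (rule power2_le_imp_le) simp
  qed
  have "X \<longlonglongrightarrow> u"
  proof (rule metric_LIMSEQ_I)
    fix e :: real assume "0 < e"
    then obtain j where j: "(1/2)^j < e / 2"
      using real_arch_pow_inv[of "e/2" "1/2"] by auto
    have "dist (X n) u < e" if "n \<ge> N j" for n
    proof -
      have "dist (X n) u \<le> dist (X n) (Y j) + dist (Y j) u" by (rule dist_triangle)
      also have "dist (X n) (Y j) < (1/2)^j" unfolding Y_def by (rule N) (use that r in auto)
      also have "dist (Y j) u \<le> (1/2)^j" using dist[of j] by (simp add: dist_norm norm_minus_commute)
      finally show ?thesis using j by simp
    qed
    then show "\<exists>N. \<forall>n\<ge>N. dist (X n) u < e" by blast
  qed
  then show "convergent X" by (auto simp: convergent_def)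
qed

instance hsp :: banach ..

section \<open>Fourier series\<close>

lemma eb_orthonormal: "j \<noteq> 0 \<Longrightarrow> k \<noteq> 0 \<Longrightarrow> inner (eb j) (eb k) = (if j = k then 1 else 0)"
  using fc_eb[of j k] by (simp add: fc_def)

lemma bounded_linear_fc: "bounded_linear (\<lambda>u. fc u k)"
  unfolding fc_def by (rule bounded_linear_inner_left)

lemma fc_sum_eb:
  assumes "finite J" "J \<subseteq> - {0}" "j \<noteq> 0"
  shows "fc (\<Sum>k\<in>J. c k *\<^sub>R eb k) j = (if j \<in> J then c j else 0)"
proof -
  have "fc (\<Sum>k\<in>J. c k *\<^sub>R eb k) j = (\<Sum>k\<in>J. c k * inner (eb k) (eb j))"
    by (simp add: fc_def inner_sum_left)
  also have "\<dots> = (\<Sum>k\<in>J. if k = j then c j else 0)"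
    by (rule sum.cong[OF refl], subst eb_orthonormal) (use assms in auto)
  finally show ?thesis using assms by simp
qed

lemma norm_sum_eb:
  assumes "finite J" "J \<subseteq> - {0}"
  shows "(norm (\<Sum>k\<in>J. c k *\<^sub>R eb k))\<^sup>2 = (\<Sum>k\<in>J. (c k)\<^sup>2)"
proof -
  have "inner (\<Sum>k\<in>J. c k *\<^sub>R eb k) (\<Sum>k\<in>J. c k *\<^sub>R eb k) = (\<Sum>j\<in>J. c j * fc (\<Sum>k\<in>J. c k *\<^sub>R eb k) j)"
    by (subst inner_sum_right) (simp add: fc_def)
  also have "\<dots> = (\<Sum>j\<in>J. (c j)\<^sup>2)"
    by (rule sum.cong[OF refl], subst fc_sum_eb) (use assms in \<open>auto simp: power2_eq_square\<close>)
  finally show ?thesis by (simp add: power2_norm_eq_inner)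
qed

text \<open>A sequence of finite sets exhausting the nonzero integers. Along it the unordered sums
  become limits of sequences, the form that Fatou's lemma and dominated convergence act on.\<close>

definition modes :: "nat \<Rightarrow> int set" where
  "modes n = {- int n..int n} - {0}"

lemma finite_modes [simp]: "finite (modes n)" and modes_subset: "modes n \<subseteq> - {0}"
  and zero_notin_modes [simp]: "0 \<notin> modes n"
  by (auto simp: modes_def)

lemma modes_mono: "m \<le> n \<Longrightarrow> modes m \<subseteq> modes n"
  by (auto simp: modes_def)

lemma mem_modes: "k \<noteq> 0 \<Longrightarrow> k \<in> modes n \<longleftrightarrow> nat \<bar>k\<bar> \<le> n"
  by (auto simp: modes_def)

lemma filterlim_modes: "filterlim modes (finite_subsets_at_top (- {0})) sequentially"
proof (rule filterlim_finite_subsets_at_top[THEN iffD2], intro allI impI)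
  fix X :: "int set" assume X: "finite X \<and> X \<subseteq> - {0}"
  define N where "N = Max (insert 0 ((\<lambda>k. nat \<bar>k\<bar>) ` X))"
  have "X \<subseteq> modes n" if "N \<le> n" for n
  proof
    fix k assume k: "k \<in> X"
    then have "nat \<bar>k\<bar> \<le> N" unfolding N_def using X by (intro Max_ge) auto
    then show "k \<in> modes n" using k X that by (subst mem_modes) auto
  qed
  then show "\<forall>\<^sub>F n in sequentially. finite (modes n) \<and> X \<subseteq> modes n \<and> modes n \<subseteq> - {0}"
    using modes_subset by (intro eventually_sequentiallyI[of N]) auto
qed

lemma has_sum_modes: "(f has_sum s) (- {0}) \<Longrightarrow> (\<lambda>n. \<Sum>k\<in>modes n. f k) \<longlonglongrightarrow> s"
  unfolding has_sum_def by (rule filterlim_compose[OF _ filterlim_modes])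

lemma infsum_modes: "f summable_on (- {0}) \<Longrightarrow> (\<lambda>n. \<Sum>k\<in>modes n. f k) \<longlonglongrightarrow> (\<Sum>\<^sub>\<infinity>k\<in>- {0}. f k)"
  by (rule has_sum_modes) (rule has_sum_infsum)

text \<open>The squared distance of two partial sums is the difference of the partial sums of the
  squares, so the partial sums are Cauchy and completeness of \<open>hsp\<close> provides the limit.
  In contrast to \<open>exists_hsp_fc\<close>, square-summable coefficients suffice.\<close>

lemma riesz_fischer_hsp:
  assumes c: "(\<lambda>k. (c k)\<^sup>2) summable_on (- {0})"
  obtains u where "\<And>k. k \<noteq> 0 \<Longrightarrow> fc u k = c k" "(norm u)\<^sup>2 = (\<Sum>\<^sub>\<infinity>k\<in>- {0}. (c k)\<^sup>2)"
    "(\<lambda>n. \<Sum>k\<in>modes n. c k *\<^sub>R eb k) \<longlonglongrightarrow> u"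
proof -
  define s where "s n = (\<Sum>k\<in>modes n. c k *\<^sub>R eb k)" for n
  define C where "C n = (\<Sum>k\<in>modes n. (c k)\<^sup>2)" for n
  have C: "C \<longlonglongrightarrow> (\<Sum>\<^sub>\<infinity>k\<in>- {0}. (c k)\<^sup>2)"
    unfolding C_def by (rule infsum_modes[OF c])
  have diff: "(norm (s m - s n))\<^sup>2 = C m - C n" if "n \<le> m" for m n
  proof -
    have "s m - s n = (\<Sum>k\<in>modes m - modes n. c k *\<^sub>R eb k)"
      unfolding s_def using modes_mono[OF that] by (subst sum_diff) auto
    then have "(norm (s m - s n))\<^sup>2 = (\<Sum>k\<in>modes m - modes n. (c k)\<^sup>2)"
      using modes_subset[of m] by (simp add: norm_sum_eb Diff_subset_conv subset_iff)
    also have "\<dots> = C m - C n"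
      unfolding C_def using modes_mono[OF that] by (subst sum_diff) auto
    finally show ?thesis .
  qed
  have "Cauchy s"
  proof (rule metric_CauchyI)
    fix e :: real assume e: "0 < e"
    have "Cauchy C" using C by (rule LIMSEQ_imp_Cauchy)
    then obtain N where N: "\<And>m n. m \<ge> N \<Longrightarrow> n \<ge> N \<Longrightarrow> dist (C m) (C n) < e\<^sup>2"
      using metric_CauchyD[of C "e\<^sup>2"] e by (auto simp: zero_less_power)
    have *: "dist (s m) (s n) < e" if "n \<ge> N" "n \<le> m" for m n
    proof -
      have "(norm (s m - s n))\<^sup>2 < e\<^sup>2"
        using diff[OF that(2)] N[of m n] that by (simp add: dist_real_def)
      then show ?thesis using e by (simp add: dist_norm power2_less_imp_less)
    qed
    have "dist (s m) (s n) < e" if "m \<ge> N" "n \<ge> N" for m n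
      using *[of n m] *[of m n] that by (cases "n \<le> m") (auto simp: dist_commute)
    then show "\<exists>N. \<forall>m\<ge>N. \<forall>n\<ge>N. dist (s m) (s n) < e" by blast
  qed
  then obtain u where u: "s \<longlonglongrightarrow> u"
    using Cauchy_convergent convergent_def by blast
  have "fc u k = c k" if k: "k \<noteq> 0" for k
  proof (rule LIMSEQ_unique)
    show "(\<lambda>n. fc (s n) k) \<longlonglongrightarrow> fc u k"
      by (rule bounded_linear.tendsto[OF bounded_linear_fc u])
    have "fc (s n) k = c k" if "nat \<bar>k\<bar> \<le> n" for n
      using that k by (simp add: s_def fc_sum_eb modes_subset mem_modes)
    then show "(\<lambda>n. fc (s n) k) \<longlonglongrightarrow> c k"
      by (intro tendsto_eventually eventually_sequentiallyI[of "nat \<bar>k\<bar>"])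
  qed
  moreover have "(norm u)\<^sup>2 = (\<Sum>\<^sub>\<infinity>k\<in>- {0}. (c k)\<^sup>2)"
  proof (rule LIMSEQ_unique)
    show "(\<lambda>n. (norm (s n))\<^sup>2) \<longlonglongrightarrow> (norm u)\<^sup>2" by (intro tendsto_intros u)
    show "(\<lambda>n. (norm (s n))\<^sup>2) \<longlonglongrightarrow> (\<Sum>\<^sub>\<infinity>k\<in>- {0}. (c k)\<^sup>2)"
      using C unfolding s_def C_def by (simp add: norm_sum_eb modes_subset)
  qed
  ultimately show thesis using that u unfolding s_def by blast
qed

text \<open>Bessel's inequality: expand the squared distance from \<open>u\<close> to its projection
  onto finitely many modes.\<close>

lemma summable_fc: "(\<lambda>k. (fc u k)\<^sup>2) summable_on (- {0})"
proof (rule nonneg_bdd_above_summable_on)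
  show "bdd_above (sum (\<lambda>k. (fc u k)\<^sup>2) ` {F. F \<subseteq> - {0} \<and> finite F})"
  proof (rule bdd_aboveI[of _ "(norm u)\<^sup>2"], clarify)
    fix F :: "int set" assume F: "F \<subseteq> - {0}" "finite F"
    define p where "p = (\<Sum>k\<in>F. fc u k *\<^sub>R eb k)"
    have "0 \<le> (norm (u - p))\<^sup>2" by simp
    also have "\<dots> = (norm u)\<^sup>2 - 2 * inner u p + (norm p)\<^sup>2"
      by (simp add: power2_norm_eq_inner inner_diff_left inner_diff_right inner_commute)
    also have "inner u p = (\<Sum>k\<in>F. (fc u k)\<^sup>2)"
      by (simp add: p_def inner_sum_right power2_eq_square fc_def)
    also have "(norm p)\<^sup>2 = (\<Sum>k\<in>F. (fc u k)\<^sup>2)"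
      unfolding p_def by (rule norm_sum_eb) (use F in auto)
    finally show "(\<Sum>k\<in>F. (fc u k)\<^sup>2) \<le> (norm u)\<^sup>2" by simp
  qed
qed simp

text \<open>The Riesz-Fischer element built from the coefficients of \<open>u\<close> has the same
  coefficients, hence is \<open>u\<close> by completeness of the trigonometric system.\<close>

lemma parseval_hsp: "(norm u)\<^sup>2 = (\<Sum>\<^sub>\<infinity>k\<in>- {0}. (fc u k)\<^sup>2)"
  and fourier_series_hsp: "(\<lambda>n. \<Sum>k\<in>modes n. fc u k *\<^sub>R eb k) \<longlonglongrightarrow> u"
proof -
  obtain v where v: "\<And>k. k \<noteq> 0 \<Longrightarrow> fc v k = fc u k" "(norm v)\<^sup>2 = (\<Sum>\<^sub>\<infinity>k\<in>- {0}. (fc u k)\<^sup>2)"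
    "(\<lambda>n. \<Sum>k\<in>modes n. fc u k *\<^sub>R eb k) \<longlonglongrightarrow> v"
    using riesz_fischer_hsp[OF summable_fc[of u]] by blast
  have "v = u" using v(1) by (rule hsp_eq_fcI)
  with v show "(norm u)\<^sup>2 = (\<Sum>\<^sub>\<infinity>k\<in>- {0}. (fc u k)\<^sup>2)"
    "(\<lambda>n. \<Sum>k\<in>modes n. fc u k *\<^sub>R eb k) \<longlonglongrightarrow> u" by auto
qed

text \<open>Poincare's inequality: every frequency has modulus at least 1.\<close>

lemma norm_emb_le: "norm (emb w) \<le> norm w"
proof (rule power2_le_imp_le)
  have "(fc (emb w) k)\<^sup>2 \<le> \<bar>real_of_int k\<bar>\<^sup>2 * (fc (emb w) k)\<^sup>2" if "k \<noteq> 0" for k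
  proof -
    have "1 \<le> \<bar>real_of_int k\<bar>" using that by linarith
    then have "1 * (fc (emb w) k)\<^sup>2 \<le> \<bar>real_of_int k\<bar>\<^sup>2 * (fc (emb w) k)\<^sup>2"
      by (intro mult_right_mono one_le_power) auto
    then show ?thesis by simp
  qed
  then show "(norm (emb w))\<^sup>2 \<le> (norm w)\<^sup>2"
    unfolding parseval_hsp norm_hdot1_sq
    by (intro infsum_mono summable_fc summable_hdot1) auto
qed simp

lemma bounded_linear_emb: "bounded_linear emb"
  by (rule bounded_linear_intro[of _ 1]) (auto simp: emb_add emb_scaleR norm_emb_le)

lemma fourier_series_hdot1: "(\<lambda>n. \<Sum>k\<in>modes n. fc (emb w) k *\<^sub>R eb1 k) \<longlonglongrightarrow> w"
  by (rule has_sum_modes) (rule has_sum_eb1)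

text \<open>Trigonometric polynomials are dense in \<open>hdot1\<close>. Together with the bilinear
  version this reduces multilinear identities to explicit integrals of basis functions.\<close>

lemma bounded_linear_eq_0_hdot1:
  assumes "bounded_linear L" "\<And>k. k \<noteq> 0 \<Longrightarrow> L (eb1 k) = 0"
  shows "L w = 0"
proof -
  interpret bounded_linear L by fact
  have "(\<lambda>n. L (\<Sum>k\<in>modes n. fc (emb w) k *\<^sub>R eb1 k)) \<longlonglongrightarrow> L w"
    by (rule tendsto) (rule fourier_series_hdot1)
  moreover have "L (\<Sum>k\<in>modes n. fc (emb w) k *\<^sub>R eb1 k) = 0" for n
    unfolding sum
  proof (rule sum.neutral, rule ballI)
    fix k assume "k \<in> modes n"
    then have "k \<noteq> 0" by (auto simp: modes_def)
    then show "L (fc (emb w) k *\<^sub>R eb1 k) = 0" by (simp add: scaleR assms(2))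
  qed
  ultimately show ?thesis by (simp add: LIMSEQ_const_iff)
qed

lemma bilinear_eq_0_hdot1:
  assumes "\<And>v. bounded_linear (\<lambda>u. h u v)" "\<And>u. bounded_linear (h u)"
    and "\<And>j k. j \<noteq> 0 \<Longrightarrow> k \<noteq> 0 \<Longrightarrow> h (eb1 j) (eb1 k) = 0"
  shows "h u v = 0"
  by (rule bounded_linear_eq_0_hdot1[OF assms(2)])
    (rule bounded_linear_eq_0_hdot1[OF assms(1)], rule assms(3))

section \<open>Derivative, velocity and the trilinear form\<close>

definition inv_square_sum :: real where
  "inv_square_sum = (\<Sum>\<^sub>\<infinity>k\<in>- {0::int}. 1 / (real_of_int k)\<^sup>2)"

lemma inv_square_sum_nonneg: "0 \<le> inv_square_sum"
  unfolding inv_square_sum_def by (rule infsum_nonneg) simp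

text \<open>The embedding constant that AM-GM produces; Cauchy-Schwarz would give the smaller
  \<open>sqrt inv_square_sum\<close>.\<close>

definition sup_const :: real where "sup_const = (inv_square_sum + 1) / 2"

lemma sup_const_pos: "0 < sup_const"
  using inv_square_sum_nonneg by (simp add: sup_const_def)

text \<open>AM-GM applied to the factors 1 / |k| and |k| |c_k|, c_k being the coefficient, with
  weight \<open>norm w\<close>. The weight makes the resulting bound homogeneous in
  \<open>w\<close>.\<close>

lemma sum_abs_fc_le:
  assumes "finite J" "J \<subseteq> - {0}"
  shows "(\<Sum>k\<in>J. \<bar>fc (emb w) k\<bar>) \<le> sup_const * norm w"
proof (cases "w = 0")
  case True
  then show ?thesis by (simp add: emb_zero fc_zero)
next
  case False
  define r where "r = norm w"
  have r: "0 < r" using False by (simp add: r_def)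
  have "\<bar>fc (emb w) k\<bar> \<le> (r * (1 / (real_of_int k)\<^sup>2) + (\<bar>real_of_int k\<bar>\<^sup>2 * (fc (emb w) k)\<^sup>2) / r) / 2" if "k \<in> J" for k
  proof -
    define a where "a = real_of_int k"
    define c where "c = \<bar>fc (emb w) k\<bar>"
    have a: "a \<noteq> 0" using that assms by (auto simp: a_def)
    have "0 \<le> (r / \<bar>a\<bar> - \<bar>a\<bar> * c)\<^sup>2" by simp
    also have "\<dots> = r\<^sup>2 / a\<^sup>2 - 2 * r * c + a\<^sup>2 * c\<^sup>2"
      using a by (simp add: power2_diff power_divide power_mult_distrib)
    finally have "2 * r * c \<le> r\<^sup>2 / a\<^sup>2 + a\<^sup>2 * c\<^sup>2" by simp
    then have "2 * r * c / (2 * r) \<le> (r\<^sup>2 / a\<^sup>2 + a\<^sup>2 * c\<^sup>2) / (2 * r)"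
      using r by (intro divide_right_mono) auto
    moreover have "(r\<^sup>2 / a\<^sup>2 + a\<^sup>2 * c\<^sup>2) / (2 * r) = (r * (1 / a\<^sup>2) + a\<^sup>2 * c\<^sup>2 / r) / 2"
      using r by (simp add: field_simps power2_eq_square)
    moreover have "2 * r * c / (2 * r) = c" using r by simp
    ultimately have "c \<le> (r * (1 / a\<^sup>2) + a\<^sup>2 * c\<^sup>2 / r) / 2" by metis
    then show ?thesis by (simp add: a_def c_def)
  qed
  then have "(\<Sum>k\<in>J. \<bar>fc (emb w) k\<bar>) \<le>
      (\<Sum>k\<in>J. (r * (1 / (real_of_int k)\<^sup>2) + (\<bar>real_of_int k\<bar>\<^sup>2 * (fc (emb w) k)\<^sup>2) / r) / 2)"
    by (rule sum_mono)
  also have "\<dots> = (r * (\<Sum>k\<in>J. 1 / (real_of_int k)\<^sup>2) + (\<Sum>k\<in>J. \<bar>real_of_int k\<bar>\<^sup>2 * (fc (emb w) k)\<^sup>2) / r) / 2"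
    by (simp only: sum_divide_distrib[symmetric] sum.distrib sum_distrib_left)
  also have "\<dots> \<le> (r * inv_square_sum + r\<^sup>2 / r) / 2"
    unfolding inv_square_sum_def
    using r sum_le_norm_hdot1_sq[OF assms, of w] assms
    by (intro divide_right_mono add_mono mult_left_mono finite_sum_le_infsum summable_inverse_squares_int)
      (auto simp: r_def)
  also have "\<dots> = sup_const * norm w"
    using r by (simp add: sup_const_def r_def power2_eq_square algebra_simps)
  finally show ?thesis .
qed

lemma rep_sum_hsp: "AE x in circ. rep_hsp (\<Sum>k\<in>J. u k) x = (\<Sum>k\<in>J. rep_hsp (u k) x)"
proof (induction J rule: infinite_finite_induct)
  case (insert k J)
  then show ?case
    using rep_plus_hsp[of "u k" "\<Sum>k\<in>J. u k"] by (auto elim: eventually_elim2)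
qed (use rep_zero_hsp in auto)

lemma rep_eb: "AE x in circ. rep_hsp (eb k) x = trig k x"
  unfolding eb_def by (rule rep_abs_hsp[OF trig_L2_mean0])

lemma rep_trig_sum: "AE x in circ. rep_hsp (\<Sum>k\<in>modes n. c k *\<^sub>R eb k) x = (\<Sum>k\<in>modes n. c k * trig k x)"
proof -
  have "AE x in circ. rep_hsp (c k *\<^sub>R eb k) x = c k * trig k x" for k
    using rep_scaleR_hsp[of "c k" "eb k"] rep_eb[of k] by eventually_elim simp
  then have "AE x in circ. \<forall>k\<in>modes n. rep_hsp (c k *\<^sub>R eb k) x = c k * trig k x"
    by (intro AE_finite_allI) auto
  then show ?thesis
    using rep_sum_hsp[of "\<lambda>k. c k *\<^sub>R eb k" "modes n"] by eventually_elim simp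
qed

text \<open>All partial sums of the Fourier series are bounded by the constant, so the excess
  \<open>g\<close> of |w| over it is at most the distance to a partial sum. That distance tends to 0
  in L1, hence \<open>g\<close> vanishes almost everywhere.\<close>

lemma rep_emb_bound: "AE x in circ. \<bar>rep_hsp (emb w) x\<bar> \<le> sup_const * norm w"
proof -
  define K where "K = sup_const * norm w"
  define g where "g x = max 0 (\<bar>rep_hsp (emb w) x\<bar> - K)" for x
  have [measurable]: "g \<in> borel_measurable circ" unfolding g_def by measurable
  define s where "s n = (\<Sum>k\<in>modes n. fc (emb w) k *\<^sub>R eb k)" for n
  have gs: "AE x in circ. g x \<le> \<bar>rep_hsp (emb w - s n) x\<bar>" for n
    using rep_diff_hsp[of "emb w" "s n"] rep_trig_sum[of "fc (emb w)" n]
  proof eventually_elim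
    case (elim x)
    have "\<bar>\<Sum>k\<in>modes n. fc (emb w) k * trig k x\<bar> \<le> (\<Sum>k\<in>modes n. \<bar>fc (emb w) k\<bar>)"
      by (rule order_trans[OF sum_abs], rule sum_mono) (simp add: abs_mult mult_left_le abs_trig_le)
    also have "\<dots> \<le> K"
      unfolding K_def by (rule sum_abs_fc_le) (auto simp: modes_subset)
    finally show ?case using elim unfolding g_def s_def by linarith
  qed
  have le: "(\<integral>\<^sup>+x. ennreal (g x) \<partial>circ) \<le> ennreal (sqrt (2 * pi) * norm (emb w - s n))" for n
  proof -
    have "(\<integral>\<^sup>+x. ennreal (g x) \<partial>circ) \<le> (\<integral>\<^sup>+x. ennreal \<bar>rep_hsp (emb w - s n) x\<bar> \<partial>circ)"
      by (rule nn_integral_mono_AE) (use gs[of n] in eventually_elim, simp add: ennreal_leI)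
    also have "\<dots> = ennreal (\<integral>x. \<bar>rep_hsp (emb w - s n) x\<bar> \<partial>circ)"
      by (rule nn_integral_eq_integral) (use integrable_L2[OF rep_hsp_D(1,2)] in auto)
    also have "\<dots> \<le> ennreal (sqrt (2 * pi) * norm (emb w - s n))"
      by (intro ennreal_leI L1_le_norm_hsp)
    finally show ?thesis .
  qed
  have "(\<lambda>n. ennreal (sqrt (2 * pi) * norm (emb w - s n))) \<longlonglongrightarrow> ennreal (sqrt (2 * pi) * norm (emb w - emb w))"
    unfolding s_def by (intro tendsto_intros fourier_series_hsp)
  then have "(\<integral>\<^sup>+x. ennreal (g x) \<partial>circ) \<le> ennreal (sqrt (2 * pi) * norm (emb w - emb w))"
    by (rule LIMSEQ_le_const) (use le in blast)
  then have "(\<integral>\<^sup>+x. ennreal (g x) \<partial>circ) = 0" by simp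
  then have "AE x in circ. ennreal (g x) = 0" by (subst (asm) nn_integral_0_iff_AE) auto
  then show ?thesis
    unfolding K_def[symmetric] by eventually_elim (auto simp: g_def ennreal_eq_0_iff)
qed

section \<open>Derivative and velocity as Fourier multipliers\<close>

lemma summable_fc_reflect:
  "(\<lambda>k. \<bar>real_of_int k\<bar>\<^sup>2 * (fc (emb w) (- k))\<^sup>2) summable_on (- {0})"
  "(\<Sum>\<^sub>\<infinity>k\<in>- {0}. \<bar>real_of_int k\<bar>\<^sup>2 * (fc (emb w) (- k))\<^sup>2) = (norm w)\<^sup>2"
proof -
  have b: "bij_betw uminus (- {0::int}) (- {0})"
    by (rule bij_betwI[of _ _ _ uminus]) auto
  show "(\<lambda>k. \<bar>real_of_int k\<bar>\<^sup>2 * (fc (emb w) (- k))\<^sup>2) summable_on (- {0})"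
    using summable_on_reindex_bij_betw[OF b, of "\<lambda>k. \<bar>real_of_int k\<bar>\<^sup>2 * (fc (emb w) k)\<^sup>2"] summable_hdot1[of w]
    by simp
  show "(\<Sum>\<^sub>\<infinity>k\<in>- {0}. \<bar>real_of_int k\<bar>\<^sup>2 * (fc (emb w) (- k))\<^sup>2) = (norm w)\<^sup>2"
    using infsum_reindex_bij_betw[OF b, of "\<lambda>k. \<bar>real_of_int k\<bar>\<^sup>2 * (fc (emb w) k)\<^sup>2"]
    by (simp add: norm_hdot1_sq)
qed

text \<open>The weak derivative in the real basis. The derivative of e_k is -k e_{-k}, so
  differentiation exchanges the coefficients at k and -k.\<close>

definition dx :: "hdot1 \<Rightarrow> hsp" where
  "dx w = (THE v. \<forall>k. k \<noteq> 0 \<longrightarrow> fc v k = of_int k * fc (emb w) (- k))"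

text \<open>The coefficients are square-summable with sum \<open>(norm w)\<^sup>2\<close>, so
  \<open>riesz_fischer_hsp\<close> provides the element; they need not be absolutely
  summable.\<close>

lemma fc_dx: "k \<noteq> 0 \<Longrightarrow> fc (dx w) k = of_int k * fc (emb w) (- k)"
  and norm_dx: "norm (dx w) = norm w"
proof -
  let ?c = "\<lambda>k. of_int k * fc (emb w) (- k)"
  have sq: "(?c k)\<^sup>2 = \<bar>real_of_int k\<bar>\<^sup>2 * (fc (emb w) (- k))\<^sup>2" for k
    by (simp add: power_mult_distrib)
  obtain v where v: "\<And>k. k \<noteq> 0 \<Longrightarrow> fc v k = ?c k" "(norm v)\<^sup>2 = (\<Sum>\<^sub>\<infinity>k\<in>- {0}. (?c k)\<^sup>2)"
    using riesz_fischer_hsp[of ?c] summable_fc_reflect(1)[of w] unfolding sq by blast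
  have "dx w = v"
    unfolding dx_def
  proof (rule the_equality)
    show "u = v" if "\<forall>k. k \<noteq> 0 \<longrightarrow> fc u k = ?c k" for u
      using that v by (intro hsp_eq_fcI) auto
  qed (use v in auto)
  then show "k \<noteq> 0 \<Longrightarrow> fc (dx w) k = ?c k" "norm (dx w) = norm w"
    using v summable_fc_reflect(2)[of w] by (auto simp: sq)
qed

lemma linear_dx: "dx (u + v) = dx u + dx v" "dx (c *\<^sub>R u) = c *\<^sub>R dx u"
  by (rule hsp_eq_fcI; simp add: fc_dx fc_add fc_scaleR emb_add emb_scaleR algebra_simps)+

lemma dx_eb1: "k \<noteq> 0 \<Longrightarrow> dx (eb1 k) = - of_int k *\<^sub>R eb (- k)"
  by (rule hsp_eq_fcI) (auto simp: fc_dx emb_eb1 fc_eb fc_scaleR fc_minus)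

text \<open>The multiplier of -(-d^2/dx^2)^{-1/2}. Taking values in \<open>hdot1\<close> makes the
  velocity bounded and differentiable, as the product rule requires; \<open>velocity_emb\<close>
  identifies it with \<open>velocity\<close>.\<close>

definition vel :: "hdot1 \<Rightarrow> hdot1" where
  "vel w = (THE u. \<forall>k. k \<noteq> 0 \<longrightarrow> fc (emb u) k = - (fc (emb w) k / \<bar>of_int k\<bar>))"

lemma fc_vel: "k \<noteq> 0 \<Longrightarrow> fc (emb (vel w)) k = - (fc (emb w) k / \<bar>of_int k\<bar>)"
proof -
  let ?c = "\<lambda>k. - (fc (emb w) k / \<bar>real_of_int k\<bar>)"
  have "(\<lambda>k. \<bar>real_of_int k\<bar>\<^sup>2 * (?c k)\<^sup>2) summable_on (- {0})"
    by (rule summable_on_cong[THEN iffD1, OF _ summable_fc[of "emb w"]]) (simp add: power_divide)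
  then obtain v where v: "\<And>k. k \<noteq> 0 \<Longrightarrow> fc (emb v) k = ?c k"
    using exists_hdot1_fc[of ?c] by blast
  have "vel w = v"
    unfolding vel_def
  proof (rule the_equality)
    show "u = v" if "\<forall>k. k \<noteq> 0 \<longrightarrow> fc (emb u) k = ?c k" for u
      using that v hsp_eq_fcI[of "emb u" "emb v"] by (simp add: emb_inject)
  qed (use v in auto)
  then show "k \<noteq> 0 \<Longrightarrow> fc (emb (vel w)) k = ?c k" using v by simp
qed

text \<open>The multiplier gains one derivative: the \<open>hdot1\<close> norm of
  \<open>vel w\<close> is the L2 norm of \<open>w\<close>.\<close>

lemma norm_vel_le: "norm (vel w) \<le> norm w"
proof (rule power2_le_imp_le)
  have "\<bar>real_of_int k\<bar>\<^sup>2 * (fc (emb (vel w)) k)\<^sup>2 = (fc (emb w) k)\<^sup>2" if "k \<noteq> 0" for k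
    using that by (simp add: fc_vel power_divide)
  then have "(norm (vel w))\<^sup>2 = (norm (emb w))\<^sup>2"
    unfolding norm_hdot1_sq[of "vel w"] parseval_hsp by (intro infsum_cong) auto
  also have "\<dots> \<le> (norm w)\<^sup>2" by (intro power_mono norm_emb_le) simp
  finally show "(norm (vel w))\<^sup>2 \<le> (norm w)\<^sup>2" .
qed simp

lemma hdot1_eq_fcI: "(\<And>k. k \<noteq> 0 \<Longrightarrow> fc (emb u) k = fc (emb v) k) \<Longrightarrow> u = v"
  using hsp_eq_fcI[of "emb u" "emb v"] by (simp add: emb_inject)

lemma bounded_linear_vel: "bounded_linear vel"
proof (rule bounded_linear_intro[of _ 1])
  show "vel (u + v) = vel u + vel v" for u v
    by (rule hdot1_eq_fcI) (simp add: fc_vel emb_add fc_add add_divide_distrib)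
  show "vel (c *\<^sub>R u) = c *\<^sub>R vel u" for c u
    by (rule hdot1_eq_fcI) (simp add: fc_vel emb_scaleR fc_scaleR)
qed (simp add: norm_vel_le)

text \<open>The integral of u_x w v. Fourier coefficients of the nonlinearity are values of this
  form, and the energy cancellation becomes an algebraic identity for it.\<close>

definition tri :: "hdot1 \<Rightarrow> hdot1 \<Rightarrow> hdot1 \<Rightarrow> real" where
  "tri u w v = (\<integral>x. rep_hsp (dx u) x * (rep_hsp (emb w) x * rep_hsp (emb v) x) \<partial>circ)"

lemma mult_emb_bound:
  "AE x in circ. \<bar>rep_hsp f x * (rep_hsp (emb w) x * rep_hsp (emb v) x)\<bar>
      \<le> \<bar>rep_hsp f x\<bar> * (sup_const\<^sup>2 * norm w * norm v)"
  using rep_emb_bound[of w] rep_emb_bound[of v]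
proof eventually_elim
  case (elim x)
  have "\<bar>rep_hsp (emb w) x\<bar> * \<bar>rep_hsp (emb v) x\<bar> \<le> (sup_const * norm w) * (sup_const * norm v)"
    using sup_const_pos by (intro mult_mono elim) auto
  then show ?case
    unfolding abs_mult by (intro mult_left_mono) (auto simp: power2_eq_square algebra_simps)
qed

lemma integrable_rep_hsp: "integrable circ (rep_hsp u)"
  by (rule integrable_L2) (rule rep_hsp_D)+

lemma integrable_tri: "integrable circ (\<lambda>x. rep_hsp f x * (rep_hsp (emb w) x * rep_hsp (emb v) x))"
  by (rule Bochner_Integration.integrable_bound[of _ "\<lambda>x. \<bar>rep_hsp f x\<bar> * (sup_const\<^sup>2 * norm w * norm v)"])
    (use mult_emb_bound[of f w v] integrable_rep_hsp[of f] in \<open>auto elim: eventually_mono\<close>)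

text \<open>One factor is a derivative in L2, hence in L1; the other two are bounded by
  \<open>rep_emb_bound\<close>.\<close>

lemma tri_bound: "\<bar>tri u w v\<bar> \<le> (sqrt (2 * pi) * sup_const\<^sup>2) * norm u * norm w * norm v"
proof -
  have "\<bar>tri u w v\<bar> \<le> (\<integral>x. \<bar>rep_hsp (dx u) x * (rep_hsp (emb w) x * rep_hsp (emb v) x)\<bar> \<partial>circ)"
    unfolding tri_def by (rule integral_abs_bound)
  also have "\<dots> \<le> (\<integral>x. \<bar>rep_hsp (dx u) x\<bar> * (sup_const\<^sup>2 * norm w * norm v) \<partial>circ)"
    by (intro integral_mono_AE integrable_abs integrable_tri integrable_mult_left integrable_rep_hsp mult_emb_bound)
  also have "\<dots> = (\<integral>x. \<bar>rep_hsp (dx u) x\<bar> \<partial>circ) * (sup_const\<^sup>2 * norm w * norm v)"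
    by simp
  also have "\<dots> \<le> (sqrt (2 * pi) * norm u) * (sup_const\<^sup>2 * norm w * norm v)"
    using L1_le_norm_hsp[of "dx u"] by (intro mult_right_mono) (auto simp: norm_dx)
  finally show ?thesis by (simp add: algebra_simps)
qed

lemma tri_commute: "tri u w v = tri u v w"
  unfolding tri_def by (simp add: mult.commute)

lemma tri_add1: "tri (u + u') w v = tri u w v + tri u' w v"
proof -
  have "tri (u + u') w v = (\<integral>x. rep_hsp (dx u) x * (rep_hsp (emb w) x * rep_hsp (emb v) x)
      + rep_hsp (dx u') x * (rep_hsp (emb w) x * rep_hsp (emb v) x) \<partial>circ)"
    unfolding tri_def linear_dx
    by (rule integral_cong_AE) (measurable, use rep_plus_hsp[of "dx u" "dx u'"] in eventually_elim, simp add: algebra_simps)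
  then show ?thesis unfolding tri_def by (simp add: integrable_tri)
qed

lemma tri_add2: "tri u (w + w') v = tri u w v + tri u w' v"
proof -
  have "tri u (w + w') v = (\<integral>x. rep_hsp (dx u) x * (rep_hsp (emb w) x * rep_hsp (emb v) x)
      + rep_hsp (dx u) x * (rep_hsp (emb w') x * rep_hsp (emb v) x) \<partial>circ)"
    unfolding tri_def emb_add
    by (rule integral_cong_AE) (measurable, use rep_plus_hsp[of "emb w" "emb w'"] in eventually_elim, simp add: algebra_simps)
  then show ?thesis unfolding tri_def by (simp add: integrable_tri)
qed

lemma tri_scale1: "tri (c *\<^sub>R u) w v = c * tri u w v"
proof -
  have "tri (c *\<^sub>R u) w v = (\<integral>x. c * (rep_hsp (dx u) x * (rep_hsp (emb w) x * rep_hsp (emb v) x)) \<partial>circ)"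
    unfolding tri_def linear_dx
    by (rule integral_cong_AE) (measurable, use rep_scaleR_hsp[of c "dx u"] in eventually_elim, simp)
  then show ?thesis unfolding tri_def by simp
qed

lemma tri_scale2: "tri u (c *\<^sub>R w) v = c * tri u w v"
proof -
  have "tri u (c *\<^sub>R w) v = (\<integral>x. c * (rep_hsp (dx u) x * (rep_hsp (emb w) x * rep_hsp (emb v) x)) \<partial>circ)"
    unfolding tri_def emb_scaleR
    by (rule integral_cong_AE) (measurable, use rep_scaleR_hsp[of c "emb w"] in eventually_elim, simp)
  then show ?thesis unfolding tri_def by simp
qed

lemma bounded_bilinear_tri12: "bounded_bilinear (\<lambda>u w. tri u w v)"
proof
  show "\<exists>K. \<forall>a b. norm (tri a b v) \<le> norm a * norm b * K"
  proof (intro exI allI)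
    show "norm (tri a b v) \<le> norm a * norm b * (sqrt (2 * pi) * sup_const\<^sup>2 * norm v)" for a b
      using tri_bound[of a b v] by (simp add: algebra_simps)
  qed
qed (simp_all add: tri_add1 tri_add2 tri_scale1 tri_scale2)

lemma bounded_bilinear_tri23: "bounded_bilinear (\<lambda>w v. tri u w v)"
proof
  show "\<exists>K. \<forall>a b. norm (tri u a b) \<le> norm a * norm b * K"
  proof (intro exI allI)
    show "norm (tri u a b) \<le> norm a * norm b * (sqrt (2 * pi) * sup_const\<^sup>2 * norm u)" for a b
      using tri_bound[of u a b] by (simp add: algebra_simps)
  qed
  show "tri u a (b + b') = tri u a b + tri u a b'" for a b b'
    using tri_add2[of u b b' a] by (simp only: tri_commute[of u a])
  show "tri u a (r *\<^sub>R b) = r *\<^sub>R tri u a b" for a b r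
    using tri_scale2[of u r b a] by (simp only: tri_commute[of u a] real_scaleR_def)
qed (simp_all add: tri_add2 tri_scale2)

section \<open>The nonlinearity in Fourier coefficients\<close>

lemma has_derivative_trig [derivative_intros]:
  "k \<noteq> 0 \<Longrightarrow> (trig k has_real_derivative - of_int k * trig (- k) x) (at x)"
proof -
  assume "k \<noteq> 0"
  define c where "c = 1 / sqrt pi"
  from \<open>k \<noteq> 0\<close> consider "k \<ge> 1" | "k \<le> -1" by linarith
  then show ?thesis
  proof cases
    case 1
    then have "trig k = (\<lambda>x. cos (of_int k * x) * c)" "trig (- k) x = sin (of_int k * x) * c"
      by (auto simp: trig_def c_def)
    then show ?thesis by (auto intro!: derivative_eq_intros)
  next
    case 2
    then have "trig k = (\<lambda>x. sin (- of_int k * x) * c)" "trig (- k) x = cos (- of_int k * x) * c"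
      by (auto simp: trig_def c_def fun_eq_iff)
    then show ?thesis by (auto intro!: derivative_eq_intros)
  qed
qed

lemma trig_periodic: "trig k (2 * pi) = trig k 0"
  using cos_int_2pin[of k] sin_int_2pin[of "- k"] by (simp add: trig_def mult.commute[of _ "2 * pi"])

lemma continuous_on_trig [continuous_intros]: "continuous_on A (trig k)"
  unfolding trig_def by (cases "k \<ge> 1") (auto intro!: continuous_intros)

lemma rep_dx_eb1: "k \<noteq> 0 \<Longrightarrow> AE x in circ. rep_hsp (dx (eb1 k)) x = - of_int k * trig (- k) x"
  unfolding dx_eb1 using rep_scaleR_hsp[of "- of_int k" "eb (- k)"] rep_eb[of "- k"] by eventually_elim simp

lemma tri_eb1:
  assumes "i \<noteq> 0" "j \<noteq> 0" "k \<noteq> 0"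
  shows "tri (eb1 i) (eb1 j) (eb1 k) = (\<integral>x. (- of_int i * trig (- i) x) * (trig j x * trig k x) \<partial>circ)"
  unfolding tri_def emb_eb1[OF assms(2)] emb_eb1[OF assms(3)]
proof (rule integral_cong_AE)
  show "AE x in circ. rep_hsp (dx (eb1 i)) x * (rep_hsp (eb j) x * rep_hsp (eb k) x)
      = (- of_int i * trig (- i) x) * (trig j x * trig k x)"
    using rep_dx_eb1[OF assms(1)] rep_eb[of j] rep_eb[of k] by eventually_elim simp
qed (use measurable_trig_circ[measurable] in measurable)

text \<open>The three terms add up to the derivative of a product of periodic functions, whose
  integral over a period vanishes.\<close>

lemma tri_cyclic_eb1:
  assumes "i \<noteq> 0" "j \<noteq> 0" "k \<noteq> 0"
  shows "tri (eb1 i) (eb1 j) (eb1 k) + tri (eb1 j) (eb1 i) (eb1 k) + tri (eb1 k) (eb1 i) (eb1 j) = 0"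
proof -
  let ?D = "\<lambda>i x. - of_int i * trig (- i) x"
  have int: "integrable circ (\<lambda>x. ?D i x * (trig j x * trig k x))" for i j k
  proof (rule integrable_circ_bounded[of _ "\<bar>of_int i\<bar>"])
    show "norm (?D i x * (trig j x * trig k x)) \<le> \<bar>of_int i\<bar>" for x
    proof -
      have "\<bar>trig (- i) x * (trig j x * trig k x)\<bar> \<le> 1 * (1 * 1)"
        unfolding abs_mult by (intro mult_mono abs_trig_le) auto
      then have "\<bar>real_of_int i\<bar> * \<bar>trig (- i) x * (trig j x * trig k x)\<bar> \<le> \<bar>of_int i\<bar> * 1"
        by (intro mult_left_mono) auto
      then show ?thesis by (simp add: abs_mult)
    qed
  qed (use measurable_trig_circ[measurable] in measurable)
  have "(\<integral>x. ?D i x * (trig j x * trig k x) + ?D j x * (trig i x * trig k x) + ?D k x * (trig i x * trig j x) \<partial>circ)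
      = trig i (2 * pi) * trig j (2 * pi) * trig k (2 * pi) - trig i 0 * trig j 0 * trig k 0"
    by (rule integral_circ_FTC)
      (auto intro!: derivative_eq_intros continuous_intros simp: assms algebra_simps)
  then show ?thesis
    unfolding tri_eb1[OF assms] tri_eb1[OF assms(2,1,3)] tri_eb1[OF assms(3,1,2)]
    by (simp only: trig_periodic Bochner_Integration.integral_add int Bochner_Integration.integrable_add)
qed

text \<open>The integral of (u w v)_x vanishes. Known on basis elements, the identity is extended by
  density in one argument at a time.\<close>

lemma tri_cyclic:
  fixes u w v :: hdot1
  shows "tri u w v + tri w u v + tri v u w = 0"
proof -
  have b13: "bounded_linear (\<lambda>u. tri u w v)" "bounded_linear (\<lambda>w. tri u w v)" "bounded_linear (\<lambda>v. tri u w v)" for u w v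
    using bounded_bilinear.bounded_linear_left[OF bounded_bilinear_tri12]
      bounded_bilinear.bounded_linear_right[OF bounded_bilinear_tri12]
      bounded_bilinear.bounded_linear_right[OF bounded_bilinear_tri23] by auto
  note bl = bounded_linear_add[OF bounded_linear_add]
  have 1: "tri u (eb1 j) (eb1 k) + tri (eb1 j) u (eb1 k) + tri (eb1 k) u (eb1 j) = 0"
    if "j \<noteq> 0" "k \<noteq> 0" for u j k
    by (rule bounded_linear_eq_0_hdot1[of "\<lambda>u. tri u (eb1 j) (eb1 k) + tri (eb1 j) u (eb1 k) + tri (eb1 k) u (eb1 j)"])
      (intro bl b13, use that tri_cyclic_eb1 in auto)
  have 2: "tri u w (eb1 k) + tri w u (eb1 k) + tri (eb1 k) u w = 0" if "k \<noteq> 0" for u w k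
    by (rule bounded_linear_eq_0_hdot1[of "\<lambda>w. tri u w (eb1 k) + tri w u (eb1 k) + tri (eb1 k) u w"])
      (intro bl b13, use that 1 in auto)
  have "bounded_linear (\<lambda>v. tri u w v + tri w u v + tri v u w)"
    by (intro bl b13)
  from bounded_linear_eq_0_hdot1[OF this, of v] 2 show ?thesis by blast
qed

lemma bounded_linear_dx: "bounded_linear dx"
  by (rule bounded_linear_intro[of _ 1]) (auto simp: linear_dx norm_dx)

text \<open>Integration by parts, checked on basis elements. It yields mean zero for the derivative
  of a product.\<close>

lemma inner_dx_antisym: "inner (dx u) (emb w) + inner (emb u) (dx w) = 0"
  by (rule bilinear_eq_0_hdot1[of "\<lambda>u w. inner (dx u) (emb w) + inner (emb u) (dx w)"];
      (intro bounded_linear_add bounded_linear_compose[OF bounded_linear_inner_left]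
        bounded_linear_compose[OF bounded_linear_inner_right] bounded_linear_dx bounded_linear_emb)?)
    (auto simp: dx_eb1 emb_eb1 eb_orthonormal)

lemma fc_dx_vel: "k \<noteq> 0 \<Longrightarrow> fc (dx (vel w)) k = - of_int (sgn k) * fc (emb w) (- k)"
  by (simp add: fc_dx fc_vel sgn_if)

text \<open>The Hilbert transform of \<open>w\<close> is \<open>dx (vel w)\<close>.\<close>

lemma inner_hilbert_self: "inner (dx (vel w)) (emb w) = 0"
proof -
  have "inner (dx (vel (eb1 j))) (emb (eb1 k)) + inner (emb (eb1 j)) (dx (vel (eb1 k))) = 0"
    if "j \<noteq> 0" "k \<noteq> 0" for j k
  proof -
    have "inner (dx (vel (eb1 j))) (emb (eb1 k)) = fc (dx (vel (eb1 j))) k"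
      "inner (emb (eb1 j)) (dx (vel (eb1 k))) = fc (dx (vel (eb1 k))) j"
      using that by (simp_all add: emb_eb1 fc_def inner_commute)
    then show ?thesis using that by (auto simp: fc_dx_vel emb_eb1 fc_eb sgn_if)
  qed
  then have "inner (dx (vel w)) (emb w) + inner (emb w) (dx (vel w)) = 0"
    by (rule bilinear_eq_0_hdot1[of "\<lambda>u w. inner (dx (vel u)) (emb w) + inner (emb u) (dx (vel w))", rotated 2])
      (assumption | intro bounded_linear_add bounded_linear_compose[OF bounded_linear_inner_left]
        bounded_linear_compose[OF bounded_linear_inner_right] bounded_linear_compose[OF bounded_linear_dx bounded_linear_vel]
        bounded_linear_emb)+
  then show ?thesis by (simp add: inner_commute)
qed

section \<open>Complex versus real Fourier coefficients\<close>

definition tc :: "(real \<Rightarrow> real) \<Rightarrow> int \<Rightarrow> real" where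
  "tc f k = (\<integral>x. f x * trig k x \<partial>circ)"

lemma tc_rep: "tc (rep_hsp u) k = fc u k"
  by (simp add: tc_def fc_eq_integral)

lemma integrable_times_bounded_circ:
  assumes f: "integrable circ f" and g: "g \<in> borel_measurable circ" "\<And>x. \<bar>g x\<bar> \<le> (1::real)"
  shows "integrable circ (\<lambda>x. f x * g x :: real)"
  by (rule Bochner_Integration.integrable_bound[OF f])
    (use f g in \<open>auto simp: abs_mult intro!: mult_left_le\<close>)

text \<open>After splitting into real and imaginary parts a common factor
  \<open>fourier_scale\<close> remains on both sides; these are the two shapes from which it has to
  be cancelled.\<close>

lemma scale_cancel:
  fixes a b c s :: real
  assumes "s \<noteq> 0"
  shows "- (a * s) = b * (c * s) \<Longrightarrow> a = - (b * c)" "a * s = - (b * s) \<Longrightarrow> a = - b"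
proof -
  show "a = - (b * c)" if "- (a * s) = b * (c * s)"
  proof -
    have "s * (a + b * c) = 0" using that by (simp add: algebra_simps)
    then show ?thesis using assms by (simp add: eq_neg_iff_add_eq_0)
  qed
  show "a = - b" if "a * s = - (b * s)"
  proof -
    have "s * (a + b) = 0" using that by (simp add: algebra_simps)
    then show ?thesis using assms by (simp add: eq_neg_iff_add_eq_0)
  qed
qed

text \<open>Conversion factor between the normalization 1 / sqrt pi of the real basis and the factor
  1 / (2 pi) of the complex coefficients.\<close>

definition fourier_scale :: real where "fourier_scale = sqrt pi / (2 * pi)"

lemma fourier_scale_neq_0 [simp]: "fourier_scale \<noteq> 0"
  by (simp add: fourier_scale_def)

text \<open>For k >= 1 the complex coefficient combines the cosine coefficient at k with the sine
  coefficient at -k; negative k gives the conjugate. The functions are arbitrary integrable ones,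
  hence \<open>tc\<close> instead of \<open>fc\<close>: velocity times vorticity need not have mean
  zero.\<close>

lemma fourier_tc:
  assumes f: "integrable circ f"
  shows "k \<ge> 1 \<Longrightarrow> fourier f k = (of_real (tc f k) - \<i> * of_real (tc f (- k))) * of_real fourier_scale"
    and "k \<le> -1 \<Longrightarrow> fourier f k = (of_real (tc f (- k)) + \<i> * of_real (tc f k)) * of_real fourier_scale"
    and "fourier f 0 = of_real ((\<integral>x. f x \<partial>circ) / (2 * pi))"
proof -
  have meas: "(\<lambda>x. cos (c * x)) \<in> borel_measurable circ" "(\<lambda>x. sin (c * x)) \<in> borel_measurable circ" for c :: real
    by (intro measurable_circ borel_measurable_continuous_onI continuous_intros)+
  have ic: "integrable circ (\<lambda>x. f x * cos (c * x))" "integrable circ (\<lambda>x. f x * sin (c * x))" for c :: real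
    by (intro integrable_times_bounded_circ f meas abs_cos_le_one abs_sin_le_one)+
  have e: "of_real (f x) * cis b = of_real (f x * cos b) + \<i> * of_real (f x * sin b)" for x b :: real
    by (simp add: complex_eq_iff)
  have main: "fourier f k = (of_real (\<integral>x. f x * cos (of_int k * x) \<partial>circ)
      - \<i> * of_real (\<integral>x. f x * sin (of_int k * x) \<partial>circ)) / of_real (2 * pi)" for k
  proof -
    have "(\<integral>x. of_real (f x) * cis (- of_int k * x) \<partial>circ)
        = (\<integral>x. complex_of_real (f x * cos (- of_int k * x)) \<partial>circ) +
        (\<integral>x. \<i> * complex_of_real (f x * sin (- of_int k * x)) \<partial>circ)"
      unfolding e
      by (intro Bochner_Integration.integral_add integrable_mult_right integrable_of_real ic)
    also have "\<dots> = of_real (\<integral>x. f x * cos (of_int k * x) \<partial>circ) - \<i> * of_real (\<integral>x. f x * sin (of_int k * x) \<partial>circ)"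
      by (simp del: of_real_mult)
    finally show ?thesis by (simp add: fourier_def)
  qed
  show "k \<ge> 1 \<Longrightarrow> fourier f k = (of_real (tc f k) - \<i> * of_real (tc f (- k))) * of_real fourier_scale"
    unfolding main tc_def trig_def fourier_scale_def
    by (simp add: complex_eq_iff)
  show "k \<le> -1 \<Longrightarrow> fourier f k = (of_real (tc f (- k)) + \<i> * of_real (tc f k)) * of_real fourier_scale"
    unfolding main tc_def trig_def fourier_scale_def
    by (simp add: complex_eq_iff)
  show "fourier f 0 = of_real ((\<integral>x. f x \<partial>circ) / (2 * pi))"
    unfolding main by simp
qed

text \<open>One complex equation at k >= 1 carries the two real equations at k and -k. The equation
  at 0 holds because elements of \<open>hsp\<close> have mean zero.\<close>

lemma is_weak_deriv_iff:
  assumes f: "integrable circ f"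
  shows "is_weak_deriv f v \<longleftrightarrow> (\<forall>k. k \<noteq> 0 \<longrightarrow> fc v k = of_int k * tc f (- k))"
proof
  assume *: "is_weak_deriv f v"
  have "fc v k = of_int k * tc f (- k) \<and> fc v (- k) = - of_int k * tc f k" if "k \<ge> 1" for k
  proof -
    have "fourier (rep_hsp v) k = \<i> * of_int k * fourier f k"
      using * by (simp add: is_weak_deriv_def)
    then show ?thesis
      using that scale_cancel(1)[OF fourier_scale_neq_0, of "fc v (- k)" "of_int k" "tc f k"]
      by (simp add: fourier_tc(1)[OF integrable_rep_hsp] fourier_tc(1)[OF f] tc_rep complex_eq_iff)
  qed
  from this this[of "- k" for k] show "\<forall>k. k \<noteq> 0 \<longrightarrow> fc v k = of_int k * tc f (- k)"
    by (metis (no_types, opaque_lifting) int_one_le_iff_zero_less add.inverse_inverse linorder_neqE_linordered_idom neg_0_less_iff_less of_int_minus)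
next
  assume *: "\<forall>k. k \<noteq> 0 \<longrightarrow> fc v k = of_int k * tc f (- k)"
  have "fourier (rep_hsp v) k = \<i> * of_int k * fourier f k" for k
  proof -
    consider "k = 0" | "k \<ge> 1" | "k \<le> -1" by linarith
    then show ?thesis
    proof cases
      case 1
      then show ?thesis by (simp add: fourier_tc(3)[OF integrable_rep_hsp] rep_hsp_D(3))
    next
      case 2
      then show ?thesis
        using * by (simp add: fourier_tc(1)[OF integrable_rep_hsp] fourier_tc(1)[OF f] tc_rep complex_eq_iff)
    next
      case 3
      then show ?thesis
        using * by (simp add: fourier_tc(2)[OF integrable_rep_hsp] fourier_tc(2)[OF f] tc_rep complex_eq_iff)
    qed
  qed
  then show "is_weak_deriv f v" by (simp add: is_weak_deriv_def)
qed

lemma weak_deriv_eqI: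
  assumes "integrable circ f" "\<And>k. k \<noteq> 0 \<Longrightarrow> fc v k = of_int k * tc f (- k)"
  shows "weak_deriv f = v"
  unfolding weak_deriv_def is_weak_deriv_iff[OF assms(1)]
  by (rule the_equality) (use assms in \<open>auto intro: hsp_eq_fcI\<close>)

text \<open>In the real basis the multiplier -i sgn k moves the coefficient at -k to index k with
  factor -sgn k, which is what differentiating \<open>vel w\<close> does.\<close>

lemma hilbert_emb: "hilbert (emb w) = dx (vel w)"
proof -
  have iff: "(\<forall>k. fourier (rep_hsp v) k = - \<i> * of_int (sgn k) * fourier (rep_hsp u) k) \<longleftrightarrow>
      (\<forall>k. k \<noteq> 0 \<longrightarrow> fc v k = - of_int (sgn k) * fc u (- k))" (is "?L \<longleftrightarrow> ?R") for u v
  proof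
    assume *: ?L
    have "fc v k = - fc u (- k) \<and> fc v (- k) = fc u k" if "k \<ge> 1" for k
      using *[rule_format, of k] that scale_cancel(2)[OF fourier_scale_neq_0, of "fc v k" "fc u (- k)"]
      by (simp add: fourier_tc(1)[OF integrable_rep_hsp] tc_rep complex_eq_iff)
    then show ?R
      by (metis (no_types, opaque_lifting) add.inverse_inverse int_one_le_iff_zero_less linorder_neqE_linordered_idom mult_minus1 mult_1 neg_0_less_iff_less of_int_1 of_int_minus sgn_neg sgn_pos)
  next
    assume *: ?R
    show ?L
    proof
      fix k :: int
      consider "k = 0" | "k \<ge> 1" | "k \<le> -1" by linarith
      then show "fourier (rep_hsp v) k = - \<i> * of_int (sgn k) * fourier (rep_hsp u) k"
      proof cases
        case 1
        then show ?thesis by (simp add: fourier_tc(3)[OF integrable_rep_hsp] rep_hsp_D(3))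
      next
        case 2
        then show ?thesis
          using * by (simp add: fourier_tc(1)[OF integrable_rep_hsp] tc_rep complex_eq_iff)
      next
        case 3
        then show ?thesis
          using * by (simp add: fourier_tc(2)[OF integrable_rep_hsp] tc_rep complex_eq_iff)
      qed
    qed
  qed
  show ?thesis
    unfolding hilbert_def iff
    by (rule the_equality) (auto simp: fc_dx_vel intro: hsp_eq_fcI)
qed

lemma velocity_emb: "velocity (emb w) = emb (vel w)"
  unfolding velocity_def hilbert_emb is_weak_deriv_iff[OF integrable_rep_hsp] tc_rep
proof (rule the_equality)
  show "\<forall>k. k \<noteq> 0 \<longrightarrow> fc (dx (vel w)) k = of_int k * fc (emb (vel w)) (- k)"
    by (simp add: fc_dx)
  show "u = emb (vel w)" if "\<forall>k. k \<noteq> 0 \<longrightarrow> fc (dx (vel w)) k = of_int k * fc u (- k)" for u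
  proof (rule hsp_eq_fcI)
    fix k :: int assume "k \<noteq> 0"
    then show "fc u k = fc (emb (vel w)) k"
      using that[rule_format, of "- k"] by (simp add: fc_dx)
  qed
qed

lemma L2_mult_emb:
  shows "integrable circ (\<lambda>x. (rep_hsp f x * rep_hsp (emb w) x)\<^sup>2)"
proof (rule Bochner_Integration.integrable_bound[of _ "\<lambda>x. (rep_hsp f x)\<^sup>2 * (sup_const * norm w)\<^sup>2"])
  show "AE x in circ. norm ((rep_hsp f x * rep_hsp (emb w) x)\<^sup>2) \<le> norm ((rep_hsp f x)\<^sup>2 * (sup_const * norm w)\<^sup>2)"
    using rep_emb_bound[of w]
  proof eventually_elim
    case (elim x)
    then have "\<bar>rep_hsp (emb w) x\<bar>\<^sup>2 \<le> (sup_const * norm w)\<^sup>2" by (rule power_mono) simp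
    then show ?case by (simp add: power_mult_distrib mult_left_mono)
  qed
qed (use rep_hsp_D in auto)

text \<open>Each product is in L2 because one factor is bounded; the mean vanishes by
  \<open>inner_dx_antisym\<close>.\<close>

lemma product_rule_L2_mean0:
  "(\<lambda>x. rep_hsp (dx u) x * rep_hsp (emb w) x + rep_hsp (dx w) x * rep_hsp (emb u) x) \<in> L2_mean0"
proof -
  let ?f = "\<lambda>x. rep_hsp (dx u) x * rep_hsp (emb w) x" and ?g = "\<lambda>x. rep_hsp (dx w) x * rep_hsp (emb u) x"
  have "integrable circ (\<lambda>x. (?f x)\<^sup>2 + (?g x)\<^sup>2 + 2 * (?f x * ?g x))"
    by (intro Bochner_Integration.integrable_add integrable_mult_right integrable_L2_mult L2_mult_emb) measurable
  then have "integrable circ (\<lambda>x. (?f x + ?g x)\<^sup>2)"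
    by (simp add: power2_sum mult.assoc)
  moreover have "(\<integral>x. ?f x + ?g x \<partial>circ) = 0"
    using inner_dx_antisym[of u w]
    by (simp add: integrable_rep_hsp_mult inner_hsp_def mult.commute)
  ultimately show ?thesis unfolding L2_mean0_def by simp
qed

lemma tc_product_eq_tri: "k \<noteq> 0 \<Longrightarrow> tc (\<lambda>x. rep_hsp (dx u) x * rep_hsp (emb w) x) k = tri u w (eb1 k)"
  unfolding tc_def tri_def emb_eb1
  by (rule integral_cong_AE)
    (use measurable_trig_circ[measurable] in measurable, use rep_eb[of k] in eventually_elim, simp)

text \<open>Tested against a basis function, the product rule is \<open>tri_cyclic\<close> with that
  function as third argument.\<close>

lemma weak_deriv_product:
  "weak_deriv (\<lambda>x. rep_hsp (emb u) x * rep_hsp (emb w) x)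
     = abs_hsp (\<lambda>x. rep_hsp (dx u) x * rep_hsp (emb w) x + rep_hsp (dx w) x * rep_hsp (emb u) x)" (is "_ = abs_hsp ?g")
proof (rule weak_deriv_eqI[OF integrable_rep_hsp_mult])
  fix k :: int assume k: "k \<noteq> 0"
  have i: "integrable circ (\<lambda>x. rep_hsp (dx u) x * rep_hsp (emb w) x * trig k x)" for u w
    by (intro integrable_times_bounded_circ integrable_rep_hsp_mult measurable_trig_circ abs_trig_le)
  have "fc (abs_hsp ?g) k = tc (\<lambda>x. rep_hsp (dx u) x * rep_hsp (emb w) x) k + tc (\<lambda>x. rep_hsp (dx w) x * rep_hsp (emb u) x) k"
    by (simp add: fc_abs_hsp[OF product_rule_L2_mean0] tc_def distrib_right i)
  also have "\<dots> = tri u w (eb1 k) + tri w u (eb1 k)"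
    by (simp add: tc_product_eq_tri k)
  also have "\<dots> = - tri (eb1 k) u w"
    using tri_cyclic[of u w "eb1 k"] by simp
  also have "tri (eb1 k) u w = (\<integral>x. - of_int k * (rep_hsp (emb u) x * rep_hsp (emb w) x * trig (- k) x) \<partial>circ)"
    unfolding tri_def
    by (rule integral_cong_AE)
      (use measurable_trig_circ[measurable] in measurable, use rep_dx_eb1[OF k] in eventually_elim, simp)
  also have "- \<dots> = of_int k * tc (\<lambda>x. rep_hsp (emb u) x * rep_hsp (emb w) x) (- k)"
    by (simp add: tc_def)
  finally show "fc (abs_hsp ?g) k = of_int k * tc (\<lambda>x. rep_hsp (emb u) x * rep_hsp (emb w) x) (- k)" .
qed

lemma hilbert_product_L2_mean0: "(\<lambda>x. rep_hsp (dx (vel w)) x * rep_hsp (emb w) x) \<in> L2_mean0"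
  unfolding L2_mean0_def
  using inner_hilbert_self[of w] L2_mult_emb[of "dx (vel w)" w] by (simp add: inner_hsp_def)

text \<open>For a = -2 the nonlinearity 2 (u w)_x - u_x w equals u_x w + 2 u w_x.\<close>

lemma fc_nonlin:
  assumes "k \<noteq> 0"
  shows "fc (nonlin (- 2) (emb w)) k = tri (vel w) w (eb1 k) + 2 * tri w (vel w) (eb1 k)"
proof -
  have i: "integrable circ (\<lambda>x. rep_hsp (dx u) x * rep_hsp (emb w) x * trig k x)" for u w
    by (intro integrable_times_bounded_circ integrable_rep_hsp_mult measurable_trig_circ abs_trig_le)
  have "fc (nonlin (- 2) (emb w)) k = 2 * (tri (vel w) w (eb1 k) + tri w (vel w) (eb1 k)) - tri (vel w) w (eb1 k)"
    unfolding nonlin_def hilbert_emb velocity_emb weak_deriv_product fc_add fc_scaleR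
      fc_abs_hsp[OF product_rule_L2_mean0] fc_abs_hsp[OF hilbert_product_L2_mean0] distrib_right
    using tc_product_eq_tri[OF assms, of "vel w" w] tc_product_eq_tri[OF assms, of w "vel w"]
    by (simp add: tc_def i)
  then show ?thesis by simp
qed

lemma continuous_on_fc_nonlin:
  assumes "k \<noteq> 0"
  shows "continuous_on A (\<lambda>w. fc (nonlin (- 2) (emb w)) k)"
proof -
  interpret b: bounded_bilinear "\<lambda>u w. tri u w (eb1 k)" by (rule bounded_bilinear_tri12)
  interpret v: bounded_linear vel by (rule bounded_linear_vel)
  show ?thesis
    unfolding fc_nonlin[OF assms]
    by (intro continuous_intros b.continuous_on v.continuous_on)
qed

text \<open>The flux vanishes in the limit since \<open>\<integral> (u w\<^sup>2)\<^sub>x = 0\<close>.\<close>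

definition flux :: "nat \<Rightarrow> hdot1 \<Rightarrow> real" where
  "flux n w = (\<Sum>k\<in>modes n. fc (emb w) k * fc (nonlin (- 2) (emb w)) k)"

lemma flux_eq_tri:
  fixes n w defines "s \<equiv> (\<Sum>k\<in>modes n. fc (emb w) k *\<^sub>R eb1 k)"
  shows "flux n w = tri (vel w) w s + 2 * tri w (vel w) s"
proof -
  interpret b: bounded_bilinear "\<lambda>w v. tri u w v" for u by (rule bounded_bilinear_tri23)
  have s: "tri u v s = (\<Sum>k\<in>modes n. fc (emb w) k * tri u v (eb1 k))" for u v
    unfolding s_def by (simp add: b.sum_right b.scaleR_right)
  show ?thesis
    unfolding flux_def s sum_distrib_left sum.distrib[symmetric]
    by (rule sum.cong[OF refl]) (auto simp: fc_nonlin modes_def algebra_simps)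
qed

text \<open>For general a the cubic term integrates to (1 + a / 2) times the integral of u_x w^2; a
  = -2 is the value at which it cancels.\<close>

lemma tendsto_flux: "(\<lambda>n. flux n w) \<longlonglongrightarrow> 0"
proof -
  interpret b: bounded_bilinear "\<lambda>w v. tri u w v" for u by (rule bounded_bilinear_tri23)
  have "(\<lambda>n. flux n w) \<longlonglongrightarrow> tri (vel w) w w + 2 * tri w (vel w) w"
    unfolding flux_eq_tri by (intro tendsto_intros b.tendsto fourier_series_hdot1)
  moreover have "tri (vel w) w w + 2 * tri w (vel w) w = 0"
    using tri_cyclic[of w "vel w" w] tri_commute[of w w "vel w"] by simp
  ultimately show ?thesis by simp
qed

lemma norm_partial_sum_hdot1_le: "norm (\<Sum>k\<in>modes n. fc (emb w) k *\<^sub>R eb1 k) \<le> norm w" (is "norm ?s \<le> _")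
proof (rule power2_le_imp_le)
  have s: "emb ?s = (\<Sum>k\<in>modes n. fc (emb w) k *\<^sub>R eb k)"
    unfolding emb_sum emb_scaleR by (rule sum.cong) (auto simp: emb_eb1 modes_def)
  show "(norm ?s)\<^sup>2 \<le> (norm w)\<^sup>2"
  proof (rule norm_hdot1_sq_le)
    fix F :: "int set" assume F: "finite F" "F \<subseteq> - {0}"
    have "(fc (emb ?s) k)\<^sup>2 \<le> (fc (emb w) k)\<^sup>2" if "k \<in> F" for k
      using F that unfolding s by (subst fc_sum_eb) (auto simp: modes_subset)
    then have "(\<Sum>k\<in>F. \<bar>real_of_int k\<bar>\<^sup>2 * (fc (emb ?s) k)\<^sup>2) \<le> (\<Sum>k\<in>F. \<bar>real_of_int k\<bar>\<^sup>2 * (fc (emb w) k)\<^sup>2)"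
      by (intro sum_mono mult_left_mono) auto
    also have "\<dots> \<le> (norm w)\<^sup>2" by (rule sum_le_norm_hdot1_sq[OF F])
    finally show "(\<Sum>k\<in>F. \<bar>real_of_int k\<bar>\<^sup>2 * (fc (emb ?s) k)\<^sup>2) \<le> (norm w)\<^sup>2" .
  qed
qed simp

text \<open>Uniform in the number of modes, this is the dominating function when the time integral
  of the flux is taken to the limit.\<close>

lemma flux_bound:
  obtains C where "0 \<le> C" "\<And>n w. \<bar>flux n w\<bar> \<le> C * norm w ^ 3"
proof
  define K where "K = sqrt (2 * pi) * sup_const\<^sup>2"
  have K: "0 \<le> K" by (simp add: K_def)
  then show "0 \<le> 3 * K" by simp
  fix n w
  let ?s = "\<Sum>k\<in>modes n. fc (emb w) k *\<^sub>R eb1 k"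
  have *: "\<bar>tri u v ?s\<bar> \<le> K * norm w ^ 3" if "norm u \<le> norm w" "norm v \<le> norm w" for u v
  proof -
    have "\<bar>tri u v ?s\<bar> \<le> K * norm u * norm v * norm ?s"
      unfolding K_def by (rule tri_bound)
    also have "\<dots> \<le> K * norm w * norm w * norm w"
      by (intro mult_mono that norm_partial_sum_hdot1_le K) (auto intro!: mult_nonneg_nonneg K)
    finally show ?thesis by (simp add: power3_eq_cube mult.assoc)
  qed
  have "\<bar>tri (vel w) w ?s\<bar> \<le> K * norm w ^ 3" "\<bar>tri w (vel w) ?s\<bar> \<le> K * norm w ^ 3"
    by (intro * norm_vel_le order_refl)+
  then show "\<bar>flux n w\<bar> \<le> 3 * K * norm w ^ 3"
    unfolding flux_eq_tri by linarith
qed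

section \<open>Riemann sums on uniform grids\<close>

definition grid :: "real \<Rightarrow> nat \<Rightarrow> nat \<Rightarrow> real" where
  "grid T m j = T * real j / real m"

lemma grid_0 [simp]: "grid T m 0 = 0" and grid_last [simp]: "0 < m \<Longrightarrow> grid T m m = T"
  by (auto simp: grid_def)

lemma grid_Suc: "grid T m (Suc j) = grid T m j + T / real m"
  by (simp add: grid_def field_simps add_divide_distrib)

lemma grid_mono: "0 \<le> T \<Longrightarrow> i \<le> j \<Longrightarrow> grid T m i \<le> grid T m j"
  by (auto simp: grid_def intro!: divide_right_mono mult_left_mono)

lemma grid_nonneg: "0 \<le> T \<Longrightarrow> 0 \<le> grid T m j"
  by (simp add: grid_def)

lemma grid_le: "0 \<le> T \<Longrightarrow> j \<le> m \<Longrightarrow> grid T m j \<le> T"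
  by (cases "m = 0") (use grid_mono[of T j m m] in \<open>auto simp: grid_def\<close>)

lemma integral_grid_sum:
  fixes h :: "real \<Rightarrow> real"
  assumes T: "0 \<le> T" and h: "continuous_on {0..T} h" and m: "0 < m"
  shows "(\<Sum>j<m. integral {grid T m j..grid T m (Suc j)} h) = integral {0..T} h"
proof -
  have "(\<Sum>j<n. integral {grid T m j..grid T m (Suc j)} h) = integral {0..grid T m n} h" if "n \<le> m" for n
    using that
  proof (induction n)
    case (Suc n)
    have "h integrable_on {0..grid T m (Suc n)}"
      by (intro integrable_continuous_real continuous_on_subset[OF h])
        (use Suc grid_le[OF T, of "Suc n" m] in auto)
    then have "integral {0..grid T m n} h + integral {grid T m n..grid T m (Suc n)} h = integral {0..grid T m (Suc n)} h"
      by (intro Henstock_Kurzweil_Integration.integral_combine grid_nonneg grid_mono T) auto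
    with Suc show ?case by simp
  qed simp
  from this[of m] m show ?thesis by simp
qed

text \<open>Uniform continuity of \<open>F\<close> near the diagonal. Letting \<open>F\<close>
  depend on both endpoints of a cell covers left and right evaluation, and also factors that vanish
  on the diagonal.\<close>

lemma tendsto_grid_sum:
  fixes F :: "real \<Rightarrow> real \<Rightarrow> real" and g :: "real \<Rightarrow> real"
  assumes T: "0 \<le> T" and F: "continuous_on ({0..T} \<times> {0..T}) (\<lambda>(s, t). F s t)" and g: "continuous_on {0..T} g"
  shows "(\<lambda>m. \<Sum>j<m. F (grid T m j) (grid T m (Suc j)) * integral {grid T m j..grid T m (Suc j)} g)
    \<longlonglongrightarrow> integral {0..T} (\<lambda>s. F s s * g s)"
proof (rule LIMSEQ_I)
  fix e :: real assume e: "0 < e"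
  have "compact (g ` {0..T})" by (intro compact_continuous_image g) simp
  then have "bounded (g ` {0..T})" by (rule compact_imp_bounded)
  then obtain K where "0 < K" and "\<forall>x\<in>g ` {0..T}. norm x \<le> K"
    unfolding bounded_pos by blast
  then have K: "0 < K" "\<And>s. s \<in> {0..T} \<Longrightarrow> \<bar>g s\<bar> \<le> K" by auto
  \<comment> \<open>Chosen so that the total error \<open>e' * K * T\<close> is at most e / 2; the
    summand 1 covers \<open>T = 0\<close>.\<close>
  define e' where "e' = e / (2 * K * (T + 1))"
  have e': "0 < e'" using e K T by (simp add: e'_def)
  have "uniformly_continuous_on ({0..T} \<times> {0..T}) (\<lambda>(s, t). F s t)"
    by (intro compact_uniformly_continuous F compact_Times compact_Icc)
  then obtain d where d: "0 < d" "\<And>p q. p \<in> {0..T} \<times> {0..T} \<Longrightarrow> q \<in> {0..T} \<times> {0..T} \<Longrightarrow> dist q p < d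
      \<Longrightarrow> dist ((\<lambda>(s, t). F s t) q) ((\<lambda>(s, t). F s t) p) < e'"
    unfolding uniformly_continuous_on_def using e' by metis
  \<comment> \<open>For \<open>s\<close> in a cell, \<open>(s, s)\<close> and the pair of endpoints
    of the cell are at distance at most twice the mesh.\<close>
  obtain N where N: "2 * T / d < real N" using reals_Archimedean2 by blast
  have Fd: "continuous_on {0..T} (\<lambda>s. F s s)"
  proof -
    have "continuous_on {0..T} (\<lambda>s. (\<lambda>(s, t). F s t) (s, s))"
      by (rule continuous_on_compose2[OF F]) (auto intro!: continuous_intros)
    then show ?thesis by simp
  qed
  have cont: "continuous_on {0..T} (\<lambda>s. F s s * g s)" by (intro continuous_intros Fd g)
  show "\<exists>N. \<forall>m\<ge>N. norm ((\<Sum>j<m. F (grid T m j) (grid T m (Suc j)) * integral {grid T m j..grid T m (Suc j)} g)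
      - integral {0..T} (\<lambda>s. F s s * g s)) < e"
  proof (intro exI allI impI)
    fix m assume m: "Suc N \<le> m"
    then have m0: "0 < m" by simp
    have hm: "2 * (T / m) < d"
    proof -
      have "2 * T / d < real m" using N m by linarith
      then show ?thesis using d(1) m0 by (simp add: field_simps)
    qed
    have step: "\<bar>F (grid T m j) (grid T m (Suc j)) * integral {grid T m j..grid T m (Suc j)} g
        - integral {grid T m j..grid T m (Suc j)} (\<lambda>s. F s s * g s)\<bar> \<le> (e' * K) * (T / m)" if j: "j < m" for j
    proof -
      let ?a = "grid T m j" and ?b = "grid T m (Suc j)"
      have ab: "0 \<le> ?a" "?a \<le> ?b" "?b \<le> T" "?b - ?a = T / m"
        using j grid_nonneg[OF T] grid_mono[OF T, of j "Suc j"] grid_le[OF T, of "Suc j" m]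
        by (simp_all add: grid_Suc)
      have sub: "{?a..?b} \<subseteq> {0..T}" using ab by auto
      have ig: "g integrable_on {?a..?b}" "(\<lambda>s. F s s * g s) integrable_on {?a..?b}"
        "(\<lambda>s. F ?a ?b * g s) integrable_on {?a..?b}"
        by (intro integrable_continuous_real continuous_on_mult_left continuous_on_subset[OF g] continuous_on_subset[OF cont] sub)+
      have "F ?a ?b * integral {?a..?b} g - integral {?a..?b} (\<lambda>s. F s s * g s)
          = integral {?a..?b} (\<lambda>s. F ?a ?b * g s - F s s * g s)"
        using ig by (subst integral_diff) auto
      also have "norm \<dots> \<le> integral {?a..?b} (\<lambda>s. e' * K)"
      proof (rule integral_norm_bound_integral)
        show "(\<lambda>s. F ?a ?b * g s - F s s * g s) integrable_on {?a..?b}"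
          using ig by (intro integrable_diff)
        fix s assume s: "s \<in> {?a..?b}"
        have "dist (?a, ?b) (s, s) \<le> \<bar>?a - s\<bar> + \<bar>?b - s\<bar>"
          unfolding dist_prod_def dist_real_def by (simp add: sqrt_sum_squares_le_sum_abs)
        also have "\<dots> \<le> T / m + T / m" using s ab by auto
        finally have "dist (F ?a ?b) (F s s) < e'"
          using d(2)[of "(s, s)" "(?a, ?b)"] s ab hm by auto
        then have "\<bar>F ?a ?b - F s s\<bar> * \<bar>g s\<bar> \<le> e' * K"
          using K s sub by (intro mult_mono) (auto simp: dist_real_def)
        then show "norm (F ?a ?b * g s - F s s * g s) \<le> e' * K"
          by (simp add: abs_mult flip: left_diff_distrib)
      qed auto
      also have "\<dots> = (e' * K) * (T / m)" using ab by simp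
      finally show ?thesis by simp
    qed
    have "\<bar>(\<Sum>j<m. F (grid T m j) (grid T m (Suc j)) * integral {grid T m j..grid T m (Suc j)} g)
      - integral {0..T} (\<lambda>s. F s s * g s)\<bar>
      = \<bar>\<Sum>j<m. F (grid T m j) (grid T m (Suc j)) * integral {grid T m j..grid T m (Suc j)} g
        - integral {grid T m j..grid T m (Suc j)} (\<lambda>s. F s s * g s)\<bar>"
      by (simp add: sum_subtractf integral_grid_sum[OF T cont m0])
    also have "\<dots> \<le> (\<Sum>j<m. (e' * K) * (T / m))"
      by (rule order_trans[OF sum_abs]) (intro sum_mono step, simp)
    also have "\<dots> = e' * K * T" using m0 by simp
    also have "e' * K = e / 2 / (T + 1)" using K by (simp add: e'_def)
    also have "e / 2 / (T + 1) * T = e / 2 * (T / (T + 1))" by simp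
    also have "\<dots> \<le> e / 2 * 1" using T e by (intro mult_left_mono) auto
    also have "\<dots> < e" using e by simp
    finally show "norm ((\<Sum>j<m. F (grid T m j) (grid T m (Suc j)) * integral {grid T m j..grid T m (Suc j)} g)
      - integral {0..T} (\<lambda>s. F s s * g s)) < e" by simp
  qed
qed

section \<open>Wiener integrals\<close>

lemma brownian_motionD:
  assumes "brownian_motion M B"
  shows "0 \<le> t \<Longrightarrow> B t \<in> borel_measurable M" "AE x in M. B 0 x = 0"
    "0 \<le> s \<Longrightarrow> s < t \<Longrightarrow>
      distributed M lborel (\<lambda>x. B t x - B s x) (\<lambda>z. ennreal (normal_density 0 (sqrt (t - s)) z))"
    "AE x in M. continuous_on {0..} (\<lambda>t. B t x)"
  using assms unfolding brownian_motion_def by blast+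

lemma brownian_increment_sq:
  assumes B: "brownian_motion M B" and "0 \<le> s" "s \<le> t"
  shows "integrable M (\<lambda>x. (B t x - B s x)\<^sup>2)" "(\<integral>x. (B t x - B s x)\<^sup>2 \<partial>M) = t - s"
proof -
  have "integrable M (\<lambda>x. (B t x - B s x)\<^sup>2) \<and> (\<integral>x. (B t x - B s x)\<^sup>2 \<partial>M) = t - s"
  proof (cases "s = t")
    case False
    then have st: "s < t" using assms by simp
    note D = brownian_motionD(3)[OF B \<open>0 \<le> s\<close> st]
    have \<sigma>: "0 < sqrt (t - s)" using st by simp
    have m: "has_bochner_integral lborel (\<lambda>z. normal_density 0 (sqrt (t - s)) z * z\<^sup>2) (t - s)"
      using normal_moment_even[OF \<sigma>, of 0 1] st by (simp add: diff_divide_distrib)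
    have "integrable M (\<lambda>x. (B t x - B s x)\<^sup>2)"
      using distributed_integrable[OF D, of "\<lambda>z. z\<^sup>2"] m by (auto dest: has_bochner_integral_integrable simp: has_bochner_integral_iff)
    moreover have "(\<integral>x. (B t x - B s x)\<^sup>2 \<partial>M) = t - s"
      using distributed_integral[OF D, of "\<lambda>z. z\<^sup>2"] m by (auto simp: has_bochner_integral_iff)
    ultimately show ?thesis by simp
  qed simp
  then show "integrable M (\<lambda>x. (B t x - B s x)\<^sup>2)" "(\<integral>x. (B t x - B s x)\<^sup>2 \<partial>M) = t - s" by auto
qed

lemma brownian_sq:
  assumes B: "brownian_motion M B" and "0 \<le> t"
  shows "integrable M (\<lambda>x. (B t x)\<^sup>2)" "(\<integral>x. (B t x)\<^sup>2 \<partial>M) = t"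
proof -
  have [measurable]: "B t \<in> borel_measurable M" "B 0 \<in> borel_measurable M"
    using brownian_motionD(1)[OF B] assms by auto
  have ae: "AE x in M. (B t x - B 0 x)\<^sup>2 = (B t x)\<^sup>2"
    using brownian_motionD(2)[OF B] by eventually_elim simp
  show "integrable M (\<lambda>x. (B t x)\<^sup>2)"
    using brownian_increment_sq(1)[OF B, of 0 t] assms integrable_cong_AE[OF _ _ ae] by simp
  show "(\<integral>x. (B t x)\<^sup>2 \<partial>M) = t"
    using brownian_increment_sq(2)[OF B, of 0 t] assms integral_cong_AE[OF _ _ ae] by simp
qed

text \<open>Polarization from the second moments of \<open>B s\<close>, \<open>B t\<close> and their
  difference.\<close>

lemma brownian_cov:
  assumes B: "brownian_motion M B" and "0 \<le> s" "0 \<le> t"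
  shows "integrable M (\<lambda>x. B s x * B t x)" "(\<integral>x. B s x * B t x \<partial>M) = min s t"
proof -
  have "integrable M (\<lambda>x. B s x * B t x) \<and> (\<integral>x. B s x * B t x \<partial>M) = s" if "0 \<le> s" "s \<le> t" for s t
  proof -
    have eq: "B s x * B t x = ((B s x)\<^sup>2 + (B t x)\<^sup>2 - (B t x - B s x)\<^sup>2) / 2" for x
      by (simp add: power2_diff)
    have t: "0 \<le> t" using that by simp
    show ?thesis
      unfolding eq
      using brownian_sq[OF B \<open>0 \<le> s\<close>] brownian_sq[OF B t] brownian_increment_sq[OF B that] by simp
  qed
  from this[of s t] this[of t s] assms show "integrable M (\<lambda>x. B s x * B t x)" "(\<integral>x. B s x * B t x \<partial>M) = min s t"
    by (cases "s \<le> t"; simp add: mult.commute min_def)+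
qed

text \<open>The length of the intersection is written through minima so that it matches term by term
  the covariance of two Brownian increments.\<close>

lemma interval_overlap:
  fixes a b c d :: real
  assumes "a \<le> b" "c \<le> d"
  shows "has_bochner_integral lborel (\<lambda>s. indicator {a<..b} s * indicator {c<..d} s :: real)
    (min b d - min b c - min a d + min a c)"
proof -
  have "has_bochner_integral lborel (indicator {max a c<..min b d} :: real \<Rightarrow> real) (max 0 (min b d - max a c))"
  proof (cases "max a c \<le> min b d")
    case True
    then show ?thesis using has_bochner_integral_real_indicator[of "{max a c<..min b d}" lborel] by (simp add: max_def)
  next
    case False
    then have "indicator {max a c<..min b d} = (\<lambda>_. 0 :: real)" by (auto simp: fun_eq_iff)
    moreover have "max 0 (min b d - max a c) = 0" using False by linarith
    ultimately show ?thesis by (simp only: has_bochner_integral_zero)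
  qed
  moreover have "indicator {a<..b} s * indicator {c<..d} s = (indicator {max a c<..min b d} s :: real)" for s
    by (auto simp: indicator_def)
  moreover have "max 0 (min b d - max a c) = min b d - min b c - min a d + min a c"
    using assms by (auto simp: min_def max_def)
  ultimately show ?thesis by simp
qed

text \<open>The intervals may overlap, so that step functions on different grids can be compared.\<close>

lemma wiener_isometry:
  fixes a b c :: "'i \<Rightarrow> real"
  assumes B: "brownian_motion M B" and ab: "\<And>i. i \<in> I \<Longrightarrow> 0 \<le> a i \<and> a i \<le> b i"
  shows "integrable M (\<lambda>x. (\<Sum>i\<in>I. c i * (B (b i) x - B (a i) x))\<^sup>2)"
    "integrable lborel (\<lambda>s. (\<Sum>i\<in>I. c i * indicator {a i<..b i} s)\<^sup>2)"
    "(\<integral>x. (\<Sum>i\<in>I. c i * (B (b i) x - B (a i) x))\<^sup>2 \<partial>M)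
      = (\<integral>s. (\<Sum>i\<in>I. c i * indicator {a i<..b i} s)\<^sup>2 \<partial>lborel)"
proof -
  define K where "K i j = min (b i) (b j) - min (b i) (a j) - min (a i) (b j) + min (a i) (a j)" for i j
  have 1: "has_bochner_integral M (\<lambda>x. (B (b i) x - B (a i) x) * (B (b j) x - B (a j) x)) (K i j)"
    if "i \<in> I" "j \<in> I" for i j
  proof -
    have nn: "0 \<le> a i" "0 \<le> b i" "0 \<le> a j" "0 \<le> b j" using ab[OF that(1)] ab[OF that(2)] by auto
    have c: "has_bochner_integral M (\<lambda>x. B s x * B t x) (min s t)" if "0 \<le> s" "0 \<le> t" for s t
      using brownian_cov[OF B that] by (simp add: has_bochner_integral_iff)
    have eq: "(B (b i) x - B (a i) x) * (B (b j) x - B (a j) x)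
        = B (b i) x * B (b j) x - B (b i) x * B (a j) x - B (a i) x * B (b j) x + B (a i) x * B (a j) x" for x
      by (simp add: algebra_simps)
    show ?thesis
      unfolding eq K_def
      by (intro has_bochner_integral_add has_bochner_integral_diff c nn)
  qed
  have 2: "has_bochner_integral lborel (\<lambda>s. indicator {a i<..b i} s * indicator {a j<..b j} s :: real) (K i j)"
    if "i \<in> I" "j \<in> I" for i j
    unfolding K_def using interval_overlap[of "a i" "b i" "a j" "b j"] ab[OF that(1)] ab[OF that(2)] by simp
  have e1: "(\<Sum>i\<in>I. c i * (B (b i) x - B (a i) x))\<^sup>2
      = (\<Sum>i\<in>I. \<Sum>j\<in>I. c i * c j * ((B (b i) x - B (a i) x) * (B (b j) x - B (a j) x)))" for x
    by (simp add: power2_eq_square sum_product algebra_simps)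
  have e2: "(\<Sum>i\<in>I. c i * indicator {a i<..b i} s)\<^sup>2
      = (\<Sum>i\<in>I. \<Sum>j\<in>I. c i * c j * (indicator {a i<..b i} s * indicator {a j<..b j} s :: real))" for s
    by (simp add: power2_eq_square sum_product algebra_simps)
  have h1: "has_bochner_integral M (\<lambda>x. (\<Sum>i\<in>I. c i * (B (b i) x - B (a i) x))\<^sup>2) (\<Sum>i\<in>I. \<Sum>j\<in>I. c i * c j * K i j)"
    unfolding e1 by (intro has_bochner_integral_sum has_bochner_integral_mult_right 1)
  have h2: "has_bochner_integral lborel (\<lambda>s. (\<Sum>i\<in>I. c i * indicator {a i<..b i} s)\<^sup>2) (\<Sum>i\<in>I. \<Sum>j\<in>I. c i * c j * K i j)"
    unfolding e2 by (intro has_bochner_integral_sum has_bochner_integral_mult_right 2)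
  show "integrable M (\<lambda>x. (\<Sum>i\<in>I. c i * (B (b i) x - B (a i) x))\<^sup>2)"
    "integrable lborel (\<lambda>s. (\<Sum>i\<in>I. c i * indicator {a i<..b i} s)\<^sup>2)"
    "(\<integral>x. (\<Sum>i\<in>I. c i * (B (b i) x - B (a i) x))\<^sup>2 \<partial>M)
      = (\<integral>s. (\<Sum>i\<in>I. c i * indicator {a i<..b i} s)\<^sup>2 \<partial>lborel)"
    using h1 h2 by (auto simp: has_bochner_integral_iff)
qed

text \<open>A difference of step functions on two grids is one step function on a family of
  overlapping intervals, indexed by the disjoint sum, with the second coefficients negated.\<close>

lemma wiener_isometry_steps:
  fixes c d :: "nat \<Rightarrow> real"
  assumes B: "brownian_motion M B"
    and \<tau>: "mono \<tau>" "range \<tau> \<subseteq> {0..t}" and \<rho>: "mono \<rho>" "range \<rho> \<subseteq> {0..t}"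
  shows "(\<integral>\<^sup>+x. ennreal ((step_integral B n \<tau> c x - step_integral B m \<rho> d x)\<^sup>2) \<partial>M)
    = (\<integral>\<^sup>+s\<in>{0..t}. ennreal ((step_fun n \<tau> c s - step_fun m \<rho> d s)\<^sup>2) \<partial>lborel)"
proof -
  let ?I = "{..<n} <+> {..<m}"
  let ?a = "case_sum \<tau> \<rho>" and ?b = "case_sum (\<lambda>i. \<tau> (Suc i)) (\<lambda>i. \<rho> (Suc i))" and ?c = "case_sum c (\<lambda>i. - d i)"
  have ab: "0 \<le> ?a i \<and> ?a i \<le> ?b i" for i
    using \<tau> \<rho> by (cases i) (auto simp: mono_def image_subset_iff)
  have 1: "step_integral B n \<tau> c x - step_integral B m \<rho> d x = (\<Sum>i\<in>?I. ?c i * (B (?b i) x - B (?a i) x))" for x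
    by (simp add: step_integral_def sum.Plus sum_negf mult.commute)
  have 2: "step_fun n \<tau> c s - step_fun m \<rho> d s = (\<Sum>i\<in>?I. ?c i * indicator {?a i<..?b i} s)" for s
    unfolding step_fun_def sum.Plus[OF finite_lessThan finite_lessThan]
    by (simp only: o_def sum.case mult_minus_left sum_negf real_scaleR_def mult.commute diff_conv_add_uminus)
  have supp: "step_fun n \<tau> c s - step_fun m \<rho> d s = 0" if "s \<notin> {0..t}" for s
  proof -
    have r: "0 \<le> \<tau> i" "\<tau> i \<le> t" "0 \<le> \<rho> i" "\<rho> i \<le> t" for i
      using \<tau> \<rho> by (auto simp: image_subset_iff)
    have "s \<notin> {\<tau> i<..\<tau> (Suc i)}" "s \<notin> {\<rho> i<..\<rho> (Suc i)}" for i
      using that r(1)[of i] r(2)[of "Suc i"] r(3)[of i] r(4)[of "Suc i"] by auto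
    then show ?thesis by (simp add: step_fun_def)
  qed
  have "(\<integral>\<^sup>+x. ennreal ((step_integral B n \<tau> c x - step_integral B m \<rho> d x)\<^sup>2) \<partial>M)
      = ennreal (\<integral>x. (\<Sum>i\<in>?I. ?c i * (B (?b i) x - B (?a i) x))\<^sup>2 \<partial>M)"
    unfolding 1 by (rule nn_integral_eq_integral) (use wiener_isometry(1)[OF B ab] in auto)
  also have "\<dots> = ennreal (\<integral>s. (\<Sum>i\<in>?I. ?c i * indicator {?a i<..?b i} s)\<^sup>2 \<partial>lborel)"
    by (rule arg_cong[OF wiener_isometry(3)[OF B ab]])
  also have "\<dots> = (\<integral>\<^sup>+s. ennreal ((step_fun n \<tau> c s - step_fun m \<rho> d s)\<^sup>2) \<partial>lborel)"
    unfolding 2 by (rule nn_integral_eq_integral[symmetric, OF wiener_isometry(2)[OF B ab]]) (intro AE_I2 zero_le_power2)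
  also have "\<dots> = (\<integral>\<^sup>+s\<in>{0..t}. ennreal ((step_fun n \<tau> c s - step_fun m \<rho> d s)\<^sup>2) \<partial>lborel)"
    by (rule nn_integral_cong) (use supp in \<open>auto simp: indicator_def\<close>)
  finally show ?thesis .
qed

lemma sq_add_le: "(a + b)\<^sup>2 \<le> 2 * a\<^sup>2 + 2 * (b::real)\<^sup>2"
  using sum_squares_bound[of a b] by (simp add: power2_sum)

lemma nn_integral_sq_triangle:
  fixes f g h :: "'a \<Rightarrow> real"
  assumes [measurable]: "f \<in> borel_measurable M" "g \<in> borel_measurable M" "h \<in> borel_measurable M"
  shows "(\<integral>\<^sup>+x. ennreal ((f x - h x)\<^sup>2) \<partial>M)
    \<le> 2 * (\<integral>\<^sup>+x. ennreal ((f x - g x)\<^sup>2) \<partial>M) + 2 * (\<integral>\<^sup>+x. ennreal ((g x - h x)\<^sup>2) \<partial>M)"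
proof -
  have "(f x - h x)\<^sup>2 \<le> 2 * (f x - g x)\<^sup>2 + 2 * (g x - h x)\<^sup>2" for x
    using sq_add_le[of "f x - g x" "g x - h x"] by simp
  then have "ennreal ((f x - h x)\<^sup>2) \<le> ennreal (2 * (f x - g x)\<^sup>2 + 2 * (g x - h x)\<^sup>2)" for x
    by (rule ennreal_leI)
  then have "ennreal ((f x - h x)\<^sup>2) \<le> 2 * ennreal ((f x - g x)\<^sup>2) + 2 * ennreal ((g x - h x)\<^sup>2)" for x
    by (simp add: ennreal_mult)
  then have "(\<integral>\<^sup>+x. ennreal ((f x - h x)\<^sup>2) \<partial>M)
      \<le> (\<integral>\<^sup>+x. 2 * ennreal ((f x - g x)\<^sup>2) + 2 * ennreal ((g x - h x)\<^sup>2) \<partial>M)"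
    by (intro nn_integral_mono)
  also have "\<dots> = 2 * (\<integral>\<^sup>+x. ennreal ((f x - g x)\<^sup>2) \<partial>M) + 2 * (\<integral>\<^sup>+x. ennreal ((g x - h x)\<^sup>2) \<partial>M)"
    by (subst nn_integral_add) (auto simp: nn_integral_cmult)
  finally show ?thesis .
qed

lemma summation_by_parts:
  fixes f B :: "nat \<Rightarrow> real"
  shows "(\<Sum>i<m. f i * (B (Suc i) - B i)) = f m * B m - f 0 * B 0 - (\<Sum>i<m. B (Suc i) * (f (Suc i) - f i))"
  by (induction m) (simp_all add: algebra_simps)

lemma step_fun_grid:
  assumes t: "0 < t" and m: "0 < m" and s: "0 < s" "s \<le> t"
  obtains i where "i < m" "grid t m i < s" "s \<le> grid t m (Suc i)" "step_fun m (grid t m) c s = (c i :: real)"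
proof -
  define n where "n = (LEAST n. s \<le> grid t m n)"
  have "s \<le> grid t m m" using s m by simp
  then have n: "s \<le> grid t m n" "n \<le> m" and least: "\<And>j. j < n \<Longrightarrow> grid t m j < s"
    unfolding n_def by (auto intro: LeastI Least_le dest: not_less_Least simp: not_le)
  have "n \<noteq> 0" using n(1) s by (auto simp: not_le intro: ccontr)
  then obtain i where i: "n = Suc i" by (cases n) auto
  have gi: "grid t m i < s" using least[of i] i by simp
  have 0: "indicator {grid t m j<..grid t m (Suc j)} s *\<^sub>R c j = 0" if "j \<noteq> i" for j
  proof (cases "j < i")
    case True
    then show ?thesis using least[of "Suc j"] i by (simp add: indicator_def)
  next
    case False
    then have "n \<le> j" using that i by simp
    then have "s \<le> grid t m j" using n(1) grid_mono[of t n j m] t by linarith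
    then show ?thesis by (simp add: indicator_def)
  qed
  have im: "i < m" using n(2) i by simp
  have "step_fun m (grid t m) c s = (\<Sum>j<m. if j = i then c i else 0)"
    unfolding step_fun_def
    by (rule sum.cong[OF refl]) (use 0 n(1) gi i in \<open>auto simp: indicator_def\<close>)
  then show thesis using that[OF im gi] n(1) i im by simp
qed

text \<open>The definition supplies only some approximating step functions. Left-point sums on
  uniform grids converge on almost every path to the right-hand side by summation by parts, and the
  isometry makes them close in L2 to the given approximations, so both limits agree.\<close>

lemma wiener_integral_by_parts:
  fixes f :: "real \<Rightarrow> real"
  assumes B: "brownian_motion M B" and t: "0 \<le> t"
    and f: "\<And>s. (f has_real_derivative f' s) (at s)" and f': "continuous_on UNIV f'"
    and X: "has_wiener_integral M B t f X"
  shows "AE x in M. X x = f t * B t x - integral {0..t} (\<lambda>s. B s x * f' s)"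
proof -
  have [measurable]: "f \<in> borel_measurable borel"
    using f by (intro borel_measurable_continuous_onI continuous_at_imp_continuous_on) (auto intro: DERIV_isCont)
  have Xm [measurable]: "X \<in> borel_measurable M" using X by (simp add: has_wiener_integral_def)
  obtain n \<tau> c where \<tau>: "\<And>j. mono (\<tau> j)" "\<And>j. range (\<tau> j) \<subseteq> {0..t}"
    and lim1: "(\<lambda>j::nat. \<integral>\<^sup>+s\<in>{0..t}. ennreal ((f s - step_fun (n j) (\<tau> j) (c j) s)\<^sup>2) \<partial>lborel) \<longlonglongrightarrow> 0"
    and lim2: "(\<lambda>j. \<integral>\<^sup>+x. ennreal ((X x - step_integral B (n j) (\<tau> j) (c j) x)\<^sup>2) \<partial>M) \<longlonglongrightarrow> 0"
    using X unfolding has_wiener_integral_def real_norm_def power2_abs by blast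
  define S where "S j = step_integral B (n j) (\<tau> j) (c j)" for j
  \<comment> \<open>Capping the index at \<open>m\<close> keeps the grid inside
    \<open>{0..t}\<close> at all indices, as the isometry demands; the sum over \<open>i < m\<close>
    does not see it.\<close>
  define Y where "Y m = step_integral B m (\<lambda>i. grid t m (min i m)) (\<lambda>i. f (grid t m i))" for m
  define g where "g m = step_fun m (\<lambda>i. grid t m (min i m)) (\<lambda>i. f (grid t m i))" for m
  have Bm: "B s \<in> borel_measurable M" if "0 \<le> s" for s by (rule brownian_motionD(1)[OF B that])
  have \<tau>0: "0 \<le> \<tau> j i" for i j using \<tau>(2)[of j] by (auto simp: image_subset_iff)
  have Sm [measurable]: "S j \<in> borel_measurable M" for j
    unfolding S_def step_integral_def by (intro borel_measurable_sum borel_measurable_scaleR borel_measurable_diff Bm \<tau>0) auto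
  have Ym [measurable]: "Y j \<in> borel_measurable M" for j
    unfolding Y_def step_integral_def
    by (intro borel_measurable_sum borel_measurable_scaleR borel_measurable_diff Bm grid_nonneg t) auto
  have Yeq: "Y m x = (\<Sum>i<m. f (grid t m i) * (B (grid t m (Suc i)) x - B (grid t m i) x))" for m x
    unfolding Y_def step_integral_def by (rule sum.cong) (auto simp: min_def)
  have geq: "g m = step_fun m (grid t m) (\<lambda>i. f (grid t m i))" for m
    unfolding g_def step_fun_def by (rule ext, rule sum.cong) (auto simp: min_def)
  have gm: "mono (\<lambda>i. grid t m (min i m))" "range (\<lambda>i. grid t m (min i m)) \<subseteq> {0..t}" for m
    by (auto intro!: monoI grid_mono grid_nonneg grid_le t)
  define Z where "Z x = f t * B t x - integral {0..t} (\<lambda>s. B s x * f' s)" for x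
  have YZ: "AE x in M. (\<lambda>m. Y m x) \<longlonglongrightarrow> Z x"
    using brownian_motionD(2,4)[OF B]
  proof eventually_elim
    case (elim x)
    have cB: "continuous_on {0..t} (\<lambda>s. B s x)" by (rule continuous_on_subset[OF elim(2)]) auto
    have FTC: "f (grid t m (Suc i)) - f (grid t m i) = integral {grid t m i..grid t m (Suc i)} f'" for m i
    proof (rule integral_unique[symmetric], rule fundamental_theorem_of_calculus)
      show "grid t m i \<le> grid t m (Suc i)" by (rule grid_mono[OF t]) simp
      show "(f has_vector_derivative f' s) (at s within {grid t m i..grid t m (Suc i)})" for s
        using f[of s] by (auto simp: has_real_derivative_iff_has_vector_derivative intro: has_vector_derivative_at_within)
    qed
    have "(\<lambda>m. \<Sum>i<m. B (grid t m (Suc i)) x * integral {grid t m i..grid t m (Suc i)} f') \<longlonglongrightarrow> integral {0..t} (\<lambda>s. B s x * f' s)"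
    proof (rule tendsto_grid_sum[OF t])
      show "continuous_on ({0..t} \<times> {0..t}) (\<lambda>(s, u). B u x)"
        unfolding case_prod_beta by (rule continuous_on_compose2[OF cB]) (auto intro!: continuous_intros)
      show "continuous_on {0..t} f'" by (rule continuous_on_subset[OF f']) auto
    qed
    then have "(\<lambda>m. f t * B t x - (\<Sum>i<m. B (grid t m (Suc i)) x * integral {grid t m i..grid t m (Suc i)} f')) \<longlonglongrightarrow> Z x"
      unfolding Z_def by (intro tendsto_intros)
    moreover have "\<forall>\<^sub>F m in sequentially. f t * B t x - (\<Sum>i<m. B (grid t m (Suc i)) x * integral {grid t m i..grid t m (Suc i)} f') = Y m x"
      using eventually_gt_at_top[of 0]
    proof eventually_elim
      fix m :: nat assume "0 < m"
      then show "f t * B t x - (\<Sum>i<m. B (grid t m (Suc i)) x * integral {grid t m i..grid t m (Suc i)} f') = Y m x"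
        unfolding Yeq summation_by_parts[of "\<lambda>i. f (grid t m i)" "\<lambda>i. B (grid t m i) x"] FTC using elim(1) by simp
    qed
    ultimately show ?case by (rule Lim_transform_eventually)
  qed
  have fg: "(\<lambda>m. \<integral>\<^sup>+s\<in>{0..t}. ennreal ((f s - g m s)\<^sup>2) \<partial>lborel) \<longlonglongrightarrow> 0"
  proof -
    have "bounded (f' ` {0..t})"
      by (intro compact_imp_bounded compact_continuous_image continuous_on_subset[OF f']) auto
    then obtain L where "0 < L" "\<forall>y\<in>f' ` {0..t}. norm y \<le> L" unfolding bounded_pos by blast
    then have L: "0 < L" "\<And>s. s \<in> {0..t} \<Longrightarrow> \<bar>f' s\<bar> \<le> L" by auto
    have le: "(\<integral>\<^sup>+s\<in>{0..t}. ennreal ((f s - g m s)\<^sup>2) \<partial>lborel) \<le> ennreal ((L * (t / m))\<^sup>2 * t)" if m: "0 < m" for m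
    proof -
      have d: "\<bar>f s - g m s\<bar> \<le> L * (t / m)" if s: "0 < s" "s \<le> t" for s
      proof -
        have "0 < t" using s by simp
        then obtain i where i: "i < m" "grid t m i < s" "s \<le> grid t m (Suc i)" "g m s = f (grid t m i)"
          unfolding geq using step_fun_grid[of t m s] m s by blast
        have i0: "0 \<le> grid t m i" by (rule grid_nonneg[OF t])
        obtain z where z: "grid t m i < z" "z < s" "f s - f (grid t m i) = (s - grid t m i) * f' z"
          using MVT2[OF i(2), of f f'] f by blast
        have "\<bar>f s - g m s\<bar> = \<bar>f' z\<bar> * (s - grid t m i)" using z i by (simp add: abs_mult mult.commute)
        also have "\<dots> \<le> L * (t / m)"
          using z i s i0 L by (intro mult_mono) (auto simp: grid_Suc)
        finally show ?thesis .
      qed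
      have *: "(f s - g m s)\<^sup>2 \<le> (L * (t / m))\<^sup>2" if "0 < s" "s \<le> t" for s
        using power_mono[OF d[OF that] abs_ge_zero, of 2] by (simp only: power2_abs)
      have "(\<integral>\<^sup>+s\<in>{0..t}. ennreal ((f s - g m s)\<^sup>2) \<partial>lborel) \<le> (\<integral>\<^sup>+s\<in>{0..t}. ennreal ((L * (t / m))\<^sup>2) \<partial>lborel)"
      proof (rule nn_integral_mono_AE, use AE_lborel_singleton[of 0] in eventually_elim)
        case (elim s)
        then show ?case using *[of s] by (auto simp: indicator_def intro!: ennreal_leI)
      qed
      also have "\<dots> = ennreal ((L * (t / m))\<^sup>2 * t)"
        using t by (simp add: nn_integral_cmult ennreal_mult)
      finally show ?thesis .
    qed
    have "(\<lambda>m. ennreal ((L * (t / real m))\<^sup>2 * t)) \<longlonglongrightarrow> ennreal ((L * 0)\<^sup>2 * t)"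
      by (intro tendsto_intros tendsto_divide_0[OF tendsto_const] filterlim_at_top_imp_at_infinity filterlim_real_sequentially)
    then have l0: "(\<lambda>m. ennreal ((L * (t / real m))\<^sup>2 * t)) \<longlonglongrightarrow> 0" by simp
    show ?thesis
      by (rule tendsto_sandwich[OF _ _ tendsto_const l0]) (use le in \<open>auto intro!: eventually_sequentiallyI[of 1]\<close>)
  qed
  have stm [measurable]: "step_fun n' \<tau>' (c' :: nat \<Rightarrow> real) \<in> borel_measurable borel" for n' \<tau>' c'
    unfolding step_fun_def by measurable
  have gmm [measurable]: "g m \<in> borel_measurable borel" for m unfolding g_def by measurable
  define eps where "eps j = (\<integral>\<^sup>+s\<in>{0..t}. ennreal ((f s - step_fun (n j) (\<tau> j) (c j) s)\<^sup>2) \<partial>lborel)" for j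
  \<comment> \<open>Fatou's lemma in \<open>m\<close> compares the pathwise limit with the given
    approximation \<open>S j\<close>; the error is then controlled by the distance of the
    integrands.\<close>
  have SZ: "(\<integral>\<^sup>+x. ennreal ((S j x - lim (\<lambda>m. Y m x))\<^sup>2) \<partial>M) \<le> 2 * eps j" for j
  proof -
    have SY: "(\<integral>\<^sup>+x. ennreal ((S j x - Y m x)\<^sup>2) \<partial>M) \<le> 2 * eps j + 2 * (\<integral>\<^sup>+s\<in>{0..t}. ennreal ((f s - g m s)\<^sup>2) \<partial>lborel)" for m
    proof -
      let ?R = "restrict_space lborel {0..t}"
      have "(\<integral>\<^sup>+x. ennreal ((S j x - Y m x)\<^sup>2) \<partial>M)
          = (\<integral>\<^sup>+s\<in>{0..t}. ennreal ((step_fun (n j) (\<tau> j) (c j) s - g m s)\<^sup>2) \<partial>lborel)"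
        unfolding S_def Y_def g_def by (rule wiener_isometry_steps[OF B \<tau> gm])
      also have "\<dots> = (\<integral>\<^sup>+s. ennreal ((step_fun (n j) (\<tau> j) (c j) s - g m s)\<^sup>2) \<partial>?R)"
        by (simp add: nn_integral_restrict_space)
      also have "\<dots> \<le> 2 * (\<integral>\<^sup>+s. ennreal ((step_fun (n j) (\<tau> j) (c j) s - f s)\<^sup>2) \<partial>?R)
          + 2 * (\<integral>\<^sup>+s. ennreal ((f s - g m s)\<^sup>2) \<partial>?R)"
        by (rule nn_integral_sq_triangle) (auto intro!: measurable_restrict_space1)
      also have "\<dots> = 2 * eps j + 2 * (\<integral>\<^sup>+s\<in>{0..t}. ennreal ((f s - g m s)\<^sup>2) \<partial>lborel)"
        unfolding eps_def by (simp add: nn_integral_restrict_space power2_commute)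
      finally show ?thesis .
    qed
    have "(\<integral>\<^sup>+x. ennreal ((S j x - lim (\<lambda>m. Y m x))\<^sup>2) \<partial>M) = (\<integral>\<^sup>+x. liminf (\<lambda>m. ennreal ((S j x - Y m x)\<^sup>2)) \<partial>M)"
    proof (rule nn_integral_cong_AE, use YZ in eventually_elim)
      case (elim x)
      have "(\<lambda>m. ennreal ((S j x - Y m x)\<^sup>2)) \<longlonglongrightarrow> ennreal ((S j x - lim (\<lambda>m. Y m x))\<^sup>2)"
        using elim by (intro tendsto_intros) (simp add: limI)
      then show ?case by (intro lim_imp_Liminf[symmetric]) simp_all
    qed
    also have "\<dots> \<le> liminf (\<lambda>m. \<integral>\<^sup>+x. ennreal ((S j x - Y m x)\<^sup>2) \<partial>M)"
      by (rule nn_integral_liminf) measurable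
    also have "\<dots> \<le> liminf (\<lambda>m. 2 * eps j + 2 * (\<integral>\<^sup>+s\<in>{0..t}. ennreal ((f s - g m s)\<^sup>2) \<partial>lborel))"
      by (rule Liminf_mono) (use SY in auto)
    also have "\<dots> = 2 * eps j + 2 * 0"
      by (intro lim_imp_Liminf tendsto_add tendsto_const ennreal_tendsto_cmult fg) auto
    finally show ?thesis by simp
  qed
  define Y' where "Y' x = lim (\<lambda>m. Y m x)" for x
  have [measurable]: "Y' \<in> borel_measurable M" unfolding Y'_def by measurable
  have "(\<integral>\<^sup>+x. ennreal ((X x - Y' x)\<^sup>2) \<partial>M) \<le> 2 * (\<integral>\<^sup>+x. ennreal ((X x - S j x)\<^sup>2) \<partial>M) + 2 * (2 * eps j)" for j
  proof -
    have "(\<integral>\<^sup>+x. ennreal ((X x - Y' x)\<^sup>2) \<partial>M)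
        \<le> 2 * (\<integral>\<^sup>+x. ennreal ((X x - S j x)\<^sup>2) \<partial>M) + 2 * (\<integral>\<^sup>+x. ennreal ((S j x - Y' x)\<^sup>2) \<partial>M)"
      by (rule nn_integral_sq_triangle) measurable
    also have "\<dots> \<le> 2 * (\<integral>\<^sup>+x. ennreal ((X x - S j x)\<^sup>2) \<partial>M) + 2 * (2 * eps j)"
      by (intro add_left_mono mult_left_mono SZ[folded Y'_def]) simp
    finally show ?thesis .
  qed
  moreover have "(\<lambda>j. 2 * (\<integral>\<^sup>+x. ennreal ((X x - S j x)\<^sup>2) \<partial>M) + 2 * (2 * eps j)) \<longlonglongrightarrow> 2 * 0 + 2 * (2 * 0)"
    unfolding S_def eps_def by (intro tendsto_add ennreal_tendsto_cmult lim1 lim2) auto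
  ultimately have "(\<integral>\<^sup>+x. ennreal ((X x - Y' x)\<^sup>2) \<partial>M) \<le> 2 * 0 + 2 * (2 * 0)"
    by (intro LIMSEQ_le_const) auto
  then have "(\<integral>\<^sup>+x. ennreal ((X x - Y' x)\<^sup>2) \<partial>M) = 0" by simp
  then have "AE x in M. ennreal ((X x - Y' x)\<^sup>2) = 0" by (subst (asm) nn_integral_0_iff_AE) auto
  with YZ show ?thesis
    by eventually_elim (simp add: Y'_def limI Z_def)
qed

text \<open>A functional of norm at most 1 maps step functions to step functions and does not
  increase either L2 error. Applied to Fourier coefficients, it reduces vector-valued integrals to
  real ones.\<close>

lemma has_wiener_integral_functional:
  fixes f :: "real \<Rightarrow> 'b::real_normed_vector" and L :: "'b \<Rightarrow> real"
  assumes L: "bounded_linear L" "\<And>v. \<bar>L v\<bar> \<le> norm v" and X: "has_wiener_integral M B t f X"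
  shows "has_wiener_integral M B t (\<lambda>s. L (f s)) (\<lambda>x. L (X x))"
proof -
  interpret L: bounded_linear L by fact
  obtain n \<tau> c where \<tau>: "\<And>j. mono (\<tau> j) \<and> range (\<tau> j) \<subseteq> {0..t}"
    and lim1: "(\<lambda>j::nat. \<integral>\<^sup>+s\<in>{0..t}. ennreal ((norm (f s - step_fun (n j) (\<tau> j) (c j) s))\<^sup>2) \<partial>lborel) \<longlonglongrightarrow> 0"
    and lim2: "(\<lambda>j. \<integral>\<^sup>+x. ennreal ((norm (X x - step_integral B (n j) (\<tau> j) (c j) x))\<^sup>2) \<partial>M) \<longlonglongrightarrow> 0"
    using X unfolding has_wiener_integral_def by blast
  have s: "step_fun n \<tau> (\<lambda>i. L (c i)) s = L (step_fun n \<tau> c s)"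
    "step_integral B n \<tau> (\<lambda>i. L (c i)) x = L (step_integral B n \<tau> c x)" for n \<tau> c s x
    by (simp_all add: step_fun_def step_integral_def L.sum L.scaleR)
  have le: "(L u - L v)\<^sup>2 \<le> (norm (u - v))\<^sup>2" for u v
    using power_mono[OF L(2)[of "u - v"] abs_ge_zero, of 2] by (simp add: L.diff)
  have "(\<lambda>j. \<integral>\<^sup>+s\<in>{0..t}. ennreal ((norm (L (f s) - step_fun (n j) (\<tau> j) (\<lambda>i. L (c j i)) s))\<^sup>2) \<partial>lborel) \<longlonglongrightarrow> 0"
    by (rule tendsto_sandwich[OF _ _ tendsto_const lim1])
      (unfold s, auto intro!: always_eventually nn_integral_mono mult_right_mono ennreal_leI le)
  moreover have "(\<lambda>j. \<integral>\<^sup>+x. ennreal ((norm (L (X x) - step_integral B (n j) (\<tau> j) (\<lambda>i. L (c j i)) x))\<^sup>2) \<partial>M) \<longlonglongrightarrow> 0"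
    by (rule tendsto_sandwich[OF _ _ tendsto_const lim2])
      (unfold s, auto intro!: always_eventually nn_integral_mono ennreal_leI le)
  moreover have "(\<lambda>x. L (X x)) \<in> borel_measurable M"
    using X unfolding has_wiener_integral_def
    by (intro borel_measurable_continuous_on[OF L.continuous_on[OF continuous_on_id]]) auto
  ultimately show ?thesis
    unfolding has_wiener_integral_def using \<tau> by (intro conjI exI[of _ n] exI[of _ \<tau>] exI[of _ "\<lambda>j i. L (c j i)"]) auto
qed

section \<open>From the mild formulation to equations for the modes\<close>

text \<open>Smoothing of the heat semigroup: at positive time any L2 element is mapped into
  \<open>hdot1\<close>, because k^2 exp(-2 \<tau> k^2) is at most 1 / (2 \<tau>). The drift needs
  this, the nonlinearity being only in L2.\<close>

lemma fc_heat_pos: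
  assumes \<tau>: "0 < \<tau>" and k: "k \<noteq> 0"
  shows "fc (emb (heat \<tau> v)) k = exp (- \<tau> * (real_of_int k)\<^sup>2) * fc v k"
proof -
  let ?c = "\<lambda>k. exp (- \<tau> * (real_of_int k)\<^sup>2) * fc v k"
  have "(\<lambda>k. \<bar>real_of_int k\<bar>\<^sup>2 * (?c k)\<^sup>2) summable_on (- {0})"
  proof (rule summable_on_comparison_test[OF summable_on_cmult_right[OF summable_fc[of v], of "1 / (2 * \<tau>)"]])
    fix k :: int
    define r where "r = 2 * \<tau> * (real_of_int k)\<^sup>2"
    have "r \<le> exp r" using exp_ge_add_one_self[of r] by linarith
    then have "r * exp (- r) \<le> 1" by (simp add: exp_minus field_simps)
    moreover have "(exp (- \<tau> * (real_of_int k)\<^sup>2))\<^sup>2 = exp (- r)"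
      by (simp add: r_def power2_eq_square flip: exp_add)
    ultimately have "\<bar>real_of_int k\<bar>\<^sup>2 * (exp (- \<tau> * (real_of_int k)\<^sup>2))\<^sup>2 \<le> 1 / (2 * \<tau>)"
      using \<tau> by (simp add: r_def field_simps)
    then have "(\<bar>real_of_int k\<bar>\<^sup>2 * (exp (- \<tau> * (real_of_int k)\<^sup>2))\<^sup>2) * (fc v k)\<^sup>2 \<le> 1 / (2 * \<tau>) * (fc v k)\<^sup>2"
      by (rule mult_right_mono) simp
    then show "\<bar>real_of_int k\<bar>\<^sup>2 * (?c k)\<^sup>2 \<le> 1 / (2 * \<tau>) * (fc v k)\<^sup>2"
      by (simp only: power_mult_distrib mult.assoc)
  qed simp
  then obtain w where w: "\<And>k. k \<noteq> 0 \<Longrightarrow> fc (emb w) k = ?c k"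
    using exists_hdot1_fc[of ?c] by blast
  have "heat \<tau> v = w"
    unfolding heat_def
  proof (rule the_equality)
    show "u = w" if "\<forall>k. k \<noteq> 0 \<longrightarrow> fc (emb u) k = ?c k" for u
      using that w by (intro hdot1_eq_fcI) auto
  qed (use w in auto)
  then show ?thesis using w k by simp
qed

lemma bounded_linear_fc_emb: "bounded_linear (\<lambda>v. fc (emb v) k)"
  by (rule bounded_linear_compose[OF bounded_linear_fc bounded_linear_emb])

lemma has_wiener_integral_cong:
  assumes "has_wiener_integral M B t f X" "\<And>s. s \<in> {0..t} \<Longrightarrow> f s = g s"
  shows "has_wiener_integral M B t g X"
proof -
  have "(\<integral>\<^sup>+s\<in>{0..t}. ennreal ((norm (f s - h s))\<^sup>2) \<partial>lborel) = (\<integral>\<^sup>+s\<in>{0..t}. ennreal ((norm (g s - h s))\<^sup>2) \<partial>lborel)" for h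
    by (rule nn_integral_cong) (use assms(2) in \<open>auto simp: indicator_def\<close>)
  with assms(1) show ?thesis unfolding has_wiener_integral_def by simp
qed

text \<open>The heat flow is diagonal, so only the integral against the Brownian motion of index
  \<open>j\<close> contributes. Integration by parts then leaves an expression that makes sense path
  by path, at a fixed time \<open>t\<close>.\<close>

lemma stoch_convolution_mode:
  assumes B: "\<And>k. k \<noteq> 0 \<Longrightarrow> brownian_motion M (\<beta> k)" and Z: "stoch_convolution M \<beta> b \<nu> Z"
    and t: "0 \<le> t" and j: "j \<noteq> 0" and \<nu>: "0 \<le> \<nu>"
  defines "\<kappa> \<equiv> \<nu> * (real_of_int j)\<^sup>2"
  shows "AE x in M. fc (emb (Z t x)) j
    = b j * (\<beta> j t x - integral {0..t} (\<lambda>s. \<beta> j s x * (\<kappa> * exp (- \<kappa> * (t - s)))))"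
proof -
  obtain I where I: "\<And>k. k \<noteq> 0 \<Longrightarrow> has_wiener_integral M (\<beta> k) t (\<lambda>s. heat (\<nu> * (t - s)) (eb k)) (I k)"
    and sum: "AE x in M. ((\<lambda>k. b k *\<^sub>R I k x) has_sum Z t x) (- {0})"
    using Z t unfolding stoch_convolution_def by blast
  define R where "R x = \<beta> j t x - integral {0..t} (\<lambda>s. \<beta> j s x * (\<kappa> * exp (- \<kappa> * (t - s))))" for x
  have "AE x in M. fc (emb (I k x)) j = (if k = j then R x else 0)" if k: "k \<noteq> 0" for k
  proof -
    define f where "f s = (if k = j then exp (- \<kappa> * (t - s)) else 0)" for s
    define f' where "f' s = (if k = j then \<kappa> * exp (- \<kappa> * (t - s)) else 0)" for s
    have "has_wiener_integral M (\<beta> k) t (\<lambda>s. fc (emb (heat (\<nu> * (t - s)) (eb k))) j) (\<lambda>x. fc (emb (I k x)) j)"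
      by (rule has_wiener_integral_functional[OF bounded_linear_fc_emb _ I[OF k]]) (rule abs_fc_le_norm_hdot1[OF j])
    then have "has_wiener_integral M (\<beta> k) t f (\<lambda>x. fc (emb (I k x)) j)"
    proof (rule has_wiener_integral_cong)
      fix s assume "s \<in> {0..t}"
      then have "fc (emb (heat (\<nu> * (t - s)) (emb (eb1 k)))) j = exp (- (\<nu> * (t - s)) * (real_of_int j)\<^sup>2) * fc (emb (eb1 k)) j"
        using \<nu> by (intro fc_heat j) auto
      then show "fc (emb (heat (\<nu> * (t - s)) (eb k))) j = f s"
        using k j by (simp add: emb_eb1 fc_eb f_def \<kappa>_def mult_ac)
    qed
    moreover have "(f has_real_derivative f' s) (at s)" for s
      unfolding f_def f'_def by (cases "k = j") (auto intro!: derivative_eq_intros)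
    moreover have "continuous_on UNIV f'"
      unfolding f'_def by (cases "k = j") (auto intro!: continuous_intros)
    ultimately have "AE x in M. fc (emb (I k x)) j = f t * \<beta> k t x - integral {0..t} (\<lambda>s. \<beta> k s x * f' s)"
      using wiener_integral_by_parts[OF B[OF k] t] by blast
    then show ?thesis
      by eventually_elim (auto simp: f_def f'_def R_def)
  qed
  then have "AE x in M. \<forall>k. k \<noteq> 0 \<longrightarrow> fc (emb (I k x)) j = (if k = j then R x else 0)"
    by (subst AE_all_countable) auto
  with sum have "AE x in M. fc (emb (Z t x)) j = b j * R x"
  proof eventually_elim
    case (elim x)
    have "((\<lambda>k. fc (emb (b k *\<^sub>R I k x)) j) has_sum fc (emb (Z t x)) j) (- {0})"
      using has_sum_bounded_linear[OF bounded_linear_fc_emb elim(1)] by (simp add: o_def)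
    moreover have "((\<lambda>k. fc (emb (b k *\<^sub>R I k x)) j) has_sum b j * R x) (- {0})"
    proof (rule has_sum_cong_neutral[THEN iffD1])
      show "((\<lambda>_. b j * R x) has_sum b j * R x) {j}"
        using has_sum_finite[of "{j}" "\<lambda>_. b j * R x"] by simp
    qed (use elim(2) j in \<open>auto simp: emb_scaleR fc_scaleR\<close>)
    ultimately show ?case by (rule has_sum_unique)
  qed
  then show ?thesis unfolding R_def .
qed

text \<open>Upgrades identities holding almost surely at each fixed time to all times outside one
  null set.\<close>

lemma continuous_eq_on_nonneg_rationals:
  fixes f g :: "real \<Rightarrow> real"
  assumes "continuous_on {0..} f" "continuous_on {0..} g" and eq: "\<And>q. q \<in> \<rat> \<Longrightarrow> 0 \<le> q \<Longrightarrow> f q = g q" and t: "0 \<le> t"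
  shows "f t = g t"
proof -
  \<comment> \<open>Rounding up keeps the rationals nonnegative, where both functions are known to
    be continuous.\<close>
  define q where "q n = real_of_int \<lceil>t * real (Suc n)\<rceil> / real (Suc n)" for n
  have q: "t \<le> q n" "q n \<le> t + 1 / real (Suc n)" for n
  proof -
    have "t * real (Suc n) \<le> real_of_int \<lceil>t * real (Suc n)\<rceil>" by simp
    then show "t \<le> q n" unfolding q_def by (subst pos_le_divide_eq) auto
    have "real_of_int \<lceil>t * real (Suc n)\<rceil> \<le> t * real (Suc n) + 1" by linarith
    then have "q n \<le> (t * real (Suc n) + 1) / real (Suc n)" unfolding q_def by (rule divide_right_mono) simp
    then show "q n \<le> t + 1 / real (Suc n)" by (simp add: add_divide_distrib)
  qed
  have lim: "q \<longlonglongrightarrow> t"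
  proof (rule tendsto_sandwich[OF _ _ tendsto_const])
    show "(\<lambda>n. t + 1 / real (Suc n)) \<longlonglongrightarrow> t"
      using tendsto_add[OF tendsto_const LIMSEQ_inverse_real_of_nat, of t] by (simp add: inverse_eq_divide)
  qed (use q in \<open>auto intro: always_eventually\<close>)
  have q0: "0 \<le> q n" for n using q(1)[of n] t by linarith
  have "(\<lambda>n. f (q n)) \<longlonglongrightarrow> f t" "(\<lambda>n. g (q n)) \<longlonglongrightarrow> g t"
    using assms(1,2) q0 t lim by (auto simp: continuous_on_sequentially o_def)
  moreover have "f (q n) = g (q n)" for n
    by (rule eq) (use q0 in \<open>auto simp: q_def\<close>)
  ultimately show ?thesis by (simp add: LIMSEQ_unique)
qed

lemma continuous_on_integral_upto:
  fixes g :: "real \<Rightarrow> real"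
  assumes "continuous_on {0..} g"
  shows "continuous_on {0..} (\<lambda>t. integral {0..t} g)"
proof (rule continuous_on_eq_continuous_within[THEN iffD2], rule ballI)
  fix t :: real assume t: "t \<in> {0..}"
  have "continuous_on {0..t + 1} (\<lambda>t. integral {0..t} g)"
    by (intro indefinite_integral_continuous_1 integrable_continuous_real continuous_on_subset[OF assms]) auto
  then have "continuous (at t within {0..t + 1}) (\<lambda>t. integral {0..t} g)"
    using t by (auto simp: continuous_on_eq_continuous_within)
  moreover have "at t within {0..t + 1} = at t within {0..}"
    by (rule at_within_nhd[of _ "{..<t + 1}"]) auto
  ultimately show "continuous (at t within {0..}) (\<lambda>t. integral {0..t} g)" by simp
qed

lemma exp_convolution_eq:
  fixes g :: "real \<Rightarrow> real"
  shows "integral {0..t} (\<lambda>s. exp (- \<kappa> * (t - s)) * g s) = exp (- \<kappa> * t) * integral {0..t} (\<lambda>s. exp (\<kappa> * s) * g s)"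
proof -
  have "exp (- \<kappa> * (t - s)) * g s = exp (- \<kappa> * t) * (exp (\<kappa> * s) * g s)" for s
    by (simp add: algebra_simps flip: exp_add)
  then show ?thesis by (simp only: integral_mult_right)
qed

text \<open>Inverts Duhamel's formula. The path \<open>\<beta>\<close> is merely continuous, so the
  function that is differentiated is \<open>p\<close>, equal to a - b \<beta>, in which
  \<open>\<beta>\<close> occurs only under an integral.\<close>

lemma variation_of_constants:
  fixes a n \<beta> :: "real \<Rightarrow> real"
  assumes a: "\<And>t. 0 \<le> t \<Longrightarrow> a t = exp (- \<kappa> * t) * y + integral {0..t} (\<lambda>s. exp (- \<kappa> * (t - s)) * n s)
      + b * (\<beta> t - integral {0..t} (\<lambda>s. \<beta> s * (\<kappa> * exp (- \<kappa> * (t - s)))))"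
    and n: "continuous_on {0..} n" and \<beta>: "continuous_on {0..} \<beta>" and t: "0 \<le> t"
  shows "a t = y + integral {0..t} (\<lambda>s. n s - \<kappa> * a s) + b * \<beta> t"
proof -
  define g where "g s = exp (\<kappa> * s) * (n s - \<kappa> * b * \<beta> s)" for s
  have g: "continuous_on {0..} g" unfolding g_def by (intro continuous_intros n \<beta>)
  define p where "p t = exp (- \<kappa> * t) * (y + integral {0..t} g)" for t
  have p: "p t = a t - b * \<beta> t" if "0 \<le> t" for t
  proof -
    have i: "(\<lambda>s. exp (\<kappa> * s) * n s) integrable_on {0..t}" "(\<lambda>s. exp (\<kappa> * s) * \<beta> s) integrable_on {0..t}"
      by (intro integrable_continuous_real continuous_intros continuous_on_subset[OF n] continuous_on_subset[OF \<beta>]; simp)+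
    have "integral {0..t} g = integral {0..t} (\<lambda>s. exp (\<kappa> * s) * n s - (\<kappa> * b) * (exp (\<kappa> * s) * \<beta> s))"
      unfolding g_def[abs_def] by (simp add: algebra_simps)
    also have "\<dots> = integral {0..t} (\<lambda>s. exp (\<kappa> * s) * n s) - (\<kappa> * b) * integral {0..t} (\<lambda>s. exp (\<kappa> * s) * \<beta> s)"
      using i by (subst integral_diff) (auto intro: integrable_on_mult_right)
    finally have 1: "integral {0..t} g = \<dots>" .
    have "integral {0..t} (\<lambda>s. \<beta> s * (\<kappa> * exp (- \<kappa> * (t - s)))) = integral {0..t} (\<lambda>s. \<kappa> * (exp (- \<kappa> * (t - s)) * \<beta> s))"
      by (simp add: mult_ac)
    also have "\<dots> = \<kappa> * (exp (- \<kappa> * t) * integral {0..t} (\<lambda>s. exp (\<kappa> * s) * \<beta> s))"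
      by (simp only: integral_mult_right exp_convolution_eq)
    finally have 2: "integral {0..t} (\<lambda>s. \<beta> s * (\<kappa> * exp (- \<kappa> * (t - s)))) = \<dots>" .
    have alg: "E * (y + (N - \<kappa> * b * J)) = E * y + E * N + b * (\<beta> t - \<kappa> * (E * J)) - b * \<beta> t" for E N J
      by (simp add: algebra_simps)
    show ?thesis
      unfolding a[OF that] p_def 1 2 exp_convolution_eq by (rule alg)
  qed
  have "((\<lambda>s. n s - \<kappa> * a s) has_integral p t - p 0) {0..t}"
  proof (rule fundamental_theorem_of_calculus[OF t])
    fix s assume s: "s \<in> {0..t}"
    have "((\<lambda>u. integral {0..u} g) has_real_derivative g s) (at s within {0..t})"
      by (intro integral_has_real_derivative continuous_on_subset[OF g] s) auto
    then have "(p has_real_derivative (- \<kappa> * exp (- \<kappa> * s)) * (y + integral {0..s} g) + exp (- \<kappa> * s) * g s) (at s within {0..t})"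
      unfolding p_def by (auto intro!: derivative_eq_intros)
    moreover have "exp (- \<kappa> * s) * g s = n s - \<kappa> * b * \<beta> s"
      by (simp add: g_def flip: exp_add mult.assoc)
    ultimately have d: "(p has_real_derivative - \<kappa> * p s + (n s - \<kappa> * b * \<beta> s)) (at s within {0..t})"
      by (simp add: p_def mult.assoc)
    have e: "- \<kappa> * p s + (n s - \<kappa> * b * \<beta> s) = n s - \<kappa> * a s"
    proof -
      have "a s = p s + b * \<beta> s" using p[of s] s by simp
      then show ?thesis by (simp add: distrib_left)
    qed
    show "(p has_vector_derivative n s - \<kappa> * a s) (at s within {0..t})"
      using d unfolding e has_real_derivative_iff_has_vector_derivative .
  qed
  then have "integral {0..t} (\<lambda>s. n s - \<kappa> * a s) = p t - p 0" by (rule integral_unique)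
  then show ?thesis using p[OF t] by (simp add: p_def)
qed

lemma set_lebesgue_integral_Ico_eq_integral:
  fixes g :: "real \<Rightarrow> real"
  assumes "continuous_on {0..t} g"
  shows "(LINT s:{0..<t}|lborel. g s) = integral {0..t} g"
proof -
  have i: "set_integrable lborel {0..t} g" by (rule borel_integrable_atLeastAtMost'[OF assms])
  have "(LINT s:{0..<t}|lborel. g s) = (LINT s:{0..t}|lborel. g s)"
    unfolding set_lebesgue_integral_def
  proof (rule integral_cong_AE)
    have "set_integrable lborel {0..<t} g" by (rule set_integrable_subset[OF i]) auto
    then show "(\<lambda>s. indicat_real {0..<t} s *\<^sub>R g s) \<in> borel_measurable lborel"
      "(\<lambda>s. indicat_real {0..t} s *\<^sub>R g s) \<in> borel_measurable lborel"
      using i unfolding set_integrable_def by auto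
    show "AE s in lborel. indicat_real {0..<t} s *\<^sub>R g s = indicat_real {0..t} s *\<^sub>R g s"
      using AE_lborel_singleton[of t] by eventually_elim (auto simp: indicator_def)
  qed
  then show ?thesis using set_borel_integral_eq_integral(2)[OF i] by simp
qed

text \<open>The coefficient functional turns the mild equation into Duhamel's formula for a scalar
  equation, which \<open>variation_of_constants\<close> inverts. The stochastic term is identified
  at rational times first, so that a single null set serves all times.\<close>

lemma mild_solution_mode:
  assumes B: "\<And>k. k \<noteq> 0 \<Longrightarrow> brownian_motion M (\<beta> k)" and w: "mild_solution M \<beta> b \<nu> (- 2) y w"
    and k: "k \<noteq> 0" and \<nu>: "0 < \<nu>"
  shows "AE x in M. \<forall>t\<ge>0. fc (emb (w t x)) k = fc (emb y) k
    + integral {0..t} (\<lambda>s. fc (nonlin (- 2) (emb (w s x))) k - \<nu> * (real_of_int k)\<^sup>2 * fc (emb (w s x)) k)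
    + b k * \<beta> k t x"
proof -
  define \<kappa> where "\<kappa> = \<nu> * (real_of_int k)\<^sup>2"
  obtain Z where Z: "stoch_convolution M \<beta> b \<nu> Z"
    and eq: "AE x in M. \<forall>t\<ge>0.
           set_integrable lborel {0..<t} (\<lambda>s. heat (\<nu> * (t - s)) (nonlin (- 2) (emb (w s x)))) \<and>
           w t x = heat (\<nu> * t) (emb y)
             + (LINT s:{0..<t}|lborel. heat (\<nu> * (t - s)) (nonlin (- 2) (emb (w s x)))) + Z t x"
    using w unfolding mild_solution_def by blast
  have wc: "AE x in M. continuous_on {0..} (\<lambda>t. w t x)" using w unfolding mild_solution_def by blast
  have Zc: "AE x in M. continuous_on {0..} (\<lambda>t. Z t x)" using Z unfolding stoch_convolution_def by blast
  define R where "R t x = b k * (\<beta> k t x - integral {0..t} (\<lambda>s. \<beta> k s x * (\<kappa> * exp (- \<kappa> * (t - s)))))" for t x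
  have "AE x in M. \<forall>q\<in>\<rat> \<inter> {0..}. fc (emb (Z q x)) k = R q x"
  proof (rule AE_ball_countable[THEN iffD2])
    show "countable (\<rat> \<inter> {0..} :: real set)" using countable_rat by (rule countable_subset[rotated]) auto
    show "\<forall>q\<in>\<rat> \<inter> {0..}. AE x in M. fc (emb (Z q x)) k = R q x"
      unfolding R_def \<kappa>_def using stoch_convolution_mode[OF B Z _ k] \<nu> by auto
  qed
  with eq wc Zc brownian_motionD(4)[OF B[OF k]] show ?thesis
  proof eventually_elim
    case (elim x)
    have \<beta>c: "continuous_on {0..} (\<lambda>t. \<beta> k t x)" by (rule elim)
    have Rc: "continuous_on {0..} (\<lambda>t. R t x)"
    proof -
      have "R t x = b k * (\<beta> k t x - exp (- \<kappa> * t) * integral {0..t} (\<lambda>s. exp (\<kappa> * s) * (\<kappa> * \<beta> k s x)))" for t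
        unfolding R_def exp_convolution_eq[symmetric] by (simp add: mult_ac)
      then show ?thesis by (auto intro!: continuous_intros continuous_on_integral_upto \<beta>c)
    qed
    have Zk: "fc (emb (Z t x)) k = R t x" if "0 \<le> t" for t
    proof (rule continuous_eq_on_nonneg_rationals[OF _ Rc _ that])
      show "continuous_on {0..} (\<lambda>t. fc (emb (Z t x)) k)"
        by (rule bounded_linear.continuous_on[OF bounded_linear_fc_emb elim(3)])
    qed (use elim(5) in auto)
    define n where "n s = fc (nonlin (- 2) (emb (w s x))) k" for s
    have nc: "continuous_on {0..} n"
      unfolding n_def by (rule continuous_on_compose2[OF continuous_on_fc_nonlin[OF k, of UNIV] elim(2)]) auto
    have a: "fc (emb (w t x)) k = exp (- \<kappa> * t) * fc (emb y) k + integral {0..t} (\<lambda>s. exp (- \<kappa> * (t - s)) * n s) + R t x"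
      if t: "0 \<le> t" for t
    proof -
      have int: "set_integrable lborel {0..<t} (\<lambda>s. heat (\<nu> * (t - s)) (nonlin (- 2) (emb (w s x))))"
        and wt: "w t x = heat (\<nu> * t) (emb y)
             + (LINT s:{0..<t}|lborel. heat (\<nu> * (t - s)) (nonlin (- 2) (emb (w s x)))) + Z t x"
        using elim(1) t by auto
      have "fc (emb (LINT s:{0..<t}|lborel. heat (\<nu> * (t - s)) (nonlin (- 2) (emb (w s x))))) k
          = (LINT s:{0..<t}|lborel. fc (emb (heat (\<nu> * (t - s)) (nonlin (- 2) (emb (w s x))))) k)"
        using integral_bounded_linear[OF bounded_linear_fc_emb int[unfolded set_integrable_def]]
        unfolding set_lebesgue_integral_def by (simp add: emb_scaleR fc_scaleR)
      also have "\<dots> = (LINT s:{0..<t}|lborel. exp (- \<kappa> * (t - s)) * n s)"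
        by (rule set_lebesgue_integral_cong)
          (use \<nu> k in \<open>auto simp: fc_heat_pos n_def \<kappa>_def mult_ac\<close>)
      also have "\<dots> = integral {0..t} (\<lambda>s. exp (- \<kappa> * (t - s)) * n s)"
        by (intro set_lebesgue_integral_Ico_eq_integral continuous_intros continuous_on_subset[OF nc]) auto
      finally show ?thesis
        unfolding wt emb_add fc_add Zk[OF t] using fc_heat[of "\<nu> * t" k y] \<nu> t k by (simp add: \<kappa>_def mult_ac)
    qed
    show ?case
      using variation_of_constants[of "\<lambda>t. fc (emb (w t x)) k" \<kappa> "fc (emb y) k" n "b k" "\<lambda>t. \<beta> k t x"]
        a nc \<beta>c unfolding R_def \<kappa>_def n_def by blast
  qed
qed

section \<open>Exponential supermartingales\<close>

lemma nn_integral_normal_density: "0 < \<sigma> \<Longrightarrow> (\<integral>\<^sup>+z. ennreal (normal_density \<mu> \<sigma> z) \<partial>lborel) = 1"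
  by (subst nn_integral_eq_integral) auto

text \<open>Completing the square turns the integrand into a multiple \<open>C\<close> of the normal
  density with mean a h / d and variance h / d, where d = 1 - 2 c h. Bounding by \<open>q\<close>
  instead of 2 c h gives a denominator that can be shared by all modes.\<close>

lemma gaussian_exponential_bound:
  fixes a c h q :: real
  assumes X: "distributed M lborel X (\<lambda>z. ennreal (normal_density 0 (sqrt h) z))"
    and h: "0 < h" and c: "0 \<le> c" and q: "2 * c * h \<le> q" "q < 1"
  shows "(\<integral>\<^sup>+x. ennreal (exp (a * X x + c * (X x)\<^sup>2 - h * (c + a\<^sup>2 / 2) / (1 - q))) \<partial>M) \<le> 1"
proof -
  define d where "d = 1 - 2 * c * h"
  have d: "0 < d" "1 - q \<le> d" "0 < 1 - q" using q by (auto simp: d_def)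
  define B where "B = h * (c + a\<^sup>2 / 2) / (1 - q)"
  define C where "C = 1 / sqrt d * exp (a\<^sup>2 * h / (2 * d))"
  have eq: "normal_density 0 (sqrt h) z * exp (a * z + c * z\<^sup>2) = C * normal_density (a * h / d) (sqrt (h / d)) z" for z
  proof -
    have "- (z - a * h / d)\<^sup>2 / (2 * (h / d)) + a\<^sup>2 * h / (2 * d) = - z\<^sup>2 / (2 * h) + (a * z + c * z\<^sup>2)"
    proof -
      have c': "c = (1 - d) / (2 * h)" using h by (simp add: d_def)
      show ?thesis unfolding c' using h d(1) by (simp add: field_simps power2_eq_square)
    qed
    then have e: "exp (- (z - a * h / d)\<^sup>2 / (2 * (h / d))) * exp (a\<^sup>2 * h / (2 * d)) = exp (- z\<^sup>2 / (2 * h)) * exp (a * z + c * z\<^sup>2)"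
      by (simp only: exp_add[symmetric])
    have s: "1 / sqrt d * (1 / sqrt (2 * pi * (h / d))) = 1 / sqrt (2 * pi * h)"
      using d h by (simp add: real_sqrt_divide real_sqrt_mult)
    have "C * normal_density (a * h / d) (sqrt (h / d)) z
        = (1 / sqrt d * (1 / sqrt (2 * pi * (h / d)))) * (exp (- (z - a * h / d)\<^sup>2 / (2 * (h / d))) * exp (a\<^sup>2 * h / (2 * d)))"
      using d h by (simp add: C_def normal_density_def)
    also have "\<dots> = normal_density 0 (sqrt h) z * exp (a * z + c * z\<^sup>2)"
      unfolding s e using h by (simp add: normal_density_def)
    finally show ?thesis by simp
  qed
  \<comment> \<open>1 / d = 1 + 2 c h / d is at most exp(2 c h / d), which bounds the factor 1 /
    sqrt d; afterwards d is replaced by the smaller 1 - q.\<close>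
  have C_le: "C \<le> exp B"
  proof -
    have "1 = d * (1 + 2 * c * h / d)" using d by (simp add: d_def field_simps)
    also have "\<dots> \<le> d * exp (2 * c * h / d)"
      using d by (intro mult_left_mono exp_ge_add_one_self) auto
    finally have "1 / d \<le> exp (2 * c * h / d)" using d by (simp add: field_simps)
    then have "sqrt (1 / d) \<le> sqrt ((exp (c * h / d))\<^sup>2)"
      by (simp add: exp_double[symmetric] algebra_simps)
    then have "1 / sqrt d \<le> exp (c * h / d)" by (simp add: real_sqrt_divide)
    then have "C \<le> exp (c * h / d) * exp (a\<^sup>2 * h / (2 * d))"
      unfolding C_def by (intro mult_right_mono) auto
    also have "\<dots> = exp (h * (c + a\<^sup>2 / 2) / d)"
      by (simp add: exp_add[symmetric] add_divide_distrib distrib_left mult_ac)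
    also have "\<dots> \<le> exp B"
      unfolding B_def using d h c by (intro exp_le_cancel_iff[THEN iffD2] divide_left_mono mult_nonneg_nonneg mult_pos_pos) auto
    finally show ?thesis .
  qed
  have C0: "0 \<le> C" using d by (simp add: C_def)
  have "(\<integral>\<^sup>+x. ennreal (exp (a * X x + c * (X x)\<^sup>2 - B)) \<partial>M)
      = (\<integral>\<^sup>+z. ennreal (normal_density 0 (sqrt h) z) * ennreal (exp (a * z + c * z\<^sup>2 - B)) \<partial>lborel)"
    by (rule distributed_nn_integral[OF X, symmetric]) measurable
  also have "\<dots> = (\<integral>\<^sup>+z. ennreal (C * exp (- B)) * ennreal (normal_density (a * h / d) (sqrt (h / d)) z) \<partial>lborel)"
  proof (rule nn_integral_cong)
    fix z
    have "normal_density 0 (sqrt h) z * exp (a * z + c * z\<^sup>2 - B) = C * exp (- B) * normal_density (a * h / d) (sqrt (h / d)) z"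
      using arg_cong[OF eq[of z], of "\<lambda>u. u * exp (- B)"] by (simp add: exp_diff exp_minus field_simps)
    then show "ennreal (normal_density 0 (sqrt h) z) * ennreal (exp (a * z + c * z\<^sup>2 - B))
        = ennreal (C * exp (- B)) * ennreal (normal_density (a * h / d) (sqrt (h / d)) z)"
      using C0 by (simp flip: ennreal_mult)
  qed
  also have "\<dots> = ennreal (C * exp (- B))"
    using d h by (simp add: nn_integral_cmult nn_integral_normal_density)
  also have "\<dots> \<le> ennreal 1"
    using C_le by (intro ennreal_leI) (simp add: exp_minus field_simps)
  finally show ?thesis by (simp add: B_def)
qed

text \<open>Conditioning on the past is carried out by Fubini: the past data \<open>V\<close> and
  the increments \<open>Y\<close> have a product law, and for frozen past the expectation factorizes
  over the independent modes into Gaussian integrals that are at most 1.\<close>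

lemma (in prob_space) conditional_gaussian_step:
  fixes a \<xi> :: "'i \<Rightarrow> 'a \<Rightarrow> real" and U :: "'a \<Rightarrow> ennreal" and c :: "'i \<Rightarrow> real"
  assumes G: "subalgebra M G" and ind: "indep_set (sets G) (sigma_sets (space M) E)" and E: "E \<subseteq> Pow (space M)"
    and \<xi>E: "\<And>k A. k \<in> K \<Longrightarrow> A \<in> sets borel \<Longrightarrow> \<xi> k -` A \<inter> space M \<in> sigma_sets (space M) E"
    and \<xi>: "indep_vars (\<lambda>_. borel) \<xi> K" and K: "finite K"
    and U: "U \<in> borel_measurable G" and a: "\<And>k. k \<in> K \<Longrightarrow> a k \<in> borel_measurable G"
    and D: "\<And>k. k \<in> K \<Longrightarrow> distributed M lborel (\<xi> k) (\<lambda>z. ennreal (normal_density 0 (sqrt h) z))"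
    and h: "0 < h" and c: "\<And>k. k \<in> K \<Longrightarrow> 0 \<le> c k \<and> 2 * c k * h \<le> q" and q: "q < 1"
  shows "(\<integral>\<^sup>+x. U x * ennreal (exp (\<Sum>k\<in>K. a k x * \<xi> k x + c k * (\<xi> k x)\<^sup>2 - h * (c k + (a k x)\<^sup>2 / 2) / (1 - q))) \<partial>M)
    \<le> (\<integral>\<^sup>+x. U x \<partial>M)"
proof -
  let ?P = "PiM K (\<lambda>_. borel :: real measure)"
  let ?S = "borel \<Otimes>\<^sub>M ?P :: (ennreal \<times> ('i \<Rightarrow> real)) measure"
  define V where "V x = (U x, \<lambda>k\<in>K. a k x)" for x
  \<comment> \<open>The dummy component gives \<open>Y\<close> the type of \<open>V\<close>, which \<open>indep_var\<close> requires.\<close>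
  define Y where "Y x = (0 :: ennreal, \<lambda>k\<in>K. \<xi> k x)" for x
  define N where "N = sigma (space M) E"
  have sN: "space N = space M" "sets N = sigma_sets (space M) E"
    using E by (auto simp: N_def)
  have \<xi>N: "\<xi> k \<in> borel_measurable N" if "k \<in> K" for k
    by (rule measurableI) (use \<xi>E[OF that] sN in auto)
  have YN: "Y \<in> N \<rightarrow>\<^sub>M ?S" unfolding Y_def
    by (intro measurable_Pair measurable_const measurable_restrict \<xi>N) auto
  have VG: "V \<in> G \<rightarrow>\<^sub>M ?S" unfolding V_def
    by (intro measurable_Pair U measurable_restrict a)
  have EM: "sigma_sets (space M) E \<subseteq> events"
    using ind by (auto simp: indep_set_def indep_sets_def split: bool.splits)
  have spG: "space G = space M" using G by (simp add: subalgebra_def)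
  have VM [measurable]: "V \<in> M \<rightarrow>\<^sub>M ?S" using VG G by (rule measurable_from_subalg[rotated])
  have YM [measurable]: "Y \<in> M \<rightarrow>\<^sub>M ?S"
    by (rule measurableI) (use measurable_space[OF YN] measurable_sets[OF YN] EM sN in auto)
  have "indep_var ?S V ?S Y"
    unfolding indep_var_eq
  proof (intro conjI VM YM)
    have 1: "sigma_sets (space M) {V -` A \<inter> space M |A. A \<in> sets ?S} \<subseteq> sets G"
      unfolding spG[symmetric] by (rule sets.sigma_sets_subset) (use measurable_sets[OF VG] in auto)
    have 2: "sigma_sets (space M) {Y -` A \<inter> space M |A. A \<in> sets ?S} \<subseteq> sigma_sets (space M) E"
      unfolding sN(2)[symmetric] unfolding sN(1)[symmetric] by (rule sets.sigma_sets_subset) (use measurable_sets[OF YN] in auto)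
    show "indep_set (sigma_sets (space M) {V -` A \<inter> space M |A. A \<in> sets ?S})
        (sigma_sets (space M) {Y -` A \<inter> space M |A. A \<in> sets ?S})"
      unfolding indep_set_def
      by (rule indep_sets_mono_sets[OF ind[unfolded indep_set_def]]) (use 1 2 in \<open>auto split: bool.split\<close>)
  qed
  then have J: "distr M ?S V \<Otimes>\<^sub>M distr M ?S Y = distr M (?S \<Otimes>\<^sub>M ?S) (\<lambda>x. (V x, Y x))"
    unfolding indep_var_distribution_eq by blast
  define e where "e k \<alpha> z = exp (\<alpha> * z + c k * z\<^sup>2 - h * (c k + \<alpha>\<^sup>2 / 2) / (1 - q))" for k \<alpha> z
  define \<Phi> :: "(ennreal \<times> ('i \<Rightarrow> real)) \<times> (ennreal \<times> ('i \<Rightarrow> real)) \<Rightarrow> ennreal"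
    where "\<Phi> p = fst (fst p) * (\<Prod>k\<in>K. ennreal (e k (snd (fst p) k) (snd (snd p) k)))" for p
  have \<Phi>m [measurable]: "\<Phi> \<in> borel_measurable (?S \<Otimes>\<^sub>M ?S)"
    unfolding \<Phi>_def[abs_def] e_def by measurable
  have \<Phi>m': "\<Phi> \<in> borel_measurable (distr M ?S V \<Otimes>\<^sub>M distr M ?S Y)"
    using \<Phi>m by (simp cong: measurable_cong_sets)
  interpret PV: prob_space "distr M ?S V" by (rule prob_space_distr) simp
  interpret PY: prob_space "distr M ?S Y" by (rule prob_space_distr) simp
  have inner: "(\<integral>\<^sup>+z. \<Phi> (v, z) \<partial>distr M ?S Y) \<le> fst v" for v
  proof -
    obtain u \<alpha> where v: "v = (u, \<alpha>)" by (cases v)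
    have "(\<lambda>z. \<Phi> (v, z)) \<in> borel_measurable ?S"
      unfolding \<Phi>_def v e_def fst_conv snd_conv by measurable
    then have "(\<integral>\<^sup>+z. \<Phi> (v, z) \<partial>distr M ?S Y) = (\<integral>\<^sup>+x. \<Phi> (v, Y x) \<partial>M)"
      by (subst nn_integral_distr[OF YM]) auto
    also have "\<dots> = (\<integral>\<^sup>+x. u * (\<Prod>k\<in>K. ennreal (e k (\<alpha> k) (\<xi> k x))) \<partial>M)"
      by (simp add: \<Phi>_def v Y_def cong: prod.cong)
    also have "\<dots> = u * (\<integral>\<^sup>+x. (\<Prod>k\<in>K. ennreal (e k (\<alpha> k) (\<xi> k x))) \<partial>M)"
    proof (rule nn_integral_cmult)
      have [measurable]: "\<xi> k \<in> borel_measurable M" if "k \<in> K" for k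
        using \<xi> that by (auto simp: indep_vars_def)
      show "(\<lambda>x. \<Prod>k\<in>K. ennreal (e k (\<alpha> k) (\<xi> k x))) \<in> borel_measurable M"
        unfolding e_def by measurable
    qed
    also have "(\<integral>\<^sup>+x. (\<Prod>k\<in>K. ennreal (e k (\<alpha> k) (\<xi> k x))) \<partial>M) = (\<Prod>k\<in>K. \<integral>\<^sup>+x. ennreal (e k (\<alpha> k) (\<xi> k x)) \<partial>M)"
      by (rule indep_vars_nn_integral[OF K]) (auto intro!: indep_vars_compose2[OF \<xi>] simp: e_def)
    finally have eq: "(\<integral>\<^sup>+z. \<Phi> (v, z) \<partial>distr M ?S Y) = u * (\<Prod>k\<in>K. \<integral>\<^sup>+x. ennreal (e k (\<alpha> k) (\<xi> k x)) \<partial>M)" .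
    have "(\<Prod>k\<in>K. \<integral>\<^sup>+x. ennreal (e k (\<alpha> k) (\<xi> k x)) \<partial>M) \<le> 1"
      unfolding e_def
      by (rule prod_le_1) (use gaussian_exponential_bound[OF D h _ _ q] c in auto)
    then have "u * (\<Prod>k\<in>K. \<integral>\<^sup>+x. ennreal (e k (\<alpha> k) (\<xi> k x)) \<partial>M) \<le> u * 1"
      by (intro mult_left_mono) simp_all
    with eq show ?thesis by (simp add: v)
  qed
  have "(\<integral>\<^sup>+x. U x * ennreal (exp (\<Sum>k\<in>K. a k x * \<xi> k x + c k * (\<xi> k x)\<^sup>2 - h * (c k + (a k x)\<^sup>2 / 2) / (1 - q))) \<partial>M)
      = (\<integral>\<^sup>+x. \<Phi> (V x, Y x) \<partial>M)"
    by (rule nn_integral_cong) (simp add: \<Phi>_def V_def Y_def e_def exp_sum[OF K] prod_ennreal cong: prod.cong)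
  also have "\<dots> = (\<integral>\<^sup>+p. \<Phi> p \<partial>(distr M ?S V \<Otimes>\<^sub>M distr M ?S Y))"
    unfolding J by (rule nn_integral_distr[symmetric]) measurable
  also have "\<dots> = (\<integral>\<^sup>+v. \<integral>\<^sup>+z. \<Phi> (v, z) \<partial>distr M ?S Y \<partial>distr M ?S V)"
    by (rule PY.nn_integral_fst[symmetric]) (rule \<Phi>m')
  also have "\<dots> \<le> (\<integral>\<^sup>+v. fst v \<partial>distr M ?S V)"
    by (intro nn_integral_mono inner)
  also have "\<dots> = (\<integral>\<^sup>+x. U x \<partial>M)"
    by (subst nn_integral_distr[OF VM]) (auto simp: V_def)
  finally show ?thesis .
qed

section \<open>The exponential supermartingale on a grid and its limit\<close>

lemma driving_noiseD:
  assumes "driving_noise M F \<beta>"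
  shows "prob_space M" "0 \<le> t \<Longrightarrow> subalgebra M (F t)" "0 \<le> s \<Longrightarrow> s \<le> t \<Longrightarrow> sets (F s) \<subseteq> sets (F t)"
    "k \<noteq> 0 \<Longrightarrow> brownian_motion M (\<beta> k)" "k \<noteq> 0 \<Longrightarrow> 0 \<le> t \<Longrightarrow> \<beta> k t \<in> borel_measurable (F t)"
proof -
  note N = assms[unfolded driving_noise_def filtered_prob_space_def]
  show "prob_space M" "0 \<le> t \<Longrightarrow> subalgebra M (F t)" "0 \<le> s \<Longrightarrow> s \<le> t \<Longrightarrow> sets (F s) \<subseteq> sets (F t)"
    "k \<noteq> 0 \<Longrightarrow> brownian_motion M (\<beta> k)"
    "k \<noteq> 0 \<Longrightarrow> 0 \<le> t \<Longrightarrow> \<beta> k t \<in> borel_measurable (F t)"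
    using N by simp_all
qed

lemma measurable_filtration_mono:
  assumes N: "driving_noise M F \<beta>" and "0 \<le> s" "s \<le> t" and f: "f \<in> F s \<rightarrow>\<^sub>M L"
  shows "f \<in> F t \<rightarrow>\<^sub>M L"
proof -
  have "subalgebra (F t) (F s)"
    using driving_noiseD(2)[OF N, of s] driving_noiseD(2)[OF N, of t] driving_noiseD(3)[OF N assms(2,3)] assms
    by (auto simp: subalgebra_def)
  then show ?thesis using f by (rule measurable_from_subalg)
qed

text \<open>Increments are measurable functions of the whole paths, which are independent across
  modes.\<close>

lemma noise_increments_indep:
  assumes N: "driving_noise M F \<beta>" and st: "0 \<le> s" "s \<le> t" and K: "K \<subseteq> - {0}"
  shows "prob_space.indep_vars M (\<lambda>_. borel) (\<lambda>k x. \<beta> k t x - \<beta> k s x) K"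
proof -
  interpret prob_space M by (rule driving_noiseD(1)[OF N])
  have "indep_vars (\<lambda>_. PiM {0..} (\<lambda>_. borel)) (\<lambda>k x. \<lambda>t\<in>{0..}. \<beta> k t x) (- {0})"
    using N by (simp add: driving_noise_def)
  then have "indep_vars (\<lambda>_. PiM {0..} (\<lambda>_. borel)) (\<lambda>k x. \<lambda>t\<in>{0..}. \<beta> k t x) K"
    by (rule indep_vars_subset) (rule K)
  then have "indep_vars (\<lambda>_. borel) (\<lambda>k x. (\<lambda>p. p t - p s :: real) (\<lambda>t\<in>{0..}. \<beta> k t x)) K"
  proof (rule indep_vars_compose2)
    show "(\<lambda>p. p t - p s :: real) \<in> borel_measurable (PiM {0..} (\<lambda>_. borel))"
      by (intro borel_measurable_diff measurable_component_singleton) (use st in auto)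
  qed
  then show ?thesis using st by simp
qed

text \<open>The exponent contributed by one grid step and one mode: the noise part of the increment of
  \<open>\<kappa> X\<^sup>2\<close>, minus a bound for the logarithm of its conditional exponential moment.\<close>

definition ito_step :: "(real \<Rightarrow> real) \<Rightarrow> real \<Rightarrow> real \<Rightarrow> real \<Rightarrow> (real \<Rightarrow> real) \<Rightarrow> (real \<Rightarrow> real) \<Rightarrow> nat \<Rightarrow> nat \<Rightarrow> real" where
  "ito_step \<kappa> b C T X \<beta> m j = (let s = grid T m j; \<Delta> = \<beta> (grid T m (Suc j)) - \<beta> s in
    2 * \<kappa> s * b * X s * \<Delta> + \<kappa> s * b\<^sup>2 * \<Delta>\<^sup>2
      - T / m * (\<kappa> s * b\<^sup>2 + (2 * \<kappa> s * b * X s)\<^sup>2 / 2) / (1 - 2 * C * (T / m)))"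

text \<open>The limit of the sums of \<open>ito_step\<close>. If X has drift d and noise coefficient
  b, it is, by Ito's formula, the stochastic integral of 2 \<kappa> b X minus half its quadratic
  variation, so its exponential is formally a local martingale.\<close>

definition ito_exponent :: "(real \<Rightarrow> real) \<Rightarrow> (real \<Rightarrow> real) \<Rightarrow> real \<Rightarrow> real \<Rightarrow> (real \<Rightarrow> real) \<Rightarrow> (real \<Rightarrow> real) \<Rightarrow> real" where
  "ito_exponent \<kappa> \<kappa>' b T X d = \<kappa> T * (X T)\<^sup>2 - \<kappa> 0 * (X 0)\<^sup>2 - integral {0..T} (\<lambda>s. \<kappa>' s * (X s)\<^sup>2
    + 2 * \<kappa> s * X s * d s + \<kappa> s * b\<^sup>2 + 2 * (\<kappa> s)\<^sup>2 * b\<^sup>2 * (X s)\<^sup>2)"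

text \<open>The factor of the next step has conditional expectation at most 1 given the past;
  measurability at the current grid point is part of the induction because that step needs it. The
  bound \<open>C\<close> on the weighted noise lets one denominator serve all modes and
  steps.\<close>

lemma discrete_supermartingale:
  fixes X :: "int \<Rightarrow> real \<Rightarrow> 'w \<Rightarrow> real" and \<kappa> :: "real \<Rightarrow> real"
  assumes N: "driving_noise M F \<beta>" and K: "finite K" "K \<subseteq> - {0}"
    and X: "\<And>k t. k \<in> K \<Longrightarrow> 0 \<le> t \<Longrightarrow> X k t \<in> borel_measurable (F t)"
    and T: "0 < T" and m: "0 < m"
    and \<kappa>: "\<And>s. s \<in> {0..T} \<Longrightarrow> 0 \<le> \<kappa> s" and C: "\<And>k s. k \<in> K \<Longrightarrow> s \<in> {0..T} \<Longrightarrow> \<kappa> s * (b k)\<^sup>2 \<le> C"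
    and q: "2 * C * (T / m) < 1"
  defines "L n x \<equiv> exp (\<Sum>j<n. \<Sum>k\<in>K. ito_step \<kappa> (b k) C T (\<lambda>t. X k t x) (\<lambda>t. \<beta> k t x) m j)"
  assumes n: "n \<le> m"
  shows "L n \<in> borel_measurable (F (grid T m n)) \<and> (\<integral>\<^sup>+x. ennreal (L n x) \<partial>M) \<le> 1"
  using n
proof (induction n)
  interpret prob_space M by (rule driving_noiseD(1)[OF N])
  case 0
  show ?case by (simp add: L_def emeasure_space_1)
next
  interpret prob_space M by (rule driving_noiseD(1)[OF N])
  case (Suc n)
  let ?s = "grid T m n" and ?t = "grid T m (Suc n)"
  define c where "c k = \<kappa> ?s * (b k)\<^sup>2" for k
  define a where "a k x = 2 * \<kappa> ?s * b k * X k ?s x" for k x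
  define \<Delta> where "\<Delta> k x = \<beta> k ?t x - \<beta> k ?s x" for k x
  have st: "0 \<le> ?s" "?s < ?t" "?t - ?s = T / m" "?s \<in> {0..T}"
    using T m Suc.prems grid_nonneg[of T m n] grid_le[of T n m] by (auto simp: grid_Suc)
  have t0: "0 \<le> ?t" using st by simp
  have Ls: "L n \<in> borel_measurable (F ?s)" and Li: "(\<integral>\<^sup>+x. ennreal (L n x) \<partial>M) \<le> 1"
    using Suc by auto
  have am: "a k \<in> borel_measurable (F ?s)" if "k \<in> K" for k
    unfolding a_def using X[OF that st(1)] by measurable
  have \<beta>m: "\<beta> k u \<in> borel_measurable (F ?t)" if "k \<in> K" "0 \<le> u" "u \<le> ?t" for k u
    using driving_noiseD(5)[OF N, of k u] that K measurable_filtration_mono[OF N that(2,3)] by auto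
  have step: "L (Suc n) x = L n x * exp (\<Sum>k\<in>K. a k x * \<Delta> k x + c k * (\<Delta> k x)\<^sup>2
      - T / m * (c k + (a k x)\<^sup>2 / 2) / (1 - 2 * C * (T / m)))" for x
    by (simp add: L_def exp_add ito_step_def Let_def a_def c_def \<Delta>_def)
  have "L (Suc n) \<in> borel_measurable (F ?t)"
  proof -
    have [measurable]: "L n \<in> borel_measurable (F ?t)"
      by (rule measurable_filtration_mono[OF N st(1) _ Ls]) (use st in simp)
    have [measurable]: "a k \<in> borel_measurable (F ?t)" if "k \<in> K" for k
      by (rule measurable_filtration_mono[OF N st(1) _ am[OF that]]) (use st in simp)
    have [measurable]: "\<Delta> k \<in> borel_measurable (F ?t)" if "k \<in> K" for k
      unfolding \<Delta>_def using st that by (intro borel_measurable_diff \<beta>m) auto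
    show ?thesis unfolding step by measurable
  qed
  moreover have "(\<integral>\<^sup>+x. ennreal (L (Suc n) x) \<partial>M) \<le> 1"
  proof -
    let ?E = "{(\<lambda>x. \<beta> k t x - \<beta> k ?s x) -` A \<inter> space M | k t A. k \<noteq> 0 \<and> ?s \<le> t \<and> A \<in> sets borel}"
    have "(\<integral>\<^sup>+x. ennreal (L (Suc n) x) \<partial>M)
        = (\<integral>\<^sup>+x. ennreal (L n x) * ennreal (exp (\<Sum>k\<in>K. a k x * \<Delta> k x + c k * (\<Delta> k x)\<^sup>2
            - T / m * (c k + (a k x)\<^sup>2 / 2) / (1 - 2 * C * (T / m)))) \<partial>M)"
      unfolding step by (intro nn_integral_cong ennreal_mult) (auto simp: L_def)
    also have "\<dots> \<le> (\<integral>\<^sup>+x. ennreal (L n x) \<partial>M)"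
    proof (rule conditional_gaussian_step)
      show "subalgebra M (F ?s)" by (rule driving_noiseD(2)[OF N st(1)])
      show "indep_set (sets (F ?s)) (sigma_sets (space M) ?E)"
        using N st(1) unfolding driving_noise_def by blast
      show "?E \<subseteq> Pow (space M)" by auto
      show "\<Delta> k -` A \<inter> space M \<in> sigma_sets (space M) ?E" if "k \<in> K" "A \<in> sets borel" for k A
      proof (rule sigma_sets.Basic, rule CollectI, intro exI conjI)
        show "\<Delta> k -` A \<inter> space M = (\<lambda>x. \<beta> k ?t x - \<beta> k ?s x) -` A \<inter> space M"
          by (simp add: \<Delta>_def[abs_def])
      qed (use that K st in auto)
      show "indep_vars (\<lambda>_. borel) \<Delta> K"
        unfolding \<Delta>_def[abs_def] by (rule noise_increments_indep[OF N]) (use st K in auto)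
      show "(\<lambda>x. ennreal (L n x)) \<in> borel_measurable (F ?s)" using Ls by measurable
      show "distributed M lborel (\<Delta> k) (\<lambda>z. ennreal (normal_density 0 (sqrt (T / m)) z))" if "k \<in> K" for k
        using brownian_motionD(3)[OF driving_noiseD(4)[OF N, of k] st(1,2)] that K
        unfolding \<Delta>_def[abs_def] st(3) by auto
      show "0 \<le> c k \<and> 2 * c k * (T / m) \<le> 2 * C * (T / m)" if "k \<in> K" for k
        unfolding c_def using \<kappa>[OF st(4)] C[OF that st(4)] T m by (auto intro!: mult_right_mono divide_right_mono)
    qed (use K T m am q in auto)
    finally show ?thesis using Li by (rule order_trans)
  qed
  ultimately show ?case ..
qed

text \<open>Purely pathwise: each noise increment is expressed through the increments of X and of
  the drift integral, after which the sum is exactly a telescoping part plus Riemann sums. The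
  squared noise increments stay in the exponent and are absorbed by this identity.\<close>

lemma discrete_ito_limit:
  fixes X \<beta> d \<kappa> \<kappa>' :: "real \<Rightarrow> real"
  assumes T: "0 < T" and X: "continuous_on {0..T} X" and d: "continuous_on {0..T} d"
    and \<kappa>: "\<And>s. (\<kappa> has_real_derivative \<kappa>' s) (at s)" and \<kappa>': "continuous_on UNIV \<kappa>'"
    and eq: "\<And>t. t \<in> {0..T} \<Longrightarrow> X t = X 0 + integral {0..t} d + b * \<beta> t"
  shows "(\<lambda>m. \<Sum>j<m. ito_step \<kappa> b C T X \<beta> m j) \<longlonglongrightarrow> ito_exponent \<kappa> \<kappa>' b T X d" (is "?S \<longlonglongrightarrow> ?R")
proof -
  have T0: "0 \<le> T" using T by simp
  have \<kappa>c: "continuous_on A \<kappa>" for A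
    using \<kappa> by (intro continuous_at_imp_continuous_on) (auto intro: DERIV_isCont)
  have \<kappa>'c: "continuous_on {0..T} \<kappa>'" by (rule continuous_on_subset[OF \<kappa>']) auto
  define G where "G t = integral {0..t} d" for t
  have G: "continuous_on {0..T} G"
    unfolding G_def by (intro indefinite_integral_continuous_1 integrable_continuous_real d)
  have Gd: "integral {grid T m j..grid T m (Suc j)} d = G (grid T m (Suc j)) - G (grid T m j)" if "j < m" for m j
  proof -
    have "d integrable_on {0..grid T m (Suc j)}"
      using that grid_le[OF T0, of "Suc j" m]
      by (intro integrable_continuous_real continuous_on_subset[OF d]) auto
    then have "integral {0..grid T m j} d + integral {grid T m j..grid T m (Suc j)} d = integral {0..grid T m (Suc j)} d"
      using T0 by (intro Henstock_Kurzweil_Integration.integral_combine grid_nonneg grid_mono) auto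
    then show ?thesis by (simp add: G_def)
  qed
  have \<kappa>d: "integral {grid T m j..grid T m (Suc j)} \<kappa>' = \<kappa> (grid T m (Suc j)) - \<kappa> (grid T m j)" for m j
  proof (rule integral_unique, rule fundamental_theorem_of_calculus)
    show "grid T m j \<le> grid T m (Suc j)" by (rule grid_mono[OF T0]) simp
    show "(\<kappa> has_vector_derivative \<kappa>' s) (at s within {grid T m j..grid T m (Suc j)})" for s
      using \<kappa>[of s] by (auto simp: has_real_derivative_iff_has_vector_derivative intro: has_vector_derivative_at_within)
  qed
  have one: "integral {grid T m j..grid T m (Suc j)} (\<lambda>_. 1 :: real) = T / m" for m j
    using grid_mono[OF T0, of j "Suc j" m] by (simp add: grid_Suc)
  define S1 where "S1 m = (\<Sum>j<m. (X (grid T m (Suc j)))\<^sup>2 * integral {grid T m j..grid T m (Suc j)} \<kappa>')" for m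
  \<comment> \<open>The increment of \<open>G\<close> in the first factor vanishes on the diagonal,
    so it drops out in the limit.\<close>
  define S2 where "S2 m = (\<Sum>j<m. (2 * \<kappa> (grid T m j) * X (grid T m (Suc j)) - \<kappa> (grid T m j) * (G (grid T m (Suc j)) - G (grid T m j)))
      * integral {grid T m j..grid T m (Suc j)} d)" for m
  define S3 where "S3 m = (\<Sum>j<m. (\<kappa> (grid T m j) * b\<^sup>2 + 2 * (\<kappa> (grid T m j))\<^sup>2 * b\<^sup>2 * (X (grid T m j))\<^sup>2)
      * integral {grid T m j..grid T m (Suc j)} (\<lambda>_. 1))" for m
  have c1: "continuous_on ({0..T} \<times> {0..T}) (\<lambda>p. f (fst p))" "continuous_on ({0..T} \<times> {0..T}) (\<lambda>p. f (snd p))"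
    if "continuous_on {0..T} f" for f :: "real \<Rightarrow> real"
    by (rule continuous_on_compose2[OF that]; auto intro!: continuous_intros)+
  have l1: "S1 \<longlonglongrightarrow> integral {0..T} (\<lambda>s. (X s)\<^sup>2 * \<kappa>' s)"
    unfolding S1_def by (rule tendsto_grid_sum[OF T0 _ \<kappa>'c]) (auto simp: case_prod_beta intro!: continuous_intros c1 X)
  have l2: "S2 \<longlonglongrightarrow> integral {0..T} (\<lambda>s. (2 * \<kappa> s * X s - \<kappa> s * (G s - G s)) * d s)"
    unfolding S2_def by (rule tendsto_grid_sum[OF T0 _ d]) (auto simp: case_prod_beta intro!: continuous_intros c1 X \<kappa>c G)
  have l3: "S3 \<longlonglongrightarrow> integral {0..T} (\<lambda>s. (\<kappa> s * b\<^sup>2 + 2 * (\<kappa> s)\<^sup>2 * b\<^sup>2 * (X s)\<^sup>2) * 1)"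
    unfolding S3_def by (rule tendsto_grid_sum[OF T0]) (auto simp: case_prod_beta intro!: continuous_intros c1 X \<kappa>c)
  have "(\<lambda>m. 1 / (1 - 2 * C * (T / real m))) \<longlonglongrightarrow> 1 / (1 - 2 * C * 0)"
    by (intro tendsto_intros tendsto_divide_0[OF tendsto_const] filterlim_at_top_imp_at_infinity filterlim_real_sequentially) auto
  then have lq: "(\<lambda>m. 1 / (1 - 2 * C * (T / real m))) \<longlonglongrightarrow> 1" by simp
  have telescope: "(\<Sum>j<m. f (Suc j) - f j) = f m - f 0" for f :: "nat \<Rightarrow> real" and m
    by (induction m) auto
  have S: "?S m = \<kappa> T * (X T)\<^sup>2 - \<kappa> 0 * (X 0)\<^sup>2 - S1 m - S2 m - 1 / (1 - 2 * C * (T / real m)) * S3 m" if m: "0 < m" for m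
  proof -
    let ?g = "grid T m"
    have "?S m = (\<Sum>j<m. (\<kappa> (?g (Suc j)) * (X (?g (Suc j)))\<^sup>2 - \<kappa> (?g j) * (X (?g j))\<^sup>2)
        - (X (?g (Suc j)))\<^sup>2 * integral {?g j..?g (Suc j)} \<kappa>'
        - (2 * \<kappa> (?g j) * X (?g (Suc j)) - \<kappa> (?g j) * (G (?g (Suc j)) - G (?g j))) * integral {?g j..?g (Suc j)} d
        - 1 / (1 - 2 * C * (T / real m)) * ((\<kappa> (?g j) * b\<^sup>2 + 2 * (\<kappa> (?g j))\<^sup>2 * b\<^sup>2 * (X (?g j))\<^sup>2)
          * integral {?g j..?g (Suc j)} (\<lambda>_. 1)))"
    proof (rule sum.cong[OF refl])
      fix j assume "j \<in> {..<m}"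
      then have j: "j < m" by simp
      have gT: "?g j \<in> {0..T}" "?g (Suc j) \<in> {0..T}"
        using j T0 by (auto intro!: grid_nonneg grid_le)
      define k0 k1 x0 x1 D \<delta> where "k0 = \<kappa> (?g j)" "k1 = \<kappa> (?g (Suc j))" "x0 = X (?g j)" "x1 = X (?g (Suc j))"
        "D = G (?g (Suc j)) - G (?g j)" "\<delta> = \<beta> (?g (Suc j)) - \<beta> (?g j)"
      have x1: "x1 = x0 + D + b * \<delta>"
        unfolding k0_k1_x0_x1_D_\<delta>_def eq[OF gT(1)] eq[OF gT(2)] by (simp add: G_def algebra_simps)
      \<comment> \<open>Both sides equal k0 ((x1 - D)^2 - x0^2), since x1 - D = x0 + b
        \<delta>.\<close>
      have A: "2 * k0 * b * x0 * \<delta> + k0 * b\<^sup>2 * \<delta>\<^sup>2 = (k1 * x1\<^sup>2 - k0 * x0\<^sup>2) - x1\<^sup>2 * (k1 - k0) - (2 * k0 * x1 - k0 * D) * D"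
        unfolding x1 by (simp add: power2_eq_square algebra_simps)
      have Bq: "T / m * (k0 * b\<^sup>2 + (2 * k0 * b * x0)\<^sup>2 / 2) / (1 - 2 * C * (T / m))
          = 1 / (1 - 2 * C * (T / real m)) * ((k0 * b\<^sup>2 + 2 * k0\<^sup>2 * b\<^sup>2 * x0\<^sup>2) * (T / m))"
        by (simp add: power_mult_distrib mult_ac)
      show "ito_step \<kappa> b C T X \<beta> m j
        = (\<kappa> (?g (Suc j)) * (X (?g (Suc j)))\<^sup>2 - \<kappa> (?g j) * (X (?g j))\<^sup>2)
        - (X (?g (Suc j)))\<^sup>2 * integral {?g j..?g (Suc j)} \<kappa>'
        - (2 * \<kappa> (?g j) * X (?g (Suc j)) - \<kappa> (?g j) * (G (?g (Suc j)) - G (?g j))) * integral {?g j..?g (Suc j)} d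
        - 1 / (1 - 2 * C * (T / real m)) * ((\<kappa> (?g j) * b\<^sup>2 + 2 * (\<kappa> (?g j))\<^sup>2 * b\<^sup>2 * (X (?g j))\<^sup>2)
          * integral {?g j..?g (Suc j)} (\<lambda>_. 1))"
        unfolding ito_step_def Let_def \<kappa>d Gd[OF j] one unfolding k0_k1_x0_x1_D_\<delta>_def[symmetric] A Bq ..
    qed
    also have "\<dots> = \<kappa> T * (X T)\<^sup>2 - \<kappa> 0 * (X 0)\<^sup>2 - S1 m - S2 m - 1 / (1 - 2 * C * (T / real m)) * S3 m"
      using telescope[of "\<lambda>j. \<kappa> (?g j) * (X (?g j))\<^sup>2" m] m
      unfolding sum_subtractf S1_def S2_def S3_def sum_distrib_left by simp
    finally show ?thesis .
  qed
  have i: "f integrable_on {0..T}" if "continuous_on {0..T} f" for f :: "real \<Rightarrow> real"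
    by (rule integrable_continuous_real[OF that])
  have R: "?R = \<kappa> T * (X T)\<^sup>2 - \<kappa> 0 * (X 0)\<^sup>2 - integral {0..T} (\<lambda>s. (X s)\<^sup>2 * \<kappa>' s)
      - integral {0..T} (\<lambda>s. (2 * \<kappa> s * X s - \<kappa> s * (G s - G s)) * d s)
      - 1 * integral {0..T} (\<lambda>s. (\<kappa> s * b\<^sup>2 + 2 * (\<kappa> s)\<^sup>2 * b\<^sup>2 * (X s)\<^sup>2) * 1)"
  proof -
    have "integral {0..T} (\<lambda>s. \<kappa>' s * (X s)\<^sup>2 + 2 * \<kappa> s * X s * d s + \<kappa> s * b\<^sup>2 + 2 * (\<kappa> s)\<^sup>2 * b\<^sup>2 * (X s)\<^sup>2)
      = integral {0..T} (\<lambda>s. (X s)\<^sup>2 * \<kappa>' s + ((2 * \<kappa> s * X s - \<kappa> s * (G s - G s)) * d s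
          + (\<kappa> s * b\<^sup>2 + 2 * (\<kappa> s)\<^sup>2 * b\<^sup>2 * (X s)\<^sup>2) * 1))"
      by (simp add: algebra_simps)
    also have "\<dots> = integral {0..T} (\<lambda>s. (X s)\<^sup>2 * \<kappa>' s) + (integral {0..T} (\<lambda>s. (2 * \<kappa> s * X s - \<kappa> s * (G s - G s)) * d s)
      + integral {0..T} (\<lambda>s. (\<kappa> s * b\<^sup>2 + 2 * (\<kappa> s)\<^sup>2 * b\<^sup>2 * (X s)\<^sup>2) * 1))"
      by (subst Henstock_Kurzweil_Integration.integral_add, (intro i continuous_intros X d G \<kappa>c \<kappa>'c)+)+ (rule refl)
    finally show ?thesis by (simp add: ito_exponent_def)
  qed
  have "(\<lambda>m. \<kappa> T * (X T)\<^sup>2 - \<kappa> 0 * (X 0)\<^sup>2 - S1 m - S2 m - 1 / (1 - 2 * C * (T / real m)) * S3 m) \<longlonglongrightarrow> ?R"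
    unfolding R by (intro tendsto_diff tendsto_mult tendsto_const l1 l2 l3 lq)
  then show ?thesis
    by (rule Lim_transform_eventually) (use S in \<open>auto intro!: eventually_sequentiallyI[of 1]\<close>)
qed

text \<open>Fatou's lemma along refinements of the grid. \<open>G\<close>, the lower limit of the
  discrete exponentials, is measurable by construction, whereas the exponent contains time integrals
  of \<open>d\<close>.\<close>

lemma exponential_martingale_bound:
  fixes X d :: "int \<Rightarrow> real \<Rightarrow> 'w \<Rightarrow> real" and \<kappa> :: "real \<Rightarrow> real"
  assumes N: "driving_noise M F \<beta>" and K: "finite K" "K \<subseteq> - {0}"
    and X: "\<And>k t. k \<in> K \<Longrightarrow> 0 \<le> t \<Longrightarrow> X k t \<in> borel_measurable (F t)"
    and T: "0 < T" and \<kappa>: "\<And>s. s \<in> {0..T} \<Longrightarrow> 0 \<le> \<kappa> s"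
    and \<kappa>d: "\<And>s. (\<kappa> has_real_derivative \<kappa>' s) (at s)" and \<kappa>': "continuous_on UNIV \<kappa>'"
    and path: "AE x in M. \<forall>k\<in>K. continuous_on {0..T} (\<lambda>t. X k t x) \<and> continuous_on {0..T} (\<lambda>t. d k t x)
      \<and> (\<forall>t\<in>{0..T}. X k t x = X k 0 x + integral {0..t} (\<lambda>s. d k s x) + b k * \<beta> k t x)"
  obtains G where "G \<in> borel_measurable M" "(\<integral>\<^sup>+x. G x \<partial>M) \<le> 1"
    "AE x in M. ennreal (exp (\<Sum>k\<in>K. ito_exponent \<kappa> \<kappa>' (b k) T (\<lambda>s. X k s x) (\<lambda>s. d k s x))) = G x"
proof -
  interpret prob_space M by (rule driving_noiseD(1)[OF N])
  have T0: "0 \<le> T" using T by simp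
  have "continuous_on {0..T} \<kappa>"
    using \<kappa>d by (intro continuous_at_imp_continuous_on) (auto intro: DERIV_isCont)
  then have "bounded (\<kappa> ` {0..T})"
    by (intro compact_imp_bounded compact_continuous_image) auto
  then obtain C1 where C1: "0 < C1" "\<forall>y\<in>\<kappa> ` {0..T}. norm y \<le> C1" unfolding bounded_pos by blast
  define C where "C = C1 * (\<Sum>k\<in>K. (b k)\<^sup>2)"
  have C: "\<kappa> s * (b k)\<^sup>2 \<le> C" if "k \<in> K" "s \<in> {0..T}" for k s
    unfolding C_def
  proof (rule mult_mono)
    show "\<kappa> s \<le> C1" using C1 that by force
    show "(b k)\<^sup>2 \<le> (\<Sum>k\<in>K. (b k)\<^sup>2)" by (rule member_le_sum[OF that(1)]) (use K in auto)
  qed (use C1 in auto)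
  define L where "L m x = exp (\<Sum>j<m. \<Sum>k\<in>K. ito_step \<kappa> (b k) C T (\<lambda>t. X k t x) (\<lambda>t. \<beta> k t x) m j)" for m x
  have "(\<lambda>m. 2 * C * (T / real m)) \<longlonglongrightarrow> 2 * C * 0"
    by (intro tendsto_intros tendsto_divide_0[OF tendsto_const] filterlim_at_top_imp_at_infinity filterlim_real_sequentially)
  then have "\<forall>\<^sub>F m in sequentially. 2 * C * (T / real m) < 1" by (rule order_tendstoD) simp
  then obtain m0 where m0: "\<And>m. m \<ge> m0 \<Longrightarrow> 2 * C * (T / real m) < 1" unfolding eventually_sequentially by blast
  \<comment> \<open>The shift makes every grid fine enough for
    \<open>discrete_supermartingale\<close>; the successor also excludes
    \<open>m = 0\<close>.\<close>
  define L' where "L' i x = ennreal (L (i + Suc m0) x)" for i x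
  have disc: "L m \<in> borel_measurable M \<and> (\<integral>\<^sup>+x. ennreal (L m x) \<partial>M) \<le> 1" if "m > m0" for m
  proof -
    have m: "0 < m" "2 * C * (T / m) < 1" using that m0[of m] by auto
    have "L m \<in> borel_measurable (F (grid T m m)) \<and> (\<integral>\<^sup>+x. ennreal (L m x) \<partial>M) \<le> 1"
      unfolding L_def by (rule discrete_supermartingale[OF N K X T m(1) \<kappa> C m(2) order_refl]) auto
    moreover have "subalgebra M (F (grid T m m))" by (rule driving_noiseD(2)[OF N grid_nonneg[OF T0]])
    ultimately show ?thesis using measurable_from_subalg by blast
  qed
  have L'm [measurable]: "L' i \<in> borel_measurable M" for i
  proof -
    have "L (i + Suc m0) \<in> borel_measurable M" using disc[of "i + Suc m0"] by simp
    then show ?thesis unfolding L'_def by measurable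
  qed
  define G where "G x = liminf (\<lambda>i. L' i x)" for x
  show thesis
  proof (rule that)
    show "G \<in> borel_measurable M" unfolding G_def by measurable
    have "(\<integral>\<^sup>+x. G x \<partial>M) \<le> liminf (\<lambda>i. \<integral>\<^sup>+x. L' i x \<partial>M)"
      unfolding G_def by (rule nn_integral_liminf) measurable
    also have "\<dots> \<le> limsup (\<lambda>i. \<integral>\<^sup>+x. L' i x \<partial>M)" by (rule Liminf_le_Limsup) simp
    also have "\<dots> \<le> 1"
      by (rule Limsup_bounded) (use disc in \<open>auto simp: L'_def intro!: always_eventually\<close>)
    finally show "(\<integral>\<^sup>+x. G x \<partial>M) \<le> 1" .
    show "AE x in M. ennreal (exp (\<Sum>k\<in>K. ito_exponent \<kappa> \<kappa>' (b k) T (\<lambda>s. X k s x) (\<lambda>s. d k s x))) = G x"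
      using path
    proof eventually_elim
      case (elim x)
      let ?R = "\<lambda>k. ito_exponent \<kappa> \<kappa>' (b k) T (\<lambda>s. X k s x) (\<lambda>s. d k s x)"
      have "(\<lambda>m. \<Sum>k\<in>K. \<Sum>j<m. ito_step \<kappa> (b k) C T (\<lambda>t. X k t x) (\<lambda>t. \<beta> k t x) m j) \<longlonglongrightarrow> (\<Sum>k\<in>K. ?R k)"
      proof (rule tendsto_sum)
        fix k assume "k \<in> K"
        then show "(\<lambda>m. \<Sum>j<m. ito_step \<kappa> (b k) C T (\<lambda>t. X k t x) (\<lambda>t. \<beta> k t x) m j) \<longlonglongrightarrow> ?R k"
          using elim by (intro discrete_ito_limit[OF T _ _ \<kappa>d \<kappa>']) blast+
      qed
      then have "(\<lambda>m. L m x) \<longlonglongrightarrow> exp (\<Sum>k\<in>K. ?R k)"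
        unfolding L_def by (subst sum.swap) (rule tendsto_exp)
      then have "(\<lambda>m. ennreal (L m x)) \<longlonglongrightarrow> ennreal (exp (\<Sum>k\<in>K. ?R k))" by (intro tendsto_intros)
      then have "(\<lambda>i. L' i x) \<longlonglongrightarrow> ennreal (exp (\<Sum>k\<in>K. ?R k))"
        unfolding L'_def by (rule LIMSEQ_ignore_initial_segment)
      then show ?case unfolding G_def by (intro lim_imp_Liminf[symmetric]) simp_all
    qed
  qed
qed

section \<open>The exponential energy inequality\<close>

lemma noise_finite_summable:
  assumes "noise_finite b p"
  shows "(\<lambda>k. (b k)\<^sup>2) summable_on (- {0})"
proof (rule summable_on_comparison_test[OF assms[unfolded noise_finite_def]])
  fix k :: int assume "k \<in> - {0}"
  then have "1 \<le> \<bar>real_of_int k\<bar>" by auto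
  then have "1 * (b k)\<^sup>2 \<le> \<bar>real_of_int k\<bar> ^ (2 * p) * (b k)\<^sup>2"
    by (intro mult_right_mono one_le_power) auto
  then show "(b k)\<^sup>2 \<le> \<bar>real_of_int k\<bar> ^ (2 * p) * (b k)\<^sup>2" by simp
qed simp

lemma noise_sum_0: "noise_sum b 0 = (\<Sum>\<^sub>\<infinity>k\<in>- {0}. (b k)\<^sup>2)"
  by (simp add: noise_sum_def)

lemma noise_sum_0_nonneg: "0 \<le> noise_sum b 0"
  unfolding noise_sum_0 by (rule infsum_nonneg) simp

lemma sum_le_noise_sum:
  assumes "noise_finite b p" "finite J" "J \<subseteq> - {0}"
  shows "(\<Sum>k\<in>J. (b k)\<^sup>2) \<le> noise_sum b 0"
  unfolding noise_sum_0
  by (rule finite_sum_le_infsum[OF noise_finite_summable[OF assms(1)]]) (use assms in auto)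

text \<open>Collects all modes outside one null set. The initial value is read off at time 0, where
  the Brownian motions vanish almost surely.\<close>

lemma mild_solution_modes:
  assumes N: "driving_noise M F \<beta>" and w: "mild_solution M \<beta> b \<nu> (- 2) y w" and \<nu>: "0 < \<nu>"
  shows "AE x in M. continuous_on {0..} (\<lambda>t. w t x) \<and> w 0 x = y \<and>
    (\<forall>k. k \<noteq> 0 \<longrightarrow> (\<forall>t\<ge>0. fc (emb (w t x)) k = fc (emb y) k
      + integral {0..t} (\<lambda>s. fc (nonlin (- 2) (emb (w s x))) k - \<nu> * (real_of_int k)\<^sup>2 * fc (emb (w s x)) k)
      + b k * \<beta> k t x))"
proof -
  note B = driving_noiseD(4)[OF N]
  have "AE x in M. \<forall>k. k \<noteq> 0 \<longrightarrow> (\<forall>t\<ge>0. fc (emb (w t x)) k = fc (emb y) k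
      + integral {0..t} (\<lambda>s. fc (nonlin (- 2) (emb (w s x))) k - \<nu> * (real_of_int k)\<^sup>2 * fc (emb (w s x)) k)
      + b k * \<beta> k t x)"
    using mild_solution_mode[OF B w _ \<nu>] by (subst AE_all_countable) auto
  moreover have "AE x in M. \<forall>k. k \<noteq> 0 \<longrightarrow> \<beta> k 0 x = 0"
    using brownian_motionD(2)[OF B] by (subst AE_all_countable) auto
  moreover have "AE x in M. continuous_on {0..} (\<lambda>t. w t x)"
    using w unfolding mild_solution_def by blast
  ultimately show ?thesis
  proof eventually_elim
    case (elim x)
    have "w 0 x = y"
    proof (rule hdot1_eq_fcI)
      fix k :: int assume "k \<noteq> 0"
      then show "fc (emb (w 0 x)) k = fc (emb y) k" using elim(1)[rule_format, of k 0] elim(2) by simp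
    qed
    with elim show ?case by blast
  qed
qed

section \<open>Truncated energy balance and the limit of all modes\<close>

definition enstrophy_modes :: "nat \<Rightarrow> hdot1 \<Rightarrow> real" where
  "enstrophy_modes n v = (\<Sum>k\<in>modes n. (fc (emb v) k)\<^sup>2)"

definition dissipation_modes :: "nat \<Rightarrow> hdot1 \<Rightarrow> real" where
  "dissipation_modes n v = (\<Sum>k\<in>modes n. (real_of_int k)\<^sup>2 * (fc (emb v) k)\<^sup>2)"

lemma enstrophy_le_dissipation_modes: "enstrophy_modes n v \<le> dissipation_modes n v"
  unfolding enstrophy_modes_def dissipation_modes_def
proof (rule sum_mono)
  fix k assume "k \<in> modes n"
  then have "1 \<le> \<bar>real_of_int k\<bar>" by (auto simp: modes_def)
  then have "1 \<le> \<bar>real_of_int k\<bar>\<^sup>2" by (rule one_le_power)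
  then show "(fc (emb v) k)\<^sup>2 \<le> (real_of_int k)\<^sup>2 * (fc (emb v) k)\<^sup>2"
    using mult_right_mono[of 1 "\<bar>real_of_int k\<bar>\<^sup>2" "(fc (emb v) k)\<^sup>2"] by simp
qed

lemma tendsto_enstrophy_modes: "(\<lambda>n. enstrophy_modes n v) \<longlonglongrightarrow> (norm (emb v))\<^sup>2"
  unfolding enstrophy_modes_def parseval_hsp by (rule infsum_modes[OF summable_fc])

lemma tendsto_dissipation_modes: "(\<lambda>n. dissipation_modes n v) \<longlonglongrightarrow> (norm v)\<^sup>2"
  unfolding dissipation_modes_def norm_hdot1_sq using infsum_modes[OF summable_hdot1[of v]] by simp

lemma dissipation_modes_bound: "0 \<le> dissipation_modes n v" "dissipation_modes n v \<le> (norm v)\<^sup>2"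
  using sum_le_norm_hdot1_sq[of "modes n" v] modes_subset[of n]
  by (auto simp: dissipation_modes_def intro: sum_nonneg)

lemma enstrophy_modes_le: "enstrophy_modes n v \<le> (norm (emb v))\<^sup>2"
  unfolding enstrophy_modes_def parseval_hsp
  by (rule finite_sum_le_infsum[OF summable_fc]) (auto simp: modes_subset)

lemma continuous_on_dissipation_modes: "continuous_on A (dissipation_modes n)"
  unfolding dissipation_modes_def
  by (intro continuous_intros bounded_linear.continuous_on[OF bounded_linear_fc_emb])

lemma continuous_on_flux: "continuous_on A (flux n)"
  unfolding flux_def
  by (intro continuous_on_sum continuous_on_mult bounded_linear.continuous_on[OF bounded_linear_fc_emb]
      continuous_on_id continuous_on_fc_nonlin) (auto simp: modes_def)

text \<open>In the quadratic variation term every squared noise coefficient is replaced by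
  \<open>noise_sum b 0\<close> and one weight by its maximum \<open>c\<close>. By
  \<open>enstrophy_le_dissipation_modes\<close> this term and the growth
  \<open>\<delta> * \<kappa> s\<close> of the weight are then absorbed into the dissipation.\<close>

lemma energy_exponent_modes_ge:
  fixes W :: "real \<Rightarrow> hdot1"
  assumes b: "noise_finite b p" and T: "0 < T" and W: "continuous_on {0..T} W"
    and c: "0 \<le> c" and \<delta>: "0 \<le> \<delta>" and \<nu>: "2 * c * noise_sum b 0 + \<delta> \<le> 2 * \<nu>"
  defines "\<kappa> \<equiv> \<lambda>s. c * exp (- \<delta> * (T - s))"
  shows "c * enstrophy_modes n (W T) - c * exp (- \<delta> * T) * (norm (emb (W 0)))\<^sup>2 - noise_sum b 0 * integral {0..T} \<kappa>
      + (2 * \<nu> - \<delta> - 2 * c * noise_sum b 0) * integral {0..T} (\<lambda>s. \<kappa> s * dissipation_modes n (W s))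
      - 2 * integral {0..T} (\<lambda>s. \<kappa> s * flux n (W s))
    \<le> (\<Sum>k\<in>modes n. ito_exponent \<kappa> (\<lambda>s. \<delta> * \<kappa> s) (b k) T (\<lambda>s. fc (emb (W s)) k)
        (\<lambda>s. fc (nonlin (- 2) (emb (W s))) k - \<nu> * (real_of_int k)\<^sup>2 * fc (emb (W s)) k))"
proof -
  let ?B = "noise_sum b 0"
  define \<rho> where "\<rho> = 2 * \<nu> - \<delta> - 2 * c * ?B"
  have \<kappa>c: "continuous_on {0..T} \<kappa>" unfolding \<kappa>_def by (intro continuous_intros)
  have \<kappa>b: "0 \<le> \<kappa> s" "\<kappa> s \<le> c" if "s \<in> {0..T}" for s
    unfolding \<kappa>_def using c \<delta> that by (auto intro!: mult_left_le)
  have Xc: "continuous_on {0..T} (\<lambda>s. fc (emb (W s)) k)" for k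
    by (rule bounded_linear.continuous_on[OF bounded_linear_fc_emb W])
  have Nc: "continuous_on {0..T} (\<lambda>s. fc (nonlin (- 2) (emb (W s))) k)" if "k \<in> modes n" for k
    by (rule continuous_on_compose2[OF continuous_on_fc_nonlin[of k UNIV] W]) (use that in \<open>auto simp: modes_def\<close>)
  have Dc: "continuous_on {0..T} (\<lambda>s. dissipation_modes n (W s))"
    by (rule continuous_on_compose2[OF continuous_on_dissipation_modes W subset_UNIV])
  have Fc: "continuous_on {0..T} (\<lambda>s. flux n (W s))"
    by (rule continuous_on_compose2[OF continuous_on_flux W subset_UNIV])
  define I where "I k s = \<delta> * \<kappa> s * (fc (emb (W s)) k)\<^sup>2
        + 2 * \<kappa> s * fc (emb (W s)) k * (fc (nonlin (- 2) (emb (W s))) k - \<nu> * (real_of_int k)\<^sup>2 * fc (emb (W s)) k)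
        + \<kappa> s * (b k)\<^sup>2 + 2 * (\<kappa> s)\<^sup>2 * (b k)\<^sup>2 * (fc (emb (W s)) k)\<^sup>2" for k s
  have Ic: "continuous_on {0..T} (I k)" if "k \<in> modes n" for k
    unfolding I_def by (intro continuous_intros Xc Nc \<kappa>c that)
  have Isum: "(\<Sum>k\<in>modes n. I k s) \<le> ?B * \<kappa> s - \<rho> * (\<kappa> s * dissipation_modes n (W s)) + 2 * (\<kappa> s * flux n (W s))"
    if s: "s \<in> {0..T}" for s
  proof -
    define A where "A = (\<Sum>k\<in>modes n. (b k)\<^sup>2 * (fc (emb (W s)) k)\<^sup>2)"
    have "(b k)\<^sup>2 \<le> ?B" if "k \<in> modes n" for k
      using sum_le_noise_sum[OF b, of "{k}"] that by (auto simp: modes_def)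
    then have "A \<le> ?B * enstrophy_modes n (W s)"
      unfolding A_def enstrophy_modes_def sum_distrib_left by (intro sum_mono mult_right_mono) auto
    also have "\<dots> \<le> ?B * dissipation_modes n (W s)"
      by (intro mult_left_mono enstrophy_le_dissipation_modes noise_sum_0_nonneg)
    finally have A: "A \<le> ?B * dissipation_modes n (W s)" .
    have "(\<kappa> s)\<^sup>2 * A \<le> (\<kappa> s * c) * (?B * dissipation_modes n (W s))"
      unfolding power2_eq_square using \<kappa>b[OF s] A noise_sum_0_nonneg[of b] dissipation_modes_bound(1)[of n "W s"]
      by (intro mult_mono mult_left_mono mult_nonneg_nonneg) (auto simp: A_def intro!: sum_nonneg)
    moreover have "\<delta> * \<kappa> s * enstrophy_modes n (W s) \<le> \<delta> * \<kappa> s * dissipation_modes n (W s)"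
      using \<kappa>b[OF s] \<delta> by (intro mult_left_mono enstrophy_le_dissipation_modes) auto
    moreover have "\<kappa> s * (\<Sum>k\<in>modes n. (b k)\<^sup>2) \<le> \<kappa> s * ?B"
      using \<kappa>b[OF s] by (intro mult_left_mono sum_le_noise_sum[OF b]) (auto simp: modes_subset)
    moreover have "(\<Sum>k\<in>modes n. I k s) = \<delta> * \<kappa> s * enstrophy_modes n (W s) + 2 * \<kappa> s * flux n (W s)
        - 2 * \<nu> * \<kappa> s * dissipation_modes n (W s) + \<kappa> s * (\<Sum>k\<in>modes n. (b k)\<^sup>2) + 2 * ((\<kappa> s)\<^sup>2 * A)"
      unfolding I_def A_def enstrophy_modes_def dissipation_modes_def flux_def
        sum_distrib_left sum.distrib[symmetric] sum_subtractf[symmetric]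
      by (rule sum.cong[OF refl]) (simp add: algebra_simps power2_eq_square)
    ultimately have "(\<Sum>k\<in>modes n. I k s) \<le> \<delta> * \<kappa> s * dissipation_modes n (W s) + 2 * \<kappa> s * flux n (W s)
        - 2 * \<nu> * \<kappa> s * dissipation_modes n (W s) + \<kappa> s * ?B + 2 * ((\<kappa> s * c) * (?B * dissipation_modes n (W s)))"
      by linarith
    also have "\<dots> = ?B * \<kappa> s - \<rho> * (\<kappa> s * dissipation_modes n (W s)) + 2 * (\<kappa> s * flux n (W s))"
      by (simp add: \<rho>_def algebra_simps)
    finally show ?thesis .
  qed
  have int: "f integrable_on {0..T}" if "continuous_on {0..T} f" for f :: "real \<Rightarrow> real"
    by (rule integrable_continuous_real[OF that])
  have "(\<Sum>k\<in>modes n. integral {0..T} (I k)) = integral {0..T} (\<lambda>s. \<Sum>k\<in>modes n. I k s)"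
    by (rule integral_sum[symmetric]) (auto intro: int Ic)
  also have "\<dots> \<le> integral {0..T} (\<lambda>s. ?B * \<kappa> s - \<rho> * (\<kappa> s * dissipation_modes n (W s)) + 2 * (\<kappa> s * flux n (W s)))"
    by (rule integral_le) (intro int continuous_on_sum continuous_intros Ic \<kappa>c Dc Fc Isum; assumption)+
  also have "\<dots> = ?B * integral {0..T} \<kappa> - \<rho> * integral {0..T} (\<lambda>s. \<kappa> s * dissipation_modes n (W s))
      + 2 * integral {0..T} (\<lambda>s. \<kappa> s * flux n (W s))"
    by (simp add: Henstock_Kurzweil_Integration.integral_add Henstock_Kurzweil_Integration.integral_diff int continuous_intros \<kappa>c Dc Fc)
  finally have main: "(\<Sum>k\<in>modes n. integral {0..T} (I k)) \<le> \<dots>" .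
  have "\<kappa> 0 * enstrophy_modes n (W 0) \<le> c * exp (- \<delta> * T) * (norm (emb (W 0)))\<^sup>2"
    using c by (simp add: \<kappa>_def mult_left_mono enstrophy_modes_le)
  moreover have \<kappa>T: "\<kappa> T = c" by (simp add: \<kappa>_def)
  moreover have "(\<Sum>k\<in>modes n. \<kappa> T * (fc (emb (W T)) k)\<^sup>2 - \<kappa> 0 * (fc (emb (W 0)) k)\<^sup>2 - integral {0..T} (I k))
      = \<kappa> T * enstrophy_modes n (W T) - \<kappa> 0 * enstrophy_modes n (W 0) - (\<Sum>k\<in>modes n. integral {0..T} (I k))"
    by (simp add: sum_subtractf enstrophy_modes_def sum_distrib_left)
  ultimately show ?thesis
    using main unfolding ito_exponent_def I_def[abs_def] \<rho>_def \<kappa>T by linarith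
qed

text \<open>Dominated convergence in time, with the full dissipation as majorant for the truncated
  one and the cubic bound of \<open>flux_bound\<close> for the flux.\<close>

lemma energy_exponent_modes_tendsto:
  fixes W :: "real \<Rightarrow> hdot1" and \<kappa> :: "real \<Rightarrow> real"
  assumes W: "continuous_on {0..T} W" and \<kappa>: "continuous_on {0..T} \<kappa>"
  shows "(\<lambda>n. integral {0..T} (\<lambda>s. \<kappa> s * dissipation_modes n (W s))) \<longlonglongrightarrow> integral {0..T} (\<lambda>s. \<kappa> s * (norm (W s))\<^sup>2)"
    and "(\<lambda>n. integral {0..T} (\<lambda>s. \<kappa> s * flux n (W s))) \<longlonglongrightarrow> 0"
proof -
  have Dc: "continuous_on {0..T} (\<lambda>s. dissipation_modes n (W s))" for n
    by (rule continuous_on_compose2[OF continuous_on_dissipation_modes W subset_UNIV])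
  have Fc: "continuous_on {0..T} (\<lambda>s. flux n (W s))" for n
    by (rule continuous_on_compose2[OF continuous_on_flux W subset_UNIV])
  obtain C where C: "0 \<le> C" "\<And>n w. \<bar>flux n w\<bar> \<le> C * norm w ^ 3" using flux_bound by blast
  show "(\<lambda>n. integral {0..T} (\<lambda>s. \<kappa> s * dissipation_modes n (W s))) \<longlonglongrightarrow> integral {0..T} (\<lambda>s. \<kappa> s * (norm (W s))\<^sup>2)"
  proof (rule dominated_convergence(2))
    show "(\<lambda>s. \<kappa> s * dissipation_modes n (W s)) integrable_on {0..T}" for n
      by (intro integrable_continuous_real continuous_intros \<kappa> Dc)
    show "(\<lambda>s. \<bar>\<kappa> s\<bar> * (norm (W s))\<^sup>2) integrable_on {0..T}"
      by (intro integrable_continuous_real continuous_intros \<kappa> W)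
    show "norm (\<kappa> s * dissipation_modes n (W s)) \<le> \<bar>\<kappa> s\<bar> * (norm (W s))\<^sup>2" for n s
      using dissipation_modes_bound[of n "W s"] by (auto simp: abs_mult intro!: mult_left_mono)
    show "(\<lambda>n. \<kappa> s * dissipation_modes n (W s)) \<longlonglongrightarrow> \<kappa> s * (norm (W s))\<^sup>2" for s
      by (intro tendsto_intros tendsto_dissipation_modes)
  qed
  have "(\<lambda>n. integral {0..T} (\<lambda>s. \<kappa> s * flux n (W s))) \<longlonglongrightarrow> integral {0..T} (\<lambda>s. \<kappa> s * 0)"
  proof (rule dominated_convergence(2))
    show "(\<lambda>s. \<kappa> s * flux n (W s)) integrable_on {0..T}" for n
      by (intro integrable_continuous_real continuous_intros \<kappa> Fc)
    show "(\<lambda>s. \<bar>\<kappa> s\<bar> * (C * norm (W s) ^ 3)) integrable_on {0..T}"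
      by (intro integrable_continuous_real continuous_intros \<kappa> W)
    show "norm (\<kappa> s * flux n (W s)) \<le> \<bar>\<kappa> s\<bar> * (C * norm (W s) ^ 3)" for n s
      using C(2)[of n "W s"] by (auto simp: abs_mult intro!: mult_left_mono)
    show "(\<lambda>n. \<kappa> s * flux n (W s)) \<longlonglongrightarrow> \<kappa> s * 0" for s
      by (intro tendsto_intros tendsto_flux)
  qed
  then show "(\<lambda>n. integral {0..T} (\<lambda>s. \<kappa> s * flux n (W s))) \<longlonglongrightarrow> 0" by simp
qed

text \<open>\<open>B\<close> stands for \<open>noise_sum b 0\<close>. The weight reaches
  \<open>c\<close> at time \<open>T\<close>, hence starts at
  \<open>c * exp (- \<delta> * T)\<close>: a positive \<open>\<delta>\<close> damps the initial
  datum.\<close>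

definition energy_exponent :: "real \<Rightarrow> real \<Rightarrow> real \<Rightarrow> real \<Rightarrow> real \<Rightarrow> (real \<Rightarrow> hdot1) \<Rightarrow> real" where
  "energy_exponent \<nu> B c \<delta> T w = c * (norm (emb (w T)))\<^sup>2 - c * exp (- \<delta> * T) * (norm (emb (w 0)))\<^sup>2
    - B * integral {0..T} (\<lambda>s. c * exp (- \<delta> * (T - s)))
    + (2 * \<nu> - \<delta> - 2 * c * B) * integral {0..T} (\<lambda>s. c * exp (- \<delta> * (T - s)) * (norm (w s))\<^sup>2)"

text \<open>The lower bounds from \<open>energy_exponent_modes_ge\<close> converge to
  \<open>energy_exponent\<close> on almost every path. \<open>G\<close> is the lower limit of
  measurable versions of the finite-mode exponentials.\<close>

lemma energy_exponential_bound:
  assumes N: "driving_noise M F \<beta>" and \<nu>0: "0 < \<nu>" and b: "noise_finite b p"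
    and w: "mild_solution M \<beta> b \<nu> (- 2) y w" and ad: "adapted_to F w"
    and c: "0 \<le> c" and \<delta>: "0 \<le> \<delta>" and \<nu>: "2 * c * noise_sum b 0 + \<delta> \<le> 2 * \<nu>" and T: "0 \<le> T"
  obtains G where "G \<in> borel_measurable M" "(\<integral>\<^sup>+x. G x \<partial>M) \<le> 1"
    "AE x in M. ennreal (exp (energy_exponent \<nu> (noise_sum b 0) c \<delta> T (\<lambda>s. w s x))) \<le> G x"
proof (cases "T = 0")
  \<comment> \<open>The grid argument needs \<open>0 < T\<close>; at \<open>T = 0\<close> the
    exponent is 0.\<close>
  case True
  interpret prob_space M by (rule driving_noiseD(1)[OF N])
  show thesis
  proof (rule that[of "\<lambda>_. 1"])
    show "AE x in M. ennreal (exp (energy_exponent \<nu> (noise_sum b 0) c \<delta> T (\<lambda>s. w s x))) \<le> 1"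
      by (simp add: True energy_exponent_def)
  qed (simp_all add: emeasure_space_1)
next
  case False
  then have T: "0 < T" using T by simp
  define \<kappa> where "\<kappa> s = c * exp (- \<delta> * (T - s))" for s
  have \<kappa>d: "(\<kappa> has_real_derivative \<delta> * \<kappa> s) (at s)" for s
    unfolding \<kappa>_def[abs_def] by (auto intro!: derivative_eq_intros)
  have \<kappa>c: "continuous_on A \<kappa>" for A unfolding \<kappa>_def by (intro continuous_intros)
  define X where "X k t x = fc (emb (w t x)) k" for k t x
  define d where "d k s x = fc (nonlin (- 2) (emb (w s x))) k - \<nu> * (real_of_int k)\<^sup>2 * X k s x" for k s x
  define R where "R n x = (\<Sum>k\<in>modes n. ito_exponent \<kappa> (\<lambda>s. \<delta> * \<kappa> s) (b k) T (\<lambda>s. X k s x) (\<lambda>s. d k s x))" for n x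
  note modes = mild_solution_modes[OF N w \<nu>0]
  have "\<exists>G. G \<in> borel_measurable M \<and> (\<integral>\<^sup>+x. G x \<partial>M) \<le> 1 \<and> (AE x in M. ennreal (exp (R n x)) = G x)" for n
  proof -
    have Xm: "X k t \<in> borel_measurable (F t)" if "0 \<le> t" for k t
      unfolding X_def using ad that unfolding adapted_to_def
      by (intro borel_measurable_continuous_on[OF bounded_linear.continuous_on[OF bounded_linear_fc_emb continuous_on_id]]) auto
    have path: "AE x in M. \<forall>k\<in>modes n. continuous_on {0..T} (\<lambda>t. X k t x) \<and> continuous_on {0..T} (\<lambda>t. d k t x)
      \<and> (\<forall>t\<in>{0..T}. X k t x = X k 0 x + integral {0..t} (\<lambda>s. d k s x) + b k * \<beta> k t x)"
      using modes
    proof eventually_elim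
      case (elim x)
      have W: "continuous_on {0..T} (\<lambda>t. w t x)" using elim by (auto intro: continuous_on_subset)
      show ?case
      proof (intro ballI conjI)
        fix k assume "k \<in> modes n"
        then have k: "k \<noteq> 0" by (auto simp: modes_def)
        show Xc: "continuous_on {0..T} (\<lambda>t. X k t x)"
          unfolding X_def by (rule bounded_linear.continuous_on[OF bounded_linear_fc_emb W])
        show "continuous_on {0..T} (\<lambda>t. d k t x)"
          unfolding d_def
          by (intro continuous_intros Xc continuous_on_compose2[OF continuous_on_fc_nonlin[OF k, of UNIV] W subset_UNIV])
        show "X k t x = X k 0 x + integral {0..t} (\<lambda>s. d k s x) + b k * \<beta> k t x" if "t \<in> {0..T}" for t
          using elim k that by (auto simp: X_def d_def)
      qed
    qed
    have \<kappa>0: "0 \<le> \<kappa> s" for s using c by (simp add: \<kappa>_def)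
    have \<kappa>': "continuous_on UNIV (\<lambda>s. \<delta> * \<kappa> s)" by (intro continuous_intros \<kappa>c)
    show ?thesis
      unfolding R_def
      by (rule exponential_martingale_bound[where X = X and d = d and \<kappa> = \<kappa>, OF N finite_modes modes_subset Xm T \<kappa>0 \<kappa>d \<kappa>' path])
        (assumption | blast)+
  qed
  then obtain G where Gm [measurable]: "\<And>n. G n \<in> borel_measurable M" and G1: "\<And>n. (\<integral>\<^sup>+x. G n x \<partial>M) \<le> 1"
    and GR: "\<And>n. AE x in M. ennreal (exp (R n x)) = G n x" by metis
  show thesis
  proof (rule that[of "\<lambda>x. liminf (\<lambda>n. G n x)"])
    show "(\<lambda>x. liminf (\<lambda>n. G n x)) \<in> borel_measurable M" by measurable
    have "(\<integral>\<^sup>+x. liminf (\<lambda>n. G n x) \<partial>M) \<le> liminf (\<lambda>n. \<integral>\<^sup>+x. G n x \<partial>M)"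
      by (rule nn_integral_liminf) measurable
    also have "\<dots> \<le> limsup (\<lambda>n. \<integral>\<^sup>+x. G n x \<partial>M)" by (rule Liminf_le_Limsup) simp
    also have "\<dots> \<le> 1" by (rule Limsup_bounded) (use G1 in auto)
    finally show "(\<integral>\<^sup>+x. liminf (\<lambda>n. G n x) \<partial>M) \<le> 1" .
    have "AE x in M. \<forall>n. ennreal (exp (R n x)) = G n x" using GR by (subst AE_all_countable) auto
    with modes show "AE x in M. ennreal (exp (energy_exponent \<nu> (noise_sum b 0) c \<delta> T (\<lambda>s. w s x)))
      \<le> liminf (\<lambda>n. G n x)"
    proof eventually_elim
      case (elim x)
      have W: "continuous_on {0..T} (\<lambda>t. w t x)" using elim by (auto intro: continuous_on_subset)
      define E where "E n = c * enstrophy_modes n (w T x) - c * exp (- \<delta> * T) * (norm (emb (w 0 x)))\<^sup>2 - noise_sum b 0 * integral {0..T} \<kappa>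
        + (2 * \<nu> - \<delta> - 2 * c * noise_sum b 0) * integral {0..T} (\<lambda>s. \<kappa> s * dissipation_modes n (w s x))
        - 2 * integral {0..T} (\<lambda>s. \<kappa> s * flux n (w s x))" for n
      have ER: "E n \<le> R n x" for n
        unfolding E_def R_def X_def d_def \<kappa>_def[abs_def]
        by (rule energy_exponent_modes_ge[OF b T W c \<delta> \<nu>])
      let ?e = "energy_exponent \<nu> (noise_sum b 0) c \<delta> T (\<lambda>s. w s x)"
      have "E \<longlonglongrightarrow> c * (norm (emb (w T x)))\<^sup>2 - c * exp (- \<delta> * T) * (norm (emb (w 0 x)))\<^sup>2 - noise_sum b 0 * integral {0..T} \<kappa>
        + (2 * \<nu> - \<delta> - 2 * c * noise_sum b 0) * integral {0..T} (\<lambda>s. \<kappa> s * (norm (w s x))\<^sup>2) - 2 * 0"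
        unfolding E_def
        by (intro tendsto_intros tendsto_enstrophy_modes energy_exponent_modes_tendsto W \<kappa>c)
      then have "E \<longlonglongrightarrow> ?e" by (simp add: energy_exponent_def \<kappa>_def[abs_def])
      then have "(\<lambda>n. ennreal (exp (E n))) \<longlonglongrightarrow> ennreal (exp ?e)" by (intro tendsto_intros)
      then have "ennreal (exp ?e) = liminf (\<lambda>n. ennreal (exp (E n)))"
        by (intro lim_imp_Liminf[symmetric]) simp_all
      also have "\<dots> \<le> liminf (\<lambda>n. G n x)"
        using ER elim(2) by (intro Liminf_mono always_eventually allI) (metis ennreal_leI exp_le_cancel_iff)
      finally show ?case .
    qed
  qed
qed

section \<open>Exponential mixing\<close>

lemma measurable_norm_emb [measurable]: "(\<lambda>v. norm (emb v)) \<in> borel_measurable borel"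
  by (intro borel_measurable_continuous_onI continuous_intros bounded_linear.continuous_on[OF bounded_linear_emb])

lemma integral_exp_decay_le:
  assumes "0 < \<nu>" "0 \<le> c" "0 \<le> (T :: real)"
  shows "integral {0..T} (\<lambda>s. c * exp (- \<nu> * (T - s))) \<le> c / \<nu>"
proof -
  have "((\<lambda>s. c * exp (- \<nu> * (T - s))) has_integral c / \<nu> * exp (- \<nu> * (T - T)) - c / \<nu> * exp (- \<nu> * (T - 0))) {0..T}"
    by (rule fundamental_theorem_of_calculus[OF assms(3)])
      (use assms in \<open>auto intro!: derivative_eq_intros simp: has_real_derivative_iff_has_vector_derivative[symmetric]\<close>)
  then have "integral {0..T} (\<lambda>s. c * exp (- \<nu> * (T - s))) = c / \<nu> * exp (- \<nu> * (T - T)) - c / \<nu> * exp (- \<nu> * (T - 0))"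
    by (rule integral_unique)
  then show ?thesis using assms by simp
qed

text \<open>With \<open>\<delta> = \<nu>\<close> the dissipation has coefficient
  \<open>\<nu> - 2 * c * noise_sum b 0\<close>, which is nonnegative, so that term is dropped. The
  decaying weight keeps the noise contribution bounded in \<open>T\<close> and lets the influence of
  \<open>y\<close> fade, which the estimate for the invariant measure exploits.\<close>

lemma exponential_moment_bound:
  assumes N: "driving_noise M F \<beta>" and \<nu>: "0 < \<nu>" and b: "noise_finite b p"
    and w: "mild_solution M \<beta> b \<nu> (- 2) y w" and ad: "adapted_to F w"
    and c: "0 \<le> c" "2 * c * noise_sum b 0 \<le> \<nu>" and T: "0 \<le> T"
  shows "(\<integral>\<^sup>+x. ennreal (exp (c * (norm (emb (w T x)))\<^sup>2)) \<partial>M)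
    \<le> ennreal (exp (c * exp (- \<nu> * T) * (norm (emb y))\<^sup>2 + noise_sum b 0 * (c / \<nu>)))"
proof -
  let ?B = "noise_sum b 0"
  define K where "K = c * exp (- \<nu> * T) * (norm (emb y))\<^sup>2 + ?B * (c / \<nu>)"
  have "2 * c * ?B + \<nu> \<le> 2 * \<nu>" using c by simp
  then obtain G where G [measurable]: "G \<in> borel_measurable M" and G1: "(\<integral>\<^sup>+x. G x \<partial>M) \<le> 1"
    and le: "AE x in M. ennreal (exp (energy_exponent \<nu> ?B c \<nu> T (\<lambda>s. w s x))) \<le> G x"
    using energy_exponential_bound[OF N \<nu> b w ad c(1) less_imp_le[OF \<nu>] _ T] by blast
  have "AE x in M. ennreal (exp (c * (norm (emb (w T x)))\<^sup>2)) \<le> ennreal (exp K) * G x"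
    using le mild_solution_modes[OF N w \<nu>]
  proof eventually_elim
    case (elim x)
    have W: "continuous_on {0..T} (\<lambda>t. w t x)" using elim(2) by (auto intro: continuous_on_subset)
    have "0 \<le> integral {0..T} (\<lambda>s. c * exp (- \<nu> * (T - s)) * (norm (w s x))\<^sup>2)"
      by (rule Henstock_Kurzweil_Integration.integral_nonneg)
        (use c in \<open>auto intro!: integrable_continuous_real continuous_intros W\<close>)
    then have "0 \<le> (2 * \<nu> - \<nu> - 2 * c * ?B) * integral {0..T} (\<lambda>s. c * exp (- \<nu> * (T - s)) * (norm (w s x))\<^sup>2)"
      using c by (intro mult_nonneg_nonneg) auto
    moreover have "?B * integral {0..T} (\<lambda>s. c * exp (- \<nu> * (T - s))) \<le> ?B * (c / \<nu>)"
      by (intro mult_left_mono integral_exp_decay_le \<nu> c T noise_sum_0_nonneg)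
    moreover have "w 0 x = y" using elim(2) by blast
    ultimately have "c * (norm (emb (w T x)))\<^sup>2 \<le> K + energy_exponent \<nu> ?B c \<nu> T (\<lambda>s. w s x)" (is "_ \<le> K + ?e")
      unfolding K_def energy_exponent_def by simp
    then have "ennreal (exp (c * (norm (emb (w T x)))\<^sup>2)) \<le> ennreal (exp K * exp ?e)"
      by (intro ennreal_leI) (simp flip: exp_add)
    also have "\<dots> = ennreal (exp K) * ennreal (exp ?e)" by (simp add: ennreal_mult)
    also have "\<dots> \<le> ennreal (exp K) * G x" by (intro mult_left_mono elim(1)) simp
    finally show ?case .
  qed
  then have "(\<integral>\<^sup>+x. ennreal (exp (c * (norm (emb (w T x)))\<^sup>2)) \<partial>M) \<le> (\<integral>\<^sup>+x. ennreal (exp K) * G x \<partial>M)"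
    by (rule nn_integral_mono_AE)
  also have "\<dots> = ennreal (exp K) * (\<integral>\<^sup>+x. G x \<partial>M)" by (rule nn_integral_cmult) measurable
  also have "\<dots> \<le> ennreal (exp K) * 1" by (intro mult_left_mono G1) simp
  finally show ?thesis by (simp add: K_def)
qed

text \<open>With \<open>\<delta> = 0\<close> the final energy is dropped instead and the dissipation
  integral is kept, with coefficient \<open>2 * c * (\<nu> - c * noise_sum b 0)\<close>. The noise
  then costs growth linear in \<open>T\<close> in the exponent, which the contraction has to
  beat.\<close>

lemma dissipation_exponential_bound:
  assumes N: "driving_noise M F \<beta>" and \<nu>: "0 < \<nu>" and b: "noise_finite b p"
    and w: "mild_solution M \<beta> b \<nu> (- 2) y w" and ad: "adapted_to F w"
    and c: "0 \<le> c" "c * noise_sum b 0 \<le> \<nu>" and r: "r \<le> 2 * c * (\<nu> - c * noise_sum b 0)" and T: "0 \<le> T"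
  obtains G where "G \<in> borel_measurable M" "(\<integral>\<^sup>+x. G x \<partial>M) \<le> 1"
    "AE x in M. ennreal (exp (r * (LINT s:{0..T}|lborel. (norm (w s x))\<^sup>2)))
      \<le> ennreal (exp (c * (norm (emb y))\<^sup>2 + noise_sum b 0 * c * T)) * G x"
proof -
  let ?B = "noise_sum b 0"
  have "2 * c * ?B + 0 \<le> 2 * \<nu>" using c by simp
  then obtain G where G [measurable]: "G \<in> borel_measurable M" and G1: "(\<integral>\<^sup>+x. G x \<partial>M) \<le> 1"
    and le: "AE x in M. ennreal (exp (energy_exponent \<nu> ?B c 0 T (\<lambda>s. w s x))) \<le> G x"
    using energy_exponential_bound[OF N \<nu> b w ad c(1) order_refl _ T] by blast
  show thesis
  proof (rule that[OF G G1])
    show "AE x in M. ennreal (exp (r * (LINT s:{0..T}|lborel. (norm (w s x))\<^sup>2)))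
        \<le> ennreal (exp (c * (norm (emb y))\<^sup>2 + ?B * c * T)) * G x"
      using le mild_solution_modes[OF N w \<nu>]
    proof eventually_elim
      case (elim x)
      have W: "continuous_on {0..T} (\<lambda>t. w t x)" using elim(2) by (auto intro: continuous_on_subset)
      define J where "J = integral {0..T} (\<lambda>s. (norm (w s x))\<^sup>2)"
      have "set_integrable lborel {0..T} (\<lambda>s. (norm (w s x))\<^sup>2)"
        by (intro borel_integrable_atLeastAtMost' continuous_intros W)
      then have J: "(LINT s:{0..T}|lborel. (norm (w s x))\<^sup>2) = J"
        unfolding J_def by (rule set_borel_integral_eq_integral(2))
      have J0: "0 \<le> J"
        unfolding J_def by (rule Henstock_Kurzweil_Integration.integral_nonneg)
          (auto intro!: integrable_continuous_real continuous_intros W)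
      define e where "e = c * (norm (emb (w T x)))\<^sup>2 - c * (norm (emb y))\<^sup>2 - ?B * (c * T) + (2 * \<nu> - 2 * c * ?B) * (c * J)"
      have e: "ennreal (exp e) \<le> G x"
        using elim T by (simp add: e_def J_def energy_exponent_def mult.commute)
      have "r * J \<le> (2 * \<nu> - 2 * c * ?B) * (c * J)"
        using mult_right_mono[OF r J0] by (simp add: algebra_simps)
      moreover have "0 \<le> c * (norm (emb (w T x)))\<^sup>2" using c by simp
      ultimately have "r * J \<le> (c * (norm (emb y))\<^sup>2 + ?B * c * T) + e" unfolding e_def by simp
      then have "ennreal (exp (r * J)) \<le> ennreal (exp (c * (norm (emb y))\<^sup>2 + ?B * c * T) * exp e)"
        by (intro ennreal_leI) (simp flip: exp_add)
      also have "\<dots> = ennreal (exp (c * (norm (emb y))\<^sup>2 + ?B * c * T)) * ennreal (exp e)" by (simp add: ennreal_mult)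
      also have "\<dots> \<le> ennreal (exp (c * (norm (emb y))\<^sup>2 + ?B * c * T)) * G x" by (intro mult_left_mono e) simp
      finally show ?case unfolding J .
    qed
  qed
qed

text \<open>The factor \<open>4/7\<close> stands for any \<open>\<theta> < 1\<close> with \<open>2 \<theta> - \<theta>\<^sup>2 / 4 \<ge> 1\<close>, which is what the dissipation estimate
  needs; the decay rate is \<open>(1 - \<theta>) \<nu> / 8\<close>. The choice \<open>\<theta> = 1\<close> would lose the borderline case \<open>\<nu>\<^sup>3 = 8 C\<^sub>* B\<^sub>0\<close>.\<close>

lemma expected_distance_decay:
  fixes M :: "'w measure"
  assumes N: "driving_noise M F \<beta>" and \<nu>: "0 < \<nu>" and p: "1 < p" and b: "noise_finite b p"
    and C: "stability_constant TYPE('w) C" and small: "8 * C * noise_sum b 0 \<le> \<nu> ^ 3"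
    and w1: "mild_solution M \<beta> b \<nu> (- 2) y1 w1" "adapted_to F w1"
    and w2: "mild_solution M \<beta> b \<nu> (- 2) y2 w2" "adapted_to F w2" and t: "0 \<le> t"
  defines "c \<equiv> 4 / 7 * C / \<nu>\<^sup>2"
  shows "(\<integral>\<^sup>+x. ennreal (norm (emb (w1 t x) - emb (w2 t x))) \<partial>M)
    \<le> ennreal (norm (emb y1 - emb y2) * exp (- (3 * \<nu> / 56) * t)
        * ((exp (c * (norm (emb y1))\<^sup>2) + exp (c * (norm (emb y2))\<^sup>2)) / 2))"
proof -
  let ?B = "noise_sum b 0"
  have C0: "0 < C" using C by (simp add: stability_constant_def)
  have c0: "0 \<le> c" using C0 by (simp add: c_def)
  have cB: "c * ?B \<le> \<nu> / 14"
  proof -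
    have "c * ?B = (8 * C * ?B) / (14 * \<nu>\<^sup>2)" using \<nu> by (simp add: c_def field_simps)
    also have "\<dots> \<le> \<nu> ^ 3 / (14 * \<nu>\<^sup>2)" by (intro divide_right_mono small) simp
    also have "\<dots> = \<nu> / 14" using \<nu> by (simp add: power3_eq_cube power2_eq_square)
    finally show ?thesis .
  qed
  \<comment> \<open>With \<open>c * ?B \<le> \<nu> / 14\<close> the right-hand side is at least 2 *
    4/7 * 13/14 = 52/49 times \<open>C / \<nu>\<close>.\<close>
  have r: "C / \<nu> \<le> 2 * c * (\<nu> - c * ?B)"
  proof -
    have "C / \<nu> \<le> 2 * c * (\<nu> - \<nu> / 14)"
      using \<nu> C0 by (simp add: c_def power2_eq_square field_simps)
    also have "\<dots> \<le> 2 * c * (\<nu> - c * ?B)" using cB c0 by (intro mult_left_mono) auto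
    finally show ?thesis .
  qed
  have cB1: "c * ?B \<le> \<nu>" using cB \<nu> by simp
  obtain G1 where G1 [measurable]: "G1 \<in> borel_measurable M" "(\<integral>\<^sup>+x. G1 x \<partial>M) \<le> 1"
    "AE x in M. ennreal (exp (C / \<nu> * (LINT s:{0..t}|lborel. (norm (w1 s x))\<^sup>2)))
      \<le> ennreal (exp (c * (norm (emb y1))\<^sup>2 + ?B * c * t)) * G1 x"
    using dissipation_exponential_bound[OF N \<nu> b w1 c0 cB1 r t] by blast
  obtain G2 where G2 [measurable]: "G2 \<in> borel_measurable M" "(\<integral>\<^sup>+x. G2 x \<partial>M) \<le> 1"
    "AE x in M. ennreal (exp (C / \<nu> * (LINT s:{0..t}|lborel. (norm (w2 s x))\<^sup>2)))
      \<le> ennreal (exp (c * (norm (emb y2))\<^sup>2 + ?B * c * t)) * G2 x"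
    using dissipation_exponential_bound[OF N \<nu> b w2 c0 cB1 r t] by blast
  define n0 where "n0 = norm (emb y1 - emb y2)"
  define H where "H = n0 * exp (- (\<nu> * t / 8)) / 2"
  define E where "E y = exp (c * (norm (emb y))\<^sup>2 + ?B * c * t)" for y
  have H0: "0 \<le> H" by (simp add: H_def n0_def)
  have stab: "AE x in M. \<forall>t\<ge>0. (norm (emb (w1 t x) - emb (w2 t x)))\<^sup>2 \<le>
             (norm (emb y1 - emb y2))\<^sup>2 *
             exp (- (\<nu> * t / 4) + C / \<nu> *
               ((LINT s:{0..t}|lborel. (norm (w1 s x))\<^sup>2) + (LINT s:{0..t}|lborel. (norm (w2 s x))\<^sup>2)))"
    using C N \<nu> p b w1(1) w2(1) unfolding stability_constant_def by blast
  have "AE x in M. ennreal (norm (emb (w1 t x) - emb (w2 t x))) \<le> ennreal (H * E y1) * G1 x + ennreal (H * E y2) * G2 x"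
    using stab G1(3) G2(3)
  proof eventually_elim
    case (elim x)
    define J1 J2 where "J1 = (LINT s:{0..t}|lborel. (norm (w1 s x))\<^sup>2)" "J2 = (LINT s:{0..t}|lborel. (norm (w2 s x))\<^sup>2)"
    define u v where "u = exp (C / \<nu> * J1 / 2)" "v = exp (C / \<nu> * J2 / 2)"
    have uv: "u\<^sup>2 = exp (C / \<nu> * J1)" "v\<^sup>2 = exp (C / \<nu> * J2)"
      by (simp_all add: u_v_def flip: exp_double)
    have "(norm (emb (w1 t x) - emb (w2 t x)))\<^sup>2 \<le> n0\<^sup>2 * exp (- (\<nu> * t / 4) + C / \<nu> * (J1 + J2))"
      using elim(1) t unfolding J1_J2_def n0_def by blast
    also have "\<dots> = (n0 * exp (- (\<nu> * t / 8)) * (u * v))\<^sup>2"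
    proof -
      have "(exp (- (\<nu> * t / 8)))\<^sup>2 = exp (- (\<nu> * t / 4))" by (simp flip: exp_double)
      then show ?thesis
        by (simp only: power_mult_distrib uv exp_add distrib_left mult.assoc)
    qed
    finally have "norm (emb (w1 t x) - emb (w2 t x)) \<le> n0 * exp (- (\<nu> * t / 8)) * (u * v)"
      by (rule power2_le_imp_le) (simp add: n0_def u_v_def)
    \<comment> \<open>AM-GM separates the two dissipation integrals, so that each is controlled by
      the moment bound of its own solution although both share the noise.\<close>
    also have "\<dots> \<le> n0 * exp (- (\<nu> * t / 8)) * ((u\<^sup>2 + v\<^sup>2) / 2)"
      using sum_squares_bound[of u v] by (intro mult_left_mono) (auto simp: n0_def)
    also have "\<dots> = H * u\<^sup>2 + H * v\<^sup>2" by (simp add: H_def field_simps)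
    finally have "ennreal (norm (emb (w1 t x) - emb (w2 t x))) \<le> ennreal (H * u\<^sup>2 + H * v\<^sup>2)" by (rule ennreal_leI)
    also have "\<dots> = ennreal H * ennreal (u\<^sup>2) + ennreal H * ennreal (v\<^sup>2)" using H0 by (simp add: ennreal_mult)
    also have "\<dots> \<le> ennreal H * (ennreal (E y1) * G1 x) + ennreal H * (ennreal (E y2) * G2 x)"
      using elim(2,3) unfolding uv E_def J1_J2_def by (intro add_mono mult_left_mono) auto
    finally show ?case using H0 by (simp add: ennreal_mult E_def mult.assoc)
  qed
  then have "(\<integral>\<^sup>+x. ennreal (norm (emb (w1 t x) - emb (w2 t x))) \<partial>M)
      \<le> (\<integral>\<^sup>+x. ennreal (H * E y1) * G1 x + ennreal (H * E y2) * G2 x \<partial>M)"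
    by (rule nn_integral_mono_AE)
  also have "\<dots> = ennreal (H * E y1) * (\<integral>\<^sup>+x. G1 x \<partial>M) + ennreal (H * E y2) * (\<integral>\<^sup>+x. G2 x \<partial>M)"
    by (simp add: nn_integral_add nn_integral_cmult)
  also have "\<dots> \<le> ennreal (H * E y1) * 1 + ennreal (H * E y2) * 1"
    by (intro add_mono mult_left_mono G1 G2) auto
  also have "\<dots> = ennreal (H * (E y1 + E y2))"
    using H0 by (simp add: E_def distrib_left)
  also have "\<dots> \<le> ennreal (n0 * exp (- (3 * \<nu> / 56) * t) * ((exp (c * (norm (emb y1))\<^sup>2) + exp (c * (norm (emb y2))\<^sup>2)) / 2))"
  proof (rule ennreal_leI)
    \<comment> \<open>The surviving rate is 1/8 - 1/14 = 3/56 times \<nu>.\<close>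
    have "?B * c * t \<le> \<nu> / 14 * t" using cB t by (intro mult_right_mono) (auto simp: mult.commute)
    then have le: "exp (- (\<nu> * t / 8)) * exp (?B * c * t) \<le> exp (- (3 * \<nu> / 56) * t)"
      by (simp flip: exp_add)
    have "H * (E y1 + E y2) = (exp (- (\<nu> * t / 8)) * exp (?B * c * t)) * (n0 * ((exp (c * (norm (emb y1))\<^sup>2) + exp (c * (norm (emb y2))\<^sup>2)) / 2))"
      by (simp add: H_def E_def exp_add algebra_simps)
    also have "\<dots> \<le> exp (- (3 * \<nu> / 56) * t) * (n0 * ((exp (c * (norm (emb y1))\<^sup>2) + exp (c * (norm (emb y2))\<^sup>2)) / 2))"
      by (intro mult_right_mono le) (auto simp: n0_def)
    finally show "H * (E y1 + E y2) \<le> n0 * exp (- (3 * \<nu> / 56) * t) * ((exp (c * (norm (emb y1))\<^sup>2) + exp (c * (norm (emb y2))\<^sup>2)) / 2)"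
      by (simp add: mult_ac)
  qed
  finally show ?thesis by (simp add: n0_def)
qed

section \<open>Lipschitz functions and moments of the invariant measure\<close>

lemma lip_norm_lipschitz:
  assumes "L-lipschitz_on UNIV \<phi>"
  shows "(lip_norm \<phi>)-lipschitz_on UNIV \<phi>" "0 \<le> lip_norm \<phi>"
proof -
  let ?S = "{L. L-lipschitz_on UNIV \<phi>}"
  have ne: "?S \<noteq> {}" using assms by auto
  have nn: "0 \<le> L" if "L \<in> ?S" for L using that by (auto dest: lipschitz_on_nonneg)
  show nn': "0 \<le> lip_norm \<phi>" unfolding lip_norm_def by (rule cInf_greatest[OF ne nn])
  show "(lip_norm \<phi>)-lipschitz_on UNIV \<phi>"
  proof (rule lipschitz_onI[OF _ nn'])
    fix x y :: hsp
    show "dist (\<phi> x) (\<phi> y) \<le> lip_norm \<phi> * dist x y"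
    proof (cases "x = y")
      case False
      then have d: "0 < dist x y" by simp
      \<comment> \<open>A difference quotient lies below every Lipschitz constant, hence below their
        infimum, so the infimum is itself a Lipschitz constant.\<close>
      have "dist (\<phi> x) (\<phi> y) / dist x y \<le> lip_norm \<phi>"
        unfolding lip_norm_def
      proof (rule cInf_greatest[OF ne])
        fix L assume "L \<in> ?S"
        then have "dist (\<phi> x) (\<phi> y) \<le> L * dist x y" by (auto dest: lipschitz_onD)
        then show "dist (\<phi> x) (\<phi> y) / dist x y \<le> L" using d by (simp add: field_simps)
      qed
      then show ?thesis using d by (simp add: field_simps)
    qed simp
  qed
qed

text \<open>Converts exponential moments of the squared norm into first moments. The constant comes
  from 1 + r \<le> 2 + r^2 and from multiplying out (2 + 1 / c) (1 + c r^2).\<close>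

lemma one_plus_le_exp_sq:
  fixes r c :: real
  assumes "0 < c"
  shows "1 + r \<le> (2 + 1 / c) * exp (c * r\<^sup>2)"
proof -
  have "0 \<le> r\<^sup>2 - r + 1 / 4"
    using zero_le_power2[of "r - 1 / 2"] by (simp add: power2_diff power_divide)
  then have "1 + r \<le> 2 + r\<^sup>2" by linarith
  also have "\<dots> \<le> (2 + 1 / c) * (1 + c * r\<^sup>2)"
    using assms by (simp add: algebra_simps)
  also have "\<dots> \<le> (2 + 1 / c) * exp (c * r\<^sup>2)"
    using assms by (intro mult_left_mono exp_ge_add_one_self) auto
  finally show ?thesis .
qed

text \<open>Provides the integrability that comparing integrals of transitions requires. It is read
  off from the invariance identity, applied to a shifted function whose integral cannot be
  0.\<close>

lemma invariant_measure_integrable: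
  assumes \<mu>: "invariant_measure M W \<mu>" and M: "prob_space M" and W: "\<And>y. W y t \<in> borel_measurable M" and t: "0 \<le> t"
    and f: "f \<in> borel_measurable borel" "\<And>v. \<bar>f v\<bar> \<le> K"
  shows "integrable \<mu> f" "integrable \<mu> (transition M W t f)" "(\<integral>y. transition M W t f y \<partial>\<mu>) = (\<integral>y. f y \<partial>\<mu>)"
proof -
  interpret M: prob_space M by fact
  interpret \<mu>: prob_space \<mu> using \<mu> by (simp add: invariant_measure_def)
  have s\<mu>: "sets \<mu> = sets borel" using \<mu> by (simp add: invariant_measure_def)
  have fm: "f \<in> borel_measurable \<mu>" using f(1) by (simp add: measurable_cong_sets[OF s\<mu> refl])
  show fi: "integrable \<mu> f"
    by (rule \<mu>.integrable_const_bound[of _ K]) (use fm f(2) in auto)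
  have bd: "bounded (range f)"
    using f(2) by (auto simp: bounded_iff)
  show eq: "(\<integral>y. transition M W t f y \<partial>\<mu>) = (\<integral>y. f y \<partial>\<mu>)"
    using \<mu> t f(1) bd unfolding invariant_measure_def by blast
  have fW: "integrable M (\<lambda>x. f (W y t x))" for y
    by (rule M.integrable_const_bound[of _ K]) (use measurable_compose[OF W f(1)] f(2) in auto)
  \<comment> \<open>The integral of \<open>transition M W t g\<close> with \<open>g = f + K + 1 \<ge> 1\<close> is that of \<open>g\<close>, hence nonzero, which the
    junk value of the Bochner integral would not be.\<close>
  define g where "g v = f v + (K + 1)" for v
  have g1: "1 \<le> g v" for v using f(2)[of v] by (simp add: g_def abs_le_iff)
  have gb: "bounded (range g)"
    using f(2) by (intro boundedI[of _ "K + \<bar>K + 1\<bar>"]) (auto simp: g_def intro: order_trans[OF abs_triangle_ineq])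
  have gm: "g \<in> borel_measurable borel" unfolding g_def[abs_def] using f(1) by measurable
  have gi: "integrable \<mu> g" unfolding g_def[abs_def] using fi by simp
  have "1 = (\<integral>y. (1 :: real) \<partial>\<mu>)" using \<mu>.prob_space by simp
  also have "\<dots> \<le> (\<integral>y. g y \<partial>\<mu>)" by (intro integral_mono gi g1) auto
  also have "\<dots> = (\<integral>y. transition M W t g y \<partial>\<mu>)"
    using \<mu> t gm gb unfolding invariant_measure_def by metis
  finally have "integrable \<mu> (transition M W t g)"
    by (metis not_integrable_integral_eq not_one_le_zero)
  moreover have "transition M W t g = (\<lambda>y. transition M W t f y + (K + 1))"
    unfolding transition_def g_def using fW M.prob_space by simp
  ultimately have "integrable \<mu> (\<lambda>y. transition M W t f y + (K + 1))" by simp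
  then have "integrable \<mu> (\<lambda>y. transition M W t f y + (K + 1) - (K + 1))"
    by (intro Bochner_Integration.integrable_diff) auto
  then show "integrable \<mu> (transition M W t f)" by simp
qed

text \<open>Invariance is applied at time n to the truncated exponentials \<open>h i\<close>. By
  \<open>exponential_moment_bound\<close> the dependence on the starting point fades as n grows, so
  every truncated integral is at most \<open>exp D\<close>; Fatou's lemma then removes the
  truncation.\<close>

lemma invariant_exponential_moment:
  assumes N: "driving_noise M F \<beta>" and \<nu>: "0 < \<nu>" and b: "noise_finite b p"
    and W: "\<And>y. mild_solution M \<beta> b \<nu> (- 2) y (W y)" "\<And>y. adapted_to F (W y)"
    and \<mu>: "invariant_measure M W \<mu>" and c: "0 \<le> c" "2 * c * noise_sum b 0 \<le> \<nu>"
  shows "integrable \<mu> (\<lambda>v. exp (c * (norm (emb v))\<^sup>2))"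
proof -
  interpret M: prob_space M by (rule driving_noiseD(1)[OF N])
  interpret \<mu>: prob_space \<mu> using \<mu> by (simp add: invariant_measure_def)
  have s\<mu>: "sets \<mu> = sets borel" using \<mu> by (simp add: invariant_measure_def)
  note [measurable_cong] = s\<mu>
  have Wm: "W y t \<in> borel_measurable M" if "0 \<le> t" for y t
    using W(1)[of y] that by (simp add: mild_solution_def)
  define D where "D = noise_sum b 0 * (c / \<nu>)"
  define h where "h i v = exp (c * (min (norm (emb v)) (real i))\<^sup>2)" for i :: nat and v
  have hm [measurable]: "h i \<in> borel_measurable borel" for i unfolding h_def by measurable
  have h_le: "h i v \<le> exp (c * (real i)\<^sup>2)" for i v
    unfolding h_def using c by (auto intro!: mult_left_mono power_mono)
  have hb: "\<bar>h i v\<bar> \<le> exp (c * (real i)\<^sup>2)" for i v using h_le[of i v] by (simp add: h_def)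
  have int_h: "(\<integral>v. h i v \<partial>\<mu>) \<le> exp D" for i
  proof -
    \<comment> \<open>The first entry of the minimum keeps the bound integrable before \<mu> is
      known to have exponential moments, and dominates the limit in \<open>n\<close>.\<close>
    define q where "q n v = min (exp (c * (real i)\<^sup>2)) (exp (c * exp (- \<nu> * real n) * (norm (emb v))\<^sup>2 + D))" for n :: nat and v
    have qm [measurable]: "q n \<in> borel_measurable borel" for n unfolding q_def by measurable
    have qb: "norm (q n v) \<le> exp (c * (real i)\<^sup>2)" for n v by (simp add: q_def)
    have le: "(\<integral>v. h i v \<partial>\<mu>) \<le> (\<integral>v. q n v \<partial>\<mu>)" for n
    proof -
      have n: "0 \<le> real n" by simp
      note inv = invariant_measure_integrable[OF \<mu> M.prob_space_axioms Wm[OF n] n hm hb]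
      have "transition M W (real n) (h i) y \<le> q n y" for y
      proof -
        have i1: "integrable M (\<lambda>x. h i (W y (real n) x))"
          by (rule M.integrable_const_bound[of _ "exp (c * (real i)\<^sup>2)"])
            (use measurable_compose[OF Wm[OF n] hm] hb in auto)
        have "transition M W (real n) (h i) y \<le> (\<integral>x. exp (c * (real i)\<^sup>2) \<partial>M)"
          unfolding transition_def by (intro integral_mono i1 h_le) auto
        moreover have "transition M W (real n) (h i) y \<le> exp (c * exp (- \<nu> * real n) * (norm (emb y))\<^sup>2 + D)"
        proof -
          have "ennreal (transition M W (real n) (h i) y) = (\<integral>\<^sup>+x. ennreal (h i (W y (real n) x)) \<partial>M)"
            unfolding transition_def by (rule nn_integral_eq_integral[symmetric, OF i1]) (simp add: h_def)
          also have "\<dots> \<le> (\<integral>\<^sup>+x. ennreal (exp (c * (norm (emb (W y (real n) x)))\<^sup>2)) \<partial>M)"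
            unfolding h_def using c by (intro nn_integral_mono ennreal_leI) (auto intro!: mult_left_mono power_mono)
          also have "\<dots> \<le> ennreal (exp (c * exp (- \<nu> * real n) * (norm (emb y))\<^sup>2 + D))"
            unfolding D_def by (rule exponential_moment_bound[OF N \<nu> b W c n])
          finally show ?thesis by (simp add: ennreal_le_iff)
        qed
        ultimately show ?thesis by (simp add: q_def M.prob_space)
      qed
      then have "(\<integral>y. transition M W (real n) (h i) y \<partial>\<mu>) \<le> (\<integral>y. q n y \<partial>\<mu>)"
        by (intro integral_mono inv \<mu>.integrable_const_bound[of _ "exp (c * (real i)\<^sup>2)"]) (use qb in auto)
      then show ?thesis by (simp add: inv)
    qed
    have "(\<lambda>n. \<integral>v. q n v \<partial>\<mu>) \<longlonglongrightarrow> (\<integral>v. min (exp (c * (real i)\<^sup>2)) (exp D) \<partial>\<mu>)"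
    proof (rule integral_dominated_convergence[where w = "\<lambda>_. exp (c * (real i)\<^sup>2)"])
      show "AE v in \<mu>. (\<lambda>n. q n v) \<longlonglongrightarrow> min (exp (c * (real i)\<^sup>2)) (exp D)"
      proof (rule AE_I2)
        fix v
        have "(\<lambda>n. exp (- \<nu> * real n)) \<longlonglongrightarrow> 0"
          using \<nu> by (intro filterlim_compose[OF exp_at_bot] filterlim_tendsto_neg_mult_at_bot[OF tendsto_const] filterlim_real_sequentially) auto
        then have "(\<lambda>n. q n v) \<longlonglongrightarrow> min (exp (c * (real i)\<^sup>2)) (exp (c * 0 * (norm (emb v))\<^sup>2 + D))"
          unfolding q_def by (intro tendsto_intros)
        then show "(\<lambda>n. q n v) \<longlonglongrightarrow> min (exp (c * (real i)\<^sup>2)) (exp D)" by simp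
      qed
      show "AE v in \<mu>. norm (q n v) \<le> exp (c * (real i)\<^sup>2)" for n using qb by simp
    qed (auto simp: measurable_cong_sets[OF s\<mu> refl])
    then have "(\<integral>v. h i v \<partial>\<mu>) \<le> (\<integral>v. min (exp (c * (real i)\<^sup>2)) (exp D) \<partial>\<mu>)"
      by (rule LIMSEQ_le_const) (use le in blast)
    also have "\<dots> \<le> exp D" by (simp add: \<mu>.prob_space)
    finally show ?thesis .
  qed
  have "(\<integral>\<^sup>+v. ennreal (exp (c * (norm (emb v))\<^sup>2)) \<partial>\<mu>) = (\<integral>\<^sup>+v. liminf (\<lambda>i. ennreal (h i v)) \<partial>\<mu>)"
  proof (rule nn_integral_cong)
    fix v
    obtain n where n: "norm (emb v) \<le> real n" using real_arch_simple by blast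
    have "(\<lambda>i. ennreal (h i v)) \<longlonglongrightarrow> ennreal (exp (c * (norm (emb v))\<^sup>2))"
      by (intro tendsto_eventually eventually_sequentiallyI[of n]) (use n in \<open>simp add: h_def min_def\<close>)
    then show "ennreal (exp (c * (norm (emb v))\<^sup>2)) = liminf (\<lambda>i. ennreal (h i v))"
      by (intro lim_imp_Liminf[symmetric]) simp_all
  qed
  also have "\<dots> \<le> liminf (\<lambda>i. \<integral>\<^sup>+v. ennreal (h i v) \<partial>\<mu>)"
    by (rule nn_integral_liminf) measurable
  also have "\<dots> \<le> limsup (\<lambda>i. \<integral>\<^sup>+v. ennreal (h i v) \<partial>\<mu>)" by (rule Liminf_le_Limsup) simp
  also have "\<dots> \<le> ennreal (exp D)"
  proof (rule Limsup_bounded, rule always_eventually, rule allI)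
    fix i
    have "integrable \<mu> (h i)"
      by (rule \<mu>.integrable_const_bound[of _ "exp (c * (real i)\<^sup>2)"]) (use hb in auto)
    then have "(\<integral>\<^sup>+v. ennreal (h i v) \<partial>\<mu>) = ennreal (\<integral>v. h i v \<partial>\<mu>)"
      by (rule nn_integral_eq_integral) (simp add: h_def)
    then show "(\<integral>\<^sup>+v. ennreal (h i v) \<partial>\<mu>) \<le> ennreal (exp D)" using int_h by (simp add: ennreal_leI)
  qed
  also have "\<dots> < \<infinity>" by simp
  finally show ?thesis by (intro integrableI_nonneg) auto
qed

lemma integrable_norm_of_exponential:
  fixes f :: "'a \<Rightarrow> hdot1"
  assumes f: "f \<in> borel_measurable M" and c: "0 < c" and e: "integrable M (\<lambda>x. exp (c * (norm (emb (f x)))\<^sup>2))"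
  shows "integrable M (\<lambda>x. norm (emb (f x)))"
proof (rule Bochner_Integration.integrable_bound)
  show "integrable M (\<lambda>x. (2 + 1 / c) * exp (c * (norm (emb (f x)))\<^sup>2))" using e by simp
  show "(\<lambda>x. norm (emb (f x))) \<in> borel_measurable M" by (rule measurable_compose[OF f measurable_norm_emb])
  have "norm (emb (f x)) \<le> (2 + 1 / c) * exp (c * (norm (emb (f x)))\<^sup>2)" for x
    using one_plus_le_exp_sq[OF c, of "norm (emb (f x))"] by simp
  then show "AE x in M. norm (norm (emb (f x))) \<le> norm ((2 + 1 / c) * exp (c * (norm (emb (f x)))\<^sup>2))"
    using c by simp
qed

lemma (in finite_measure) integrable_lipschitz_emb:
  assumes \<phi>: "L-lipschitz_on UNIV (\<phi> :: hsp \<Rightarrow> real)" and f: "f \<in> borel_measurable M"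
    and i: "integrable M (\<lambda>x. norm (emb (f x)))"
  shows "integrable M (\<lambda>x. \<phi> (emb (f x)))"
proof (rule Bochner_Integration.integrable_bound)
  show "integrable M (\<lambda>x. \<bar>\<phi> 0\<bar> + L * norm (emb (f x)))" using i by simp
  have "(\<lambda>v. \<phi> (emb v)) \<in> borel_measurable borel"
    by (intro borel_measurable_continuous_onI continuous_on_compose2[OF lipschitz_on_continuous_on[OF \<phi>]]
        bounded_linear.continuous_on[OF bounded_linear_emb]) auto
  then show "(\<lambda>x. \<phi> (emb (f x))) \<in> borel_measurable M" by (rule measurable_compose[OF f])
  have "\<bar>\<phi> u\<bar> \<le> \<bar>\<phi> 0\<bar> + L * norm u" for u
    using lipschitz_onD[OF \<phi>, of u 0] by (simp add: dist_real_def)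
  then show "AE x in M. norm (\<phi> (emb (f x))) \<le> norm (\<bar>\<phi> 0\<bar> + L * norm (emb (f x)))"
    by (intro AE_I2) (auto intro: order_trans[OF _ abs_ge_self])
qed

text \<open>\<open>invariant_measure\<close> speaks of bounded functions only. Truncating the values
  of a Lipschitz function makes it bounded without increasing its Lipschitz constant.\<close>

definition truncate :: "real \<Rightarrow> real \<Rightarrow> real" where
  "truncate n r = max (- n) (min n r)"

lemma truncate_bounds: "0 \<le> n \<Longrightarrow> \<bar>truncate n r\<bar> \<le> n" "0 \<le> n \<Longrightarrow> \<bar>truncate n r\<bar> \<le> \<bar>r\<bar>"
  and truncate_contraction: "\<bar>truncate n r - truncate n s\<bar> \<le> \<bar>r - s\<bar>"
  and truncate_eq: "\<bar>r\<bar> \<le> n \<Longrightarrow> truncate n r = r"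
  by (auto simp: truncate_def min_def max_def)

lemma tendsto_truncate: "(\<lambda>n. truncate (real n) r) \<longlonglongrightarrow> r"
proof -
  obtain n where "\<bar>r\<bar> \<le> real n" using real_arch_simple by blast
  then show ?thesis
    by (intro tendsto_eventually eventually_sequentiallyI[of n]) (simp add: truncate_eq)
qed

lemma borel_measurable_truncate [measurable]: "truncate n \<in> borel_measurable borel"
  unfolding truncate_def[abs_def] by measurable

lemma integral_truncate_tendsto:
  assumes "integrable M f"
  shows "(\<lambda>n. \<integral>x. truncate (real n) (f x) \<partial>M) \<longlonglongrightarrow> (\<integral>x. f x \<partial>M)"
proof (rule integral_dominated_convergence[where w = "\<lambda>x. \<bar>f x\<bar>"])
  show "(\<lambda>x. truncate (real n) (f x)) \<in> borel_measurable M" for n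
    by (rule measurable_compose[OF _ borel_measurable_truncate]) (use assms in simp)
qed (use assms in \<open>auto simp: tendsto_truncate truncate_bounds\<close>)

theorem corollary4p3p1:
  fixes M :: "'w measure" and F :: "real \<Rightarrow> 'w measure"
    and \<beta> :: "int \<Rightarrow> real \<Rightarrow> 'w \<Rightarrow> real" and b :: "int \<Rightarrow> real"
    and \<nu> Cstar :: real and p :: nat
    and W :: "hdot1 \<Rightarrow> real \<Rightarrow> 'w \<Rightarrow> hdot1" and \<mu> :: "hdot1 measure"
  assumes "driving_noise M F \<beta>"
    and "\<nu> > 0"
    and "p > 1" and "noise_finite b p"
    and "stability_constant TYPE('w) Cstar"
    and "\<nu> ^ 3 \<ge> 8 * Cstar * noise_sum b 0"
    and "\<And>y. mild_solution M \<beta> b \<nu> (- 2) y (W y)"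
    and "\<And>y. adapted_to F (W y)"
    and "invariant_measure M W \<mu>"
  shows "\<exists>lam>0. \<forall>y. \<exists>C. \<forall>\<phi> :: hsp \<Rightarrow> real. (\<exists>L. L-lipschitz_on UNIV \<phi>) \<longrightarrow>
    (\<forall>t\<ge>0.
       integrable M (\<lambda>x. \<phi> (emb (W y t x))) \<and> integrable \<mu> (\<lambda>v. \<phi> (emb v)) \<and>
       \<bar>transition M W t (\<lambda>v. \<phi> (emb v)) y - (\<integral>v. \<phi> (emb v) \<partial>\<mu>)\<bar>
         \<le> C * lip_norm \<phi> * exp (- lam * t))"
proof -
  note N = assms(1) and \<nu> = assms(2) and p = assms(3) and b = assms(4) and C = assms(5) and small = assms(6)
    and W = assms(7,8) and \<mu> = assms(9)
  interpret M: prob_space M by (rule driving_noiseD(1)[OF N])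
  interpret \<mu>: prob_space \<mu> using \<mu> by (simp add: invariant_measure_def)
  have s\<mu>: "sets \<mu> = sets borel" using \<mu> by (simp add: invariant_measure_def)
  note [measurable_cong] = s\<mu>
  have Wm [measurable]: "W y t \<in> borel_measurable M" if "0 \<le> t" for y t
    using W(1)[of y] that by (simp add: mild_solution_def)
  define c where "c = 4 / 7 * Cstar / \<nu>\<^sup>2"
  have C0: "0 < Cstar" using C by (simp add: stability_constant_def)
  have c0: "0 < c" using C0 \<nu> by (simp add: c_def)
  \<comment> \<open>The doubled exponent is the one under which \<open>R y v\<close> is integrable
    in \<open>v\<close>: one factor exp(c |v|^2) comes from the contraction estimate, the other
    absorbs the linear growth of the distance.\<close>
  have c2: "2 * (2 * c) * noise_sum b 0 \<le> \<nu>"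
  proof -
    have "2 * (2 * c) * noise_sum b 0 = 2 / 7 * (8 * Cstar * noise_sum b 0) / \<nu>\<^sup>2" by (simp add: c_def)
    also have "\<dots> \<le> 2 / 7 * \<nu> ^ 3 / \<nu>\<^sup>2" by (intro divide_right_mono mult_left_mono small) auto
    also have "\<dots> = 2 / 7 * \<nu>" using \<nu> by (simp add: power3_eq_cube power2_eq_square)
    finally show ?thesis using \<nu> by simp
  qed
  define R where "R y v = norm (emb y - emb v) * ((exp (c * (norm (emb y))\<^sup>2) + exp (c * (norm (emb v))\<^sup>2)) / 2)" for y v
  define lam where "lam = 3 * \<nu> / 56"
  have lam: "0 < lam" using \<nu> by (simp add: lam_def)
  have R0: "0 \<le> R y v" for y v by (simp add: R_def add_nonneg_nonneg)
  have \<mu>exp: "integrable \<mu> (\<lambda>v. exp (2 * c * (norm (emb v))\<^sup>2))"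
    by (rule invariant_exponential_moment[OF N \<nu> b W \<mu>]) (use c0 c2 in auto)
  have \<mu>norm: "integrable \<mu> (\<lambda>v. norm (emb v))"
    by (rule integrable_norm_of_exponential[OF _ _ \<mu>exp]) (use c0 in auto)
  have Rm [measurable]: "R y \<in> borel_measurable borel" for y
    unfolding R_def[abs_def]
    by (intro borel_measurable_continuous_onI continuous_intros bounded_linear.continuous_on[OF bounded_linear_emb]) auto
  have Ri: "integrable \<mu> (R y)" for y
  proof (rule Bochner_Integration.integrable_bound)
    define K where "K = (1 + norm (emb y)) * exp (c * (norm (emb y))\<^sup>2) * (2 + 1 / c)"
    show "integrable \<mu> (\<lambda>v. K * exp (2 * c * (norm (emb v))\<^sup>2))" using \<mu>exp by simp
    have "R y v \<le> K * exp (2 * c * (norm (emb v))\<^sup>2)" for v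
    proof -
      define A B where "A = exp (c * (norm (emb y))\<^sup>2)" "B = exp (c * (norm (emb v))\<^sup>2)"
      have AB: "1 \<le> A" "1 \<le> B" using c0 by (auto simp: A_B_def)
      have "A + B \<le> 2 * (A * B)"
      proof -
        have "A * 1 \<le> A * B" "1 * B \<le> A * B"
          by (intro mult_left_mono mult_right_mono; use AB in linarith)+
        then show ?thesis by simp
      qed
      then have 1: "(A + B) / 2 \<le> A * B" by simp
      have "norm (emb y - emb v) \<le> norm (emb y) + norm (emb v)" by (rule norm_triangle_ineq4)
      also have "\<dots> \<le> (1 + norm (emb y)) * (1 + norm (emb v))" by (simp add: algebra_simps)
      also have "\<dots> \<le> (1 + norm (emb y)) * ((2 + 1 / c) * B)"
        unfolding A_B_def by (intro mult_left_mono one_plus_le_exp_sq c0) auto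
      finally have "R y v \<le> ((1 + norm (emb y)) * ((2 + 1 / c) * B)) * (A * B)"
        unfolding R_def A_B_def[symmetric] using 1 AB c0 by (intro mult_mono) (auto intro!: mult_nonneg_nonneg add_nonneg_nonneg)
      also have "\<dots> = K * (B * B)" by (simp add: K_def A_B_def)
      also have "B * B = exp (2 * c * (norm (emb v))\<^sup>2)" by (simp add: A_B_def flip: exp_add)
      finally show ?thesis .
    qed
    then show "AE v in \<mu>. norm (R y v) \<le> norm (K * exp (2 * c * (norm (emb v))\<^sup>2))"
      using R0 by (intro AE_I2) (auto intro: order_trans[OF _ abs_ge_self])
  qed measurable
  have Wnorm: "integrable M (\<lambda>x. norm (emb (W y t x)))" if t: "0 \<le> t" for y t
  proof (rule integrable_norm_of_exponential[OF Wm[OF t] c0])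
    have "0 \<le> c * noise_sum b 0" using c0 noise_sum_0_nonneg[of b] by simp
    then have "2 * c * noise_sum b 0 \<le> \<nu>" using c2 by linarith
    then have "(\<integral>\<^sup>+x. ennreal (exp (c * (norm (emb (W y t x)))\<^sup>2)) \<partial>M)
        \<le> ennreal (exp (c * exp (- \<nu> * t) * (norm (emb y))\<^sup>2 + noise_sum b 0 * (c / \<nu>)))"
      using c0 by (intro exponential_moment_bound[OF N \<nu> b W _ _ t]) auto
    also have "\<dots> < \<infinity>" by simp
    finally show "integrable M (\<lambda>x. exp (c * (norm (emb (W y t x)))\<^sup>2))"
      by (intro integrableI_nonneg) (use measurable_compose[OF Wm[OF t] measurable_norm_emb] in measurable)
  qed
  have dist_le: "(\<integral>x. norm (emb (W y t x) - emb (W v t x)) \<partial>M) \<le> exp (- lam * t) * R y v"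
    and dist_i: "integrable M (\<lambda>x. norm (emb (W y t x) - emb (W v t x)))" if t: "0 \<le> t" for y v t
  proof -
    show i: "integrable M (\<lambda>x. norm (emb (W y t x) - emb (W v t x)))"
    proof (rule Bochner_Integration.integrable_bound)
      show "integrable M (\<lambda>x. norm (emb (W y t x)) + norm (emb (W v t x)))" using Wnorm[OF t] by simp
      have "(\<lambda>x. W y t x - W v t x) \<in> borel_measurable M" using Wm[OF t] by simp
      from measurable_compose[OF this measurable_norm_emb]
      show "(\<lambda>x. norm (emb (W y t x) - emb (W v t x))) \<in> borel_measurable M" by (simp add: emb_diff)
    qed (auto intro!: norm_triangle_ineq4)
    have "ennreal (\<integral>x. norm (emb (W y t x) - emb (W v t x)) \<partial>M) = (\<integral>\<^sup>+x. ennreal (norm (emb (W y t x) - emb (W v t x))) \<partial>M)"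
      by (rule nn_integral_eq_integral[symmetric, OF i]) simp
    also have "\<dots> \<le> ennreal (exp (- lam * t) * R y v)"
      using expected_distance_decay[OF N \<nu> p b C small W(1)[of y] W(2)[of y] W(1)[of v] W(2)[of v] t]
      by (simp add: R_def lam_def c_def mult_ac)
    finally show "(\<integral>x. norm (emb (W y t x) - emb (W v t x)) \<partial>M) \<le> exp (- lam * t) * R y v"
      using R0 by (simp add: ennreal_le_iff)
  qed
  show ?thesis
  proof (rule exI[of _ lam], rule conjI[OF lam], rule allI)
    fix y
    show "\<exists>C. \<forall>\<phi> :: hsp \<Rightarrow> real. (\<exists>L. L-lipschitz_on UNIV \<phi>) \<longrightarrow>
      (\<forall>t\<ge>0. integrable M (\<lambda>x. \<phi> (emb (W y t x))) \<and> integrable \<mu> (\<lambda>v. \<phi> (emb v)) \<and>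
       \<bar>transition M W t (\<lambda>v. \<phi> (emb v)) y - (\<integral>v. \<phi> (emb v) \<partial>\<mu>)\<bar> \<le> C * lip_norm \<phi> * exp (- lam * t))"
    \<comment> \<open>The constant is the average over \<mu> of the contraction bound between the
      solutions from \<open>y\<close> and from a random starting point; it does not depend on
      \<open>\<phi>\<close>.\<close>
    proof (intro exI[of _ "\<integral>v. R y v \<partial>\<mu>"] allI impI)
      fix \<phi> :: "hsp \<Rightarrow> real" and t :: real
      assume "\<exists>L. L-lipschitz_on UNIV \<phi>" and t: "0 \<le> t"
      then have \<phi>: "(lip_norm \<phi>)-lipschitz_on UNIV \<phi>" and L0: "0 \<le> lip_norm \<phi>" using lip_norm_lipschitz by blast+
      define L where "L = lip_norm \<phi>"
      have \<phi>W: "integrable M (\<lambda>x. \<phi> (emb (W v t x)))" for v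
        by (rule M.integrable_lipschitz_emb[OF \<phi> Wm[OF t] Wnorm[OF t]])
      have \<phi>\<mu>: "integrable \<mu> (\<lambda>v. \<phi> (emb v))"
        by (rule \<mu>.integrable_lipschitz_emb[OF \<phi> _ \<mu>norm]) simp
      have \<phi>m [measurable]: "(\<lambda>v. \<phi> (emb v)) \<in> borel_measurable borel"
        using \<phi>\<mu> by (simp add: measurable_cong_sets[OF s\<mu> refl] borel_measurable_integrable)
      have trunc: "\<bar>transition M W t (\<lambda>v. truncate (real n) (\<phi> (emb v))) y - (\<integral>v. truncate (real n) (\<phi> (emb v)) \<partial>\<mu>)\<bar>
          \<le> (\<integral>v. R y v \<partial>\<mu>) * L * exp (- lam * t)" for n
      proof -
        define f where "f v = truncate (real n) (\<phi> (emb v))" for v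
        have fm [measurable]: "f \<in> borel_measurable borel" unfolding f_def[abs_def] by measurable
        have fb: "\<bar>f v\<bar> \<le> real n" for v by (simp add: f_def truncate_bounds)
        note inv = invariant_measure_integrable[OF \<mu> M.prob_space_axioms Wm[OF t] t fm fb]
        have fW: "integrable M (\<lambda>x. f (W v t x))" for v
          by (rule M.integrable_const_bound[of _ "real n"]) (use measurable_compose[OF Wm[OF t] fm] fb in auto)
        \<comment> \<open>Synchronous coupling: the solutions from \<open>y\<close> and
          \<open>v\<close> are driven by the same noise, so their expected distance bounds the
          difference of the transitions.\<close>
        have diff: "\<bar>transition M W t f y - transition M W t f v\<bar> \<le> L * exp (- lam * t) * R y v" for v
        proof -
          have "\<bar>transition M W t f y - transition M W t f v\<bar> = \<bar>\<integral>x. f (W y t x) - f (W v t x) \<partial>M\<bar>"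
            unfolding transition_def by (simp add: fW)
          also have "\<dots> \<le> (\<integral>x. \<bar>f (W y t x) - f (W v t x)\<bar> \<partial>M)" by (rule integral_abs_bound)
          also have "\<dots> \<le> (\<integral>x. L * norm (emb (W y t x) - emb (W v t x)) \<partial>M)"
          proof (intro integral_mono integrable_abs Bochner_Integration.integrable_diff fW integrable_mult_right dist_i t)
            fix x
            have "\<bar>f (W y t x) - f (W v t x)\<bar> \<le> \<bar>\<phi> (emb (W y t x)) - \<phi> (emb (W v t x))\<bar>"
              unfolding f_def by (rule truncate_contraction)
            also have "\<dots> \<le> L * norm (emb (W y t x) - emb (W v t x))"
              using lipschitz_onD[OF \<phi>, of "emb (W y t x)" "emb (W v t x)"] by (simp add: L_def dist_norm)
            finally show "\<bar>f (W y t x) - f (W v t x)\<bar> \<le> L * norm (emb (W y t x) - emb (W v t x))" .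
          qed
          also have "\<dots> = L * (\<integral>x. norm (emb (W y t x) - emb (W v t x)) \<partial>M)" by simp
          also have "\<dots> \<le> L * (exp (- lam * t) * R y v)" unfolding L_def by (intro mult_left_mono dist_le t L0)
          finally show ?thesis by (simp add: mult.assoc)
        qed
        \<comment> \<open>By invariance the integral of \<open>f\<close> is that of its transition,
          so the difference is an average of differences between starting points.\<close>
        have "\<bar>transition M W t f y - (\<integral>v. f v \<partial>\<mu>)\<bar> = \<bar>\<integral>v. transition M W t f y - transition M W t f v \<partial>\<mu>\<bar>"
          using inv \<mu>.prob_space by simp
        also have "\<dots> \<le> (\<integral>v. \<bar>transition M W t f y - transition M W t f v\<bar> \<partial>\<mu>)" by (rule integral_abs_bound)
        also have "\<dots> \<le> (\<integral>v. L * exp (- lam * t) * R y v \<partial>\<mu>)"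
          by (intro integral_mono integrable_abs Bochner_Integration.integrable_diff inv integrable_mult_right Ri diff) auto
        also have "\<dots> = (\<integral>v. R y v \<partial>\<mu>) * L * exp (- lam * t)" by (simp add: mult_ac)
        finally show ?thesis unfolding f_def .
      qed
      have "(\<lambda>n. \<bar>transition M W t (\<lambda>v. truncate (real n) (\<phi> (emb v))) y - (\<integral>v. truncate (real n) (\<phi> (emb v)) \<partial>\<mu>)\<bar>)
          \<longlonglongrightarrow> \<bar>transition M W t (\<lambda>v. \<phi> (emb v)) y - (\<integral>v. \<phi> (emb v) \<partial>\<mu>)\<bar>"
        unfolding transition_def by (intro tendsto_intros integral_truncate_tendsto \<phi>W \<phi>\<mu>)
      then have "\<bar>transition M W t (\<lambda>v. \<phi> (emb v)) y - (\<integral>v. \<phi> (emb v) \<partial>\<mu>)\<bar> \<le> (\<integral>v. R y v \<partial>\<mu>) * L * exp (- lam * t)"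
        by (rule LIMSEQ_le_const2) (use trunc in blast)
      then show "integrable M (\<lambda>x. \<phi> (emb (W y t x))) \<and> integrable \<mu> (\<lambda>v. \<phi> (emb v)) \<and>
       \<bar>transition M W t (\<lambda>v. \<phi> (emb v)) y - (\<integral>v. \<phi> (emb v) \<partial>\<mu>)\<bar> \<le> (\<integral>v. R y v \<partial>\<mu>) * lip_norm \<phi> * exp (- lam * t)"
        using \<phi>W \<phi>\<mu> by (simp add: L_def)
    qed
  qed
qed

end
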